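(* Let $$L=-\Delta+R(x),\qquad R(x)=\sum_{1\le i<j\le n}\left(\frac{C_{ij}^+}{(x_i+x_j)^2}+\frac{C_{ij}^-}{(x_i-x_j)^2}\right)+\sum_{i=1}^n\frac{C_i}{x_i^2}+\widetilde R(x),$$ where $\widetilde R$ is real analytic at $x=0$ and the $C_{ij}^\pm,C_i$ are constants (some possibly zero). Let $\mathcal{H}$ be the set of those vectors among $e_i+e_j$, $e_i-e_j$ $(i<j)$ and $e_i$ whose coefficient ($C_{ij}^+$, $C_{ij}^-$, $C_i$ respectively) is non-zero. Assume that $\mathcal{H}$ is irreducible, that $R$ is generic, and that the group $W$ generated by $\{r_\alpha:\alpha\in\mathcal{H}\}$ is the reflection group of type $B_n$ ($n\ge2$) or of type $D_n$ ($n\ge4$), where in the type $D_n$ case $C_i=0$ for all $i$. Assume that $L$ commutes with a differential operator of the form $$P=\sum_{1\le i<j\le n}\partial_i^2\partial_j^2+\sum_{i=1}^n a_2^i\partial_i^2+\sum_{1\le i<j\le n}a_{11}^{ij}\partial_i\partial_j+\sum_{i=1}^n a_1^i\partial_i+a_0 .$$ Then $\mathcal{H}$ coincides with the positive root system of type $B_n$ or of type $D_n$. Moreover, the parameters are $W$-invariant: writing $C_\alpha$ for the coefficient attached to $\alpha\in\mathcal{H}$, one has $C_\alpha=C_\beta$ whenever $\beta\in\mathcal{H}$ and $\beta\in W\alpha\cup(-W\alpha)$.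
   Context: $e_1,\dots,e_n$ is the standard basis of $\mathbb{R}^n$, $\partial_i=\partial/\partial x_i$, $\Delta=\sum_i\partial_i^2$; $r_\alpha$ is the orthogonal reflection in $H_\alpha=\{x:\langle\alpha,x\rangle=0\}$. The positive root systems are $\{e_i\pm e_j:1\le i<j\le n\}\cup\{e_i:1\le i\le n\}$ for type $B_n$ and $\{e_i\pm e_j:1\le i<j\le n\}$ for type $D_n$; the reflection groups of type $B_n$ and $D_n$ are those generated by the reflections in these vectors. Constants and functions may be complex-valued. Let $U$ be an open ball centred at $0$ on which $\widetilde R$ is real analytic; $L$ is considered on $D=U\setminus\bigcup_{\alpha\in\mathcal{H}}H_\alpha$, and the coefficients of $P$ are real analytic functions on $D$. Irreducible: $\mathcal{H}$ spans $\mathbb{R}^n$ and cannot be partitioned into the union of two proper subsets such that each vector in one is orthogonal to each vector in the other. Generic: $C_\alpha\ne k(k+1)\langle\alpha,\alpha\rangle$ for every integer $k$ and every $\alpha\in\mathcal{H}$. *)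

theory Defs
  imports "HOL-Analysis.Analysis" "HOL-Algebra.Bij" "HOL-Algebra.Generated_Groups"
begin

text \<open>
  The index set \<open>{1..n}\<close> is modelled by an arbitrary finite linearly ordered type \<open>'n\<close>, so that
  \<open>n = CARD('n)\<close> and \<open>e\<^sub>i = axis i 1\<close>.
\<close>


section \<open>Root systems, reflections and reflection groups\<close>

definition roots_D :: "(real ^ ('n::{finite,linorder})) set" where
  "roots_D = {axis i 1 + axis j 1 | i j. i < j} \<union> {axis i 1 - axis j 1 | i j. i < j}"

definition roots_B :: "(real ^ ('n::{finite,linorder})) set" where
  "roots_B = roots_D \<union> {axis i 1 | i. True}"

definition reflection :: "'a::real_inner \<Rightarrow> 'a \<Rightarrow> 'a" where
  "reflection \<alpha> x = x - (2 * (\<alpha> \<bullet> x) / (\<alpha> \<bullet> \<alpha>)) *\<^sub>R \<alpha>"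

definition reflection_group :: "'a::real_inner set \<Rightarrow> ('a \<Rightarrow> 'a) set" where
  "reflection_group A = generate (BijGroup UNIV) (reflection ` A)"

text \<open>
  Composition in \<open>BijGroup UNIV\<close> is the usual one only on its carrier, hence the following check.
\<close>

lemma reflection_in_BijGroup: "reflection \<alpha> \<in> carrier (BijGroup UNIV)"
proof -
  have "reflection \<alpha> (reflection \<alpha> x) = x" for x
    by (cases "\<alpha> = 0") (auto simp: reflection_def inner_diff_right)
  then have "bij (reflection \<alpha>)"
    by (intro o_bij[of "reflection \<alpha>"]) auto
  then show ?thesis
    by (simp add: BijGroup_def Bij_def)
qed

definition irreducible_vectors :: "'a::euclidean_space set \<Rightarrow> bool" where
  "irreducible_vectors H \<longleftrightarrow> span H = UNIV \<and>
     \<not> (\<exists>A B. A \<subset> H \<and> B \<subset> H \<and> A \<union> B = H \<and> A \<inter> B = {} \<and>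
          (\<forall>a\<in>A. \<forall>b\<in>B. orthogonal a b))"


section \<open>Partial derivatives, smooth and real analytic functions\<close>

definition partial :: "'n::finite \<Rightarrow> (real ^ 'n \<Rightarrow> complex) \<Rightarrow> real ^ 'n \<Rightarrow> complex" where
  "partial i f x = vector_derivative (\<lambda>t. f (x + t *\<^sub>R axis i 1)) (at 0)"

text \<open>
  On an open set this is \<open>C\<^sup>\<infinity>\<close>: all iterated partial derivatives are Frechet differentiable, in
  particular continuous.
\<close>

definition smooth_on :: "(real ^ 'n::finite) set \<Rightarrow> (real ^ 'n \<Rightarrow> complex) \<Rightarrow> bool" where
  "smooth_on S f \<longleftrightarrow> (\<forall>is. foldr partial is f differentiable_on S)"

text \<open>
  Multi-indices are functions \<open>'n \<Rightarrow> nat\<close>, and the multiple power series converges unconditionally.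
\<close>

definition real_analytic_on :: "(real ^ 'n::finite) set \<Rightarrow> (real ^ 'n \<Rightarrow> complex) \<Rightarrow> bool" where
  "real_analytic_on S f \<longleftrightarrow>
     (\<forall>a\<in>S. \<exists>\<epsilon>>0. \<exists>c :: ('n \<Rightarrow> nat) \<Rightarrow> complex. \<forall>x\<in>ball a \<epsilon>.
        ((\<lambda>m. c m * of_real (\<Prod>i\<in>UNIV. (x $ i - a $ i) ^ m i)) has_sum f x) UNIV)"


section \<open>The Schroedinger operator\<close>

text \<open>
  \<open>Cp i j\<close>, \<open>Cm i j\<close>, \<open>C1 i\<close> are \<open>C\<^sub>i\<^sub>j\<^sup>+\<close>, \<open>C\<^sub>i\<^sub>j\<^sup>-\<close>, \<open>C\<^sub>i\<close>; only the values of \<open>Cp\<close>, \<open>Cm\<close> with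
  \<open>i < j\<close> matter. Since division by zero yields zero, the terms with vanishing constant
  contribute nothing even on their hyperplane.
\<close>

definition potential ::
  "('n \<Rightarrow> 'n \<Rightarrow> complex) \<Rightarrow> ('n \<Rightarrow> 'n \<Rightarrow> complex) \<Rightarrow> ('n \<Rightarrow> complex) \<Rightarrow>
   (real ^ ('n::{finite,linorder}) \<Rightarrow> complex) \<Rightarrow> real ^ 'n::_ \<Rightarrow> complex" where
  "potential Cp Cm C1 Rt x =
     (\<Sum>i\<in>UNIV. \<Sum>j | i < j.
        Cp i j / of_real ((x $ i + x $ j)\<^sup>2) + Cm i j / of_real ((x $ i - x $ j)\<^sup>2))
     + (\<Sum>i\<in>UNIV. C1 i / of_real ((x $ i)\<^sup>2)) + Rt x"

definition singular_vectors ::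
  "('n \<Rightarrow> 'n \<Rightarrow> complex) \<Rightarrow> ('n \<Rightarrow> 'n \<Rightarrow> complex) \<Rightarrow> ('n \<Rightarrow> complex) \<Rightarrow>
   (real ^ ('n::{finite,linorder})) set" where
  "singular_vectors Cp Cm C1 =
     {axis i 1 + axis j 1 | i j. i < j \<and> Cp i j \<noteq> 0} \<union>
     {axis i 1 - axis j 1 | i j. i < j \<and> Cm i j \<noteq> 0} \<union>
     {axis i 1 | i. C1 i \<noteq> 0}"

text \<open>
  The coefficient \<open>C\<^sub>\<alpha>\<close> attached to a vector. At most one summand is non-zero, because the vectors
  \<open>e\<^sub>i \<plusminus> e\<^sub>j\<close> (\<open>i < j\<close>) and \<open>e\<^sub>i\<close> are pairwise distinct; see the three evaluation lemmas below.
\<close>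

definition coefficient ::
  "('n \<Rightarrow> 'n \<Rightarrow> complex) \<Rightarrow> ('n \<Rightarrow> 'n \<Rightarrow> complex) \<Rightarrow> ('n \<Rightarrow> complex) \<Rightarrow>
   real ^ ('n::{finite,linorder}) \<Rightarrow> complex" where
  "coefficient Cp Cm C1 \<alpha> =
     (\<Sum>i\<in>UNIV. \<Sum>j | i < j.
        (if \<alpha> = axis i 1 + axis j 1 then Cp i j else 0) +
        (if \<alpha> = axis i 1 - axis j 1 then Cm i j else 0))
     + (\<Sum>i\<in>UNIV. if \<alpha> = axis i 1 then C1 i else 0)"

lemma plus_eq_plus:
  fixes i j k l :: "'n::{finite,linorder}"
  assumes "i < j" "k < l"
  shows "(axis i 1 + axis j 1 :: real ^ 'n::_) = axis k 1 + axis l 1 \<longleftrightarrow> i = k \<and> j = l"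
proof
  assume eq: "(axis i 1 + axis j 1 :: real ^ 'n::_) = axis k 1 + axis l 1"
  have "(axis i 1 + axis j 1 :: real ^ 'n::_) $ m = (axis k 1 + axis l 1) $ m" for m
    by (simp only: eq)
  from this[of i] this[of j] this[of k] this[of l] show "i = k \<and> j = l"
    using assms by (auto simp: axis_def split: if_splits)
qed auto

lemma minus_eq_minus:
  fixes i j k l :: "'n::{finite,linorder}"
  assumes "i < j" "k < l"
  shows "(axis i 1 - axis j 1 :: real ^ 'n::_) = axis k 1 - axis l 1 \<longleftrightarrow> i = k \<and> j = l"
proof
  assume eq: "(axis i 1 - axis j 1 :: real ^ 'n::_) = axis k 1 - axis l 1"
  have "(axis i 1 - axis j 1 :: real ^ 'n::_) $ m = (axis k 1 - axis l 1) $ m" for m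
    by (simp only: eq)
  from this[of i] this[of j] this[of k] this[of l] show "i = k \<and> j = l"
    using assms by (auto simp: axis_def split: if_splits)
qed auto

lemma coordinate_sums:
  fixes i j :: "'n::finite"
  shows "(\<Sum>m\<in>UNIV. (axis i 1 + axis j 1 :: real ^ 'n) $ m) = 2"
    and "(\<Sum>m\<in>UNIV. (axis i 1 - axis j 1 :: real ^ 'n) $ m) = 0"
    and "(\<Sum>m\<in>UNIV. (axis i 1 :: real ^ 'n) $ m) = 1"
  by (simp_all add: axis_def sum.distrib sum_subtractf)

lemma vectors_distinct:
  fixes i j k l :: "'n::finite"
  shows "(axis i 1 + axis j 1 :: real ^ 'n) \<noteq> axis k 1 - axis l 1"
    and "(axis i 1 - axis j 1 :: real ^ 'n) \<noteq> axis k 1 + axis l 1"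
    and "(axis i 1 + axis j 1 :: real ^ 'n) \<noteq> axis k 1"
    and "(axis k 1 :: real ^ 'n) \<noteq> axis i 1 + axis j 1"
    and "(axis i 1 - axis j 1 :: real ^ 'n) \<noteq> axis k 1"
    and "(axis k 1 :: real ^ 'n) \<noteq> axis i 1 - axis j 1"
proof -
  have ne: "(2::real) \<noteq> 0" "(2::real) \<noteq> 1" "(0::real) \<noteq> 1"
    by simp_all
  show "(axis i 1 + axis j 1 :: real ^ 'n) \<noteq> axis k 1 - axis l 1"
    and "(axis i 1 - axis j 1 :: real ^ 'n) \<noteq> axis k 1 + axis l 1"
    and "(axis i 1 + axis j 1 :: real ^ 'n) \<noteq> axis k 1"
    and "(axis k 1 :: real ^ 'n) \<noteq> axis i 1 + axis j 1"
    and "(axis i 1 - axis j 1 :: real ^ 'n) \<noteq> axis k 1"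
    and "(axis k 1 :: real ^ 'n) \<noteq> axis i 1 - axis j 1"
    using ne by (metis coordinate_sums)+
qed

lemma double_sum_delta:
  fixes f :: "'n::{finite,linorder} \<Rightarrow> 'n \<Rightarrow> 'b::comm_monoid_add"
  assumes "k < l"
  shows "(\<Sum>i\<in>UNIV. \<Sum>j | i < j. if k = i \<and> l = j then f i j else 0) = f k l"
proof -
  have "(\<Sum>j | i < j. if k = i \<and> l = j then f i j else 0) = (if k = i then f k l else 0)" for i
    using assms by (cases "k = i") (auto simp: sum.delta')
  then show ?thesis
    by simp
qed

lemma coefficient_plus:
  assumes "k < l"
  shows "coefficient Cp Cm C1 (axis k 1 + axis l 1) = Cp k l"
proof -
  have "coefficient Cp Cm C1 (axis k 1 + axis l 1) =
    (\<Sum>i\<in>UNIV. \<Sum>j | i < j. if k = i \<and> l = j then Cp i j else 0)"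
    using assms unfolding coefficient_def
    by (auto simp: vectors_distinct plus_eq_plus intro!: sum.cong)
  then show ?thesis
    using assms by (simp only: double_sum_delta)
qed

lemma coefficient_minus:
  assumes "k < l"
  shows "coefficient Cp Cm C1 (axis k 1 - axis l 1) = Cm k l"
proof -
  have "coefficient Cp Cm C1 (axis k 1 - axis l 1) =
    (\<Sum>i\<in>UNIV. \<Sum>j | i < j. if k = i \<and> l = j then Cm i j else 0)"
    using assms unfolding coefficient_def
    by (auto simp: vectors_distinct minus_eq_minus intro!: sum.cong)
  then show ?thesis
    using assms by (simp only: double_sum_delta)
qed

lemma coefficient_axis: "coefficient Cp Cm C1 (axis k 1) = C1 k"
  unfolding coefficient_def by (simp add: vectors_distinct axis_eq_axis)

text \<open>Genericity does not involve the analytic part of the potential.\<close>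

definition generic ::
  "('n \<Rightarrow> 'n \<Rightarrow> complex) \<Rightarrow> ('n \<Rightarrow> 'n \<Rightarrow> complex) \<Rightarrow> ('n::{finite,linorder} \<Rightarrow> complex) \<Rightarrow> bool"
where
  "generic Cp Cm C1 \<longleftrightarrow>
     (\<forall>\<alpha>\<in>singular_vectors Cp Cm C1. \<forall>k::int.
        coefficient Cp Cm C1 \<alpha> \<noteq> of_int (k * (k + 1)) * of_real (\<alpha> \<bullet> \<alpha>))"

definition schroedinger_op ::
  "(real ^ 'n::finite \<Rightarrow> complex) \<Rightarrow> (real ^ 'n \<Rightarrow> complex) \<Rightarrow> real ^ 'n \<Rightarrow> complex" where
  "schroedinger_op R f x = - (\<Sum>i\<in>UNIV. partial i (partial i f) x) + R x * f x"


section \<open>The commuting operator\<close>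

definition quartic_op ::
  "('n \<Rightarrow> real ^ 'n::_ \<Rightarrow> complex) \<Rightarrow> ('n \<Rightarrow> 'n \<Rightarrow> real ^ 'n::_ \<Rightarrow> complex) \<Rightarrow>
   ('n \<Rightarrow> real ^ 'n::_ \<Rightarrow> complex) \<Rightarrow> (real ^ 'n::_ \<Rightarrow> complex) \<Rightarrow>
   (real ^ ('n::{finite,linorder}) \<Rightarrow> complex) \<Rightarrow> real ^ 'n::_ \<Rightarrow> complex" where
  "quartic_op a2 a11 a1 a0 f x =
     (\<Sum>i\<in>UNIV. \<Sum>j | i < j. partial i (partial i (partial j (partial j f))) x)
     + (\<Sum>i\<in>UNIV. a2 i x * partial i (partial i f) x)
     + (\<Sum>i\<in>UNIV. \<Sum>j | i < j. a11 i j x * partial i (partial j f) x)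
     + (\<Sum>i\<in>UNIV. a1 i x * partial i f x)
     + a0 x * f x"

definition commute_on ::
  "(real ^ 'n::finite) set \<Rightarrow> ((real ^ 'n \<Rightarrow> complex) \<Rightarrow> real ^ 'n \<Rightarrow> complex) \<Rightarrow>
   ((real ^ 'n \<Rightarrow> complex) \<Rightarrow> real ^ 'n \<Rightarrow> complex) \<Rightarrow> bool" where
  "commute_on D L P \<longleftrightarrow> (\<forall>f. smooth_on D f \<longrightarrow> (\<forall>x\<in>D. L (P f) x = P (L f) x))"

end

theory Submission
  imports Defs
begin

text \<open>
  Testing the commutation relation on the exponentials \<open>exp (\<lambda> \<bullet> x)\<close> turns it into polynomial
  identities in \<open>\<lambda>\<close>.  Write \<open>M\<close> for the symmetric matrix of the second-order coefficients of \<open>P\<close>,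
  with the potential \<open>R\<close> added on the diagonal.  The identities of highest degree read
  \<open>\<partial>\<^sub>i M\<^sub>j\<^sub>k + \<partial>\<^sub>j M\<^sub>k\<^sub>i + \<partial>\<^sub>k M\<^sub>i\<^sub>j = 3 \<delta>\<^sub>i\<^sub>j\<^sub>k \<partial>\<^sub>i R\<close>, and those of degree one say that the vector field
  \<open>M \<nabla>R\<close> is curl free.  Near a generic point of the hyperplane of \<open>\<alpha>\<close> one has
  \<open>R = C / (\<alpha> \<bullet> x)\<^sup>2 + S\<close> with \<open>S\<close> smooth.  The most singular terms of the curl equation force
  \<open>M(\<alpha>, \<beta>)\<close> to vanish on the hyperplane for \<open>\<beta>\<close> orthogonal to \<open>\<alpha>\<close>, and then the first identity gives
  \<open>\<partial>\<^sub>\<alpha> \<partial>\<^sub>\<beta> S = 0\<close> there.  Letting the point tend to the origin along a ray isolates the homogeneous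
  part of \<open>S\<close>, which is a sum over the other roots; its poles can only cancel if the roots
  exchanged by the reflection in \<open>\<alpha>\<close> carry equal coefficients.
\<close>

section \<open>Smooth functions\<close>

text \<open>The coefficients of P are analytic only off the hyperplanes, so nothing bounds M near a
  wall in advance. Bounds are won by integrating along lines normal to the wall: the cubic identity
  expresses the relevant normal derivatives through R and M(\<alpha>, \<alpha>) - R, which is
  constant on these lines. In the curl equation M(\<alpha>, \<beta>) then carries a pole of order
  four against terms of order at most three. Tangential derivatives of M have no known limit at the
  wall either, so they enter through second differences.

  That M \<nabla>R is curl free is not the degree-one identity alone: it contains the first-order
  coefficients of P, whose Laplacian has to be computed from the divergence of the degree-two
  identity. What remains besides gradients is a vector of third derivatives of R; its curl vanishes
  by a fourth-order compatibility condition of the cubic identity.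

  The cubic identity is tied to the coordinate axes. It is used for directions \<beta> whose
  coordinatewise products with \<alpha> give multiples of \<alpha> and \<beta> again; this is the
  origin of \<kappa>, and 3\<kappa> - 1 is the factor in front of the mixed derivative of S.\<close>

lemma has_derivative_line:
  fixes f :: "'a::real_normed_vector \<Rightarrow> complex"
  assumes "(f has_derivative f') (at (x + t *\<^sub>R u))"
  shows "((\<lambda>t. f (x + t *\<^sub>R u)) has_vector_derivative f' u) (at t)"
proof -
  have "((\<lambda>t. x + t *\<^sub>R u) has_derivative (\<lambda>t. t *\<^sub>R u)) (at t)"
    by (auto intro!: derivative_eq_intros)
  from has_derivative_compose[OF this assms]
  have "((\<lambda>t. f (x + t *\<^sub>R u)) has_derivative (\<lambda>s. f' (s *\<^sub>R u))) (at t)" .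
  moreover have "linear f'"
    using assms has_derivative_linear by blast
  ultimately show ?thesis
    by (simp add: has_vector_derivative_def linear_scale)
qed

lemma partial_eqI:
  assumes "(f has_derivative f') (at x)"
  shows "partial i f x = f' (axis i 1)"
  using has_derivative_line[of f f' x 0] assms
  unfolding partial_def by (intro vector_derivative_at) simp

lemma has_derivative_partial:
  fixes f :: "real ^ 'n::finite \<Rightarrow> complex"
  assumes "f differentiable (at x)"
  shows "(f has_derivative (\<lambda>h. \<Sum>i\<in>UNIV. of_real (h $ i) * partial i f x)) (at x)"
proof -
  obtain f' where f': "(f has_derivative f') (at x)"
    using assms differentiable_def by blast
  have "f' h = (\<Sum>i\<in>UNIV. of_real (h $ i) * partial i f x)" for h
  proof -
    have "linear f'"
      using f' has_derivative_linear by blast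
    have "f' h = f' (\<Sum>i\<in>UNIV. h $ i *\<^sub>R axis i 1)"
      by (subst basis_expansion[of h, symmetric], simp add: scalar_mult_eq_scaleR)
    also have "\<dots> = (\<Sum>i\<in>UNIV. of_real (h $ i) * partial i f x)"
      using linear_scale[OF \<open>linear f'\<close>] f'
      by (simp only: linear_sum[OF \<open>linear f'\<close>] partial_eqI[OF f'] scaleR_conv_of_real)
    finally show ?thesis .
  qed
  then show ?thesis
    using f' by (metis (no_types, lifting) ext)
qed

lemma partial_cong:
  assumes "open S" "x \<in> S" "\<And>y. y \<in> S \<Longrightarrow> f y = g y"
  shows "partial i f x = partial i g x"
proof -
  have "eventually (\<lambda>t. x + t *\<^sub>R axis i 1 \<in> S) (at (0::real))"
  proof (rule topological_tendstoD[OF _ assms(1)])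
    have "((\<lambda>t. x + t *\<^sub>R axis i 1) \<longlongrightarrow> x + (0::real) *\<^sub>R axis i 1) (at 0)"
      by (intro tendsto_intros)
    then show "((\<lambda>t. x + t *\<^sub>R axis i 1) \<longlongrightarrow> x) (at (0::real))" by simp
  qed (use assms in auto)
  then have "eventually (\<lambda>t. x + t *\<^sub>R axis i 1 \<in> S) (nhds (0::real))"
    using assms(2) by (simp add: eventually_at_filter eventually_nhds) force
  then have "eventually (\<lambda>t. t \<in> UNIV \<longrightarrow> f (x + t *\<^sub>R axis i 1) = g (x + t *\<^sub>R axis i 1)) (nhds (0::real))"
    using assms(3) by (auto elim: eventually_mono)
  then show ?thesis
    unfolding partial_def
    by (intro vector_derivative_cong_eq) auto
qed

lemma partial_add:
  assumes "f differentiable (at x)" "g differentiable (at x)"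
  shows "partial i (\<lambda>x. f x + g x) x = partial i f x + partial i g x"
proof -
  obtain f' g' where "(f has_derivative f') (at x)" "(g has_derivative g') (at x)"
    using assms differentiable_def by blast
  then show ?thesis
    using partial_eqI[OF has_derivative_add, of f f' x g g' i] by (simp add: partial_eqI)
qed

lemma partial_sum:
  assumes "\<And>k. k \<in> K \<Longrightarrow> f k differentiable (at x)"
  shows "partial i (\<lambda>x. \<Sum>k\<in>K. f k x) x = (\<Sum>k\<in>K. partial i (f k) x)"
proof -
  have "((\<lambda>x. \<Sum>k\<in>K. f k x) has_derivative (\<lambda>h. \<Sum>k\<in>K. frechet_derivative (f k) (at x) h)) (at x)"
    using assms by (intro has_derivative_sum) (simp add: frechet_derivative_works)
  then have "partial i (\<lambda>x. \<Sum>k\<in>K. f k x) x = (\<Sum>k\<in>K. frechet_derivative (f k) (at x) (axis i 1))"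
    by (rule partial_eqI)
  also have "\<dots> = (\<Sum>k\<in>K. partial i (f k) x)"
    using assms by (intro sum.cong refl) (metis frechet_derivative_works partial_eqI)
  finally show ?thesis .
qed

lemma partial_mult:
  assumes "f differentiable (at x)" "g differentiable (at x)"
  shows "partial i (\<lambda>x. f x * g x) x = partial i f x * g x + f x * partial i g x"
proof -
  obtain f' g' where "(f has_derivative f') (at x)" "(g has_derivative g') (at x)"
    using assms differentiable_def by blast
  then show ?thesis
    using partial_eqI[OF has_derivative_mult, of f f' x g g' i] by (simp add: partial_eqI)
qed

lemma partial_const [simp]: "partial i (\<lambda>x. c) x = 0"
  using partial_eqI[OF has_derivative_const] .

lemma partial_const_fun [simp]: "partial i (\<lambda>x. c) = (\<lambda>x. 0)"
  by (rule ext) simp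

lemma partial_cmult:
  assumes "f differentiable (at x)"
  shows "partial i (\<lambda>x. c * f x) x = c * partial i f x"
  using partial_mult[OF differentiable_const assms] by simp

lemma smooth_on_differentiable_on: "smooth_on S f \<Longrightarrow> f differentiable_on S"
  unfolding smooth_on_def by (metis foldr_Nil id_apply)

lemma smooth_on_differentiable:
  assumes "smooth_on S f" "open S" "x \<in> S"
  shows "f differentiable (at x)"
proof -
  have "foldr partial [] f differentiable_on S"
    using assms unfolding smooth_on_def by blast
  then show ?thesis
    using assms by (simp add: differentiable_on_eq_differentiable_at)
qed

lemma smooth_on_partial: "smooth_on S f \<Longrightarrow> smooth_on S (partial i f)"
  unfolding smooth_on_def
proof
  fix "is"
  assume "\<forall>is. foldr partial is f differentiable_on S"
  then have "foldr partial (is @ [i]) f differentiable_on S" by blast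
  then show "foldr partial is (partial i f) differentiable_on S" by simp
qed

lemma differentiable_on_cong:
  assumes "g differentiable_on S" "\<And>x. x \<in> S \<Longrightarrow> f x = g x"
  shows "f differentiable_on S"
  unfolding differentiable_on_def
proof
  fix x assume x: "x \<in> S"
  then obtain g' where "(g has_derivative g') (at x within S)"
    using assms(1) unfolding differentiable_on_def differentiable_def by blast
  then have "(f has_derivative g') (at x within S)"
    by (rule has_derivative_transform[OF x, rotated]) (rule assms(2))
  then show "f differentiable at x within S"
    by (rule differentiableI)
qed

text \<open>An invariant for iterated differentiation: every iterated partial derivative agrees on S
  with a member of the class K. Agreement on S is enough because S is open and
  \<open>partial\<close> is local. The closure proofs for smoothness thereby reduce to naming a
  suitable K.\<close>

lemma smooth_on_coinduct:
  assumes "open S" "K f"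
    and diff: "\<And>g. K g \<Longrightarrow> g differentiable_on S"
    and step: "\<And>g i. K g \<Longrightarrow> \<exists>h. K h \<and> (\<forall>x\<in>S. partial i g x = h x)"
  shows "smooth_on S f"
  unfolding smooth_on_def
proof
  fix "is"
  have "\<exists>h. K h \<and> (\<forall>x\<in>S. foldr partial is f x = h x)"
  proof (induction "is")
    case Nil
    show ?case using \<open>K f\<close> by (intro exI[of _ f]) simp
  next
    case (Cons i "is")
    then obtain h where h: "K h" "\<forall>x\<in>S. foldr partial is f x = h x" by blast
    obtain h' where h': "K h'" "\<forall>x\<in>S. partial i h x = h' x"
      using step[OF h(1)] by blast
    have "\<forall>x\<in>S. partial i (foldr partial is f) x = partial i h x"
      using h(2) by (intro ballI partial_cong[OF assms(1)]) auto
    then show ?case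
      using h' by (intro exI[of _ h']) simp
  qed
  then obtain h where "K h" "\<forall>x\<in>S. foldr partial is f x = h x" by blast
  then show "foldr partial is f differentiable_on S"
    by (intro differentiable_on_cong[OF diff]) auto
qed

lemma smooth_on_const [simp]:
  assumes "open S"
  shows "smooth_on S (\<lambda>x. c)"
proof (rule smooth_on_coinduct[OF assms, where K = "\<lambda>g. \<exists>c. g = (\<lambda>x. c)"])
  fix g :: "real ^ 'a::finite \<Rightarrow> complex" and i
  assume "\<exists>c. g = (\<lambda>x. c)"
  then obtain c where g: "g = (\<lambda>x. c)" by blast
  show "g differentiable_on S"
    unfolding g by (rule differentiable_on_const)
  show "\<exists>h. (\<exists>c. h = (\<lambda>x. c)) \<and> (\<forall>x\<in>S. partial i g x = h x)"
    unfolding g by (intro exI[of _ "\<lambda>x. 0"]) auto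
qed blast

lemma smooth_on_sum:
  fixes f :: "'k \<Rightarrow> real ^ 'n::finite \<Rightarrow> complex"
  assumes "open S" "\<And>k. k \<in> K \<Longrightarrow> smooth_on S (f k)"
  shows "smooth_on S (\<lambda>x. \<Sum>k\<in>K. f k x)"
proof (rule smooth_on_coinduct[OF assms(1), where K = "\<lambda>g. \<exists>f. (\<forall>k\<in>K. smooth_on S (f k)) \<and> g = (\<lambda>x. \<Sum>k\<in>K. f k x)"])
  fix g :: "real ^ 'n::finite \<Rightarrow> complex" and i
  assume "\<exists>f. (\<forall>k\<in>K. smooth_on S (f k)) \<and> g = (\<lambda>x. \<Sum>k\<in>K. f k x)"
  then obtain f where f: "\<And>k. k \<in> K \<Longrightarrow> smooth_on S (f k)" "g = (\<lambda>x. \<Sum>k\<in>K. f k x)"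
    by blast
  note d = smooth_on_differentiable[OF f(1) assms(1)]
  \<comment> \<open>An infinite K is covered as well: the sum is then 0 by convention.\<close>
  show "g differentiable_on S"
    unfolding f(2) differentiable_on_eq_differentiable_at[OF assms(1)]
    using d by (cases "finite K") (auto intro!: differentiable_sum)
  show "\<exists>h. (\<exists>f. (\<forall>k\<in>K. smooth_on S (f k)) \<and> h = (\<lambda>x. \<Sum>k\<in>K. f k x)) \<and> (\<forall>x\<in>S. partial i g x = h x)"
    unfolding f(2) using f(1) d
    by (intro exI[of _ "\<lambda>x. \<Sum>k\<in>K. partial i (f k) x"] conjI exI[of _ "\<lambda>k. partial i (f k)"])
      (auto simp: smooth_on_partial partial_sum)
qed (use assms(2) in \<open>intro exI[of _ f], simp\<close>)

lemma smooth_on_add: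
  assumes "open S" "smooth_on S f" "smooth_on S g"
  shows "smooth_on S (\<lambda>x. f x + g x)"
proof -
  \<comment> \<open>Addition is the sum over the two-element index type \<open>bool\<close>, so the
    closure argument is not repeated.\<close>
  have "smooth_on S (\<lambda>x. \<Sum>b\<in>UNIV. (if b then f else g) x)"
    by (rule smooth_on_sum) (use assms in auto)
  moreover have "(\<lambda>x. \<Sum>b\<in>UNIV. (if b then f else g) x) = (\<lambda>x. f x + g x)"
    by (rule ext) (simp add: UNIV_bool)
  ultimately show ?thesis by simp
qed

lemma smooth_on_cmult:
  assumes "open S" "smooth_on S f"
  shows "smooth_on S (\<lambda>x. c * f x)"
proof (rule smooth_on_coinduct[OF assms(1), where K = "\<lambda>g. \<exists>f. smooth_on S f \<and> g = (\<lambda>x. c * f x)"])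
  fix g :: "real ^ 'a::finite \<Rightarrow> complex" and i
  assume "\<exists>f. smooth_on S f \<and> g = (\<lambda>x. c * f x)"
  then obtain f where f: "smooth_on S f" "g = (\<lambda>x. c * f x)" by blast
  note d = smooth_on_differentiable[OF f(1) assms(1)]
  show "g differentiable_on S"
    unfolding f(2) differentiable_on_eq_differentiable_at[OF assms(1)]
    using d by (auto intro!: differentiable_mult)
  show "\<exists>h. (\<exists>f. smooth_on S f \<and> h = (\<lambda>x. c * f x)) \<and> (\<forall>x\<in>S. partial i g x = h x)"
    unfolding f(2) using f(1) d
    by (intro exI[of _ "\<lambda>x. c * partial i f x"] conjI exI[of _ "partial i f"])
      (auto simp: smooth_on_partial partial_cmult)
qed (use assms(2) in \<open>intro exI[of _ f], simp\<close>)

lemma smooth_on_diff: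
  assumes "open S" "smooth_on S f" "smooth_on S g"
  shows "smooth_on S (\<lambda>x. f x - g x)"
  using smooth_on_add[OF assms(1,2) smooth_on_cmult[OF assms(1,3), of "-1"]] by simp

lemma partial_diff:
  assumes "f differentiable (at x)" "g differentiable (at x)"
  shows "partial i (\<lambda>x. f x - g x) x = partial i f x - partial i g x"
proof -
  obtain f' g' where "(f has_derivative f') (at x)" "(g has_derivative g') (at x)"
    using assms differentiable_def by blast
  then show ?thesis
    using partial_eqI[OF has_derivative_diff, of f f' x g g' i] by (simp add: partial_eqI)
qed

section \<open>Directional derivatives and symmetry of second derivatives\<close>

text \<open>Taken as a combination of partial derivatives rather than as a limit along u, it is
  linear in u by construction and inherits smoothness from the closure lemmas;
  \<open>dird_line\<close> ties it to the derivative along a line.\<close>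

definition dird :: "real ^ 'n \<Rightarrow> (real ^ 'n \<Rightarrow> complex) \<Rightarrow> real ^ 'n::finite \<Rightarrow> complex" where
  "dird u f x = (\<Sum>i\<in>UNIV. of_real (u $ i) * partial i f x)"

lemma axis_sum:
  fixes g :: "'n::finite \<Rightarrow> complex"
  shows "(\<Sum>i\<in>UNIV. of_real (axis k 1 $ i) * g i) = g k"
proof -
  have "(\<Sum>i\<in>UNIV. of_real (axis k 1 $ i) * g i) = (\<Sum>i\<in>UNIV. if i = k then g i else 0)"
    by (intro sum.cong) (auto simp: axis_def)
  then show ?thesis by simp
qed

lemma dird_axis [simp]: "dird (axis k 1) f = partial k f"
  unfolding dird_def by (rule ext) (rule axis_sum)

lemma dird_line:
  assumes "f differentiable (at (x + t *\<^sub>R u))"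
  shows "((\<lambda>t. f (x + t *\<^sub>R u)) has_vector_derivative dird u f (x + t *\<^sub>R u)) (at t)"
  using has_derivative_line[OF has_derivative_partial[OF assms]] by (simp add: dird_def)

text \<open>The mean value theorem needs real functions. The factor w is chosen later so that the
  real part of a given complex quantity becomes its squared modulus.\<close>

lemma dird_line_Re:
  assumes "f differentiable (at (x + t *\<^sub>R u))"
  shows "((\<lambda>t. Re (w * f (x + t *\<^sub>R u))) has_real_derivative Re (w * dird u f (x + t *\<^sub>R u))) (at t)"
proof -
  have "((\<lambda>t. w * f (x + t *\<^sub>R u)) has_vector_derivative w * dird u f (x + t *\<^sub>R u)) (at t)"
    using dird_line[OF assms] by (intro has_vector_derivative_mult_right)
  then show ?thesis
    by (simp only: has_real_derivative_iff_has_vector_derivative has_vector_derivative_complex_iff)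
qed

lemma smooth_on_dird:
  assumes "open S" "smooth_on S f"
  shows "smooth_on S (dird u f)"
  unfolding dird_def[abs_def]
  by (intro smooth_on_sum smooth_on_cmult smooth_on_partial assms)

text \<open>Two applications of the mean value theorem: in s to the difference of \<phi> at t = h
  and t = 0, and in t to the resulting difference of \<open>\<phi>1\<close>.\<close>

lemma second_difference:
  fixes \<phi> :: "real \<Rightarrow> real \<Rightarrow> real"
  assumes "0 < h"
    and 1: "\<And>s t. 0 \<le> s \<Longrightarrow> s \<le> h \<Longrightarrow> 0 \<le> t \<Longrightarrow> t \<le> h \<Longrightarrow>
          ((\<lambda>s. \<phi> s t) has_real_derivative \<phi>1 s t) (at s)"
    and 2: "\<And>s t. 0 \<le> s \<Longrightarrow> s \<le> h \<Longrightarrow> 0 \<le> t \<Longrightarrow> t \<le> h \<Longrightarrow>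
          ((\<lambda>t. \<phi>1 s t) has_real_derivative \<phi>2 s t) (at t)"
  shows "\<exists>s t. 0 < s \<and> s < h \<and> 0 < t \<and> t < h \<and> \<phi> h h - \<phi> 0 h - \<phi> h 0 + \<phi> 0 0 = h\<^sup>2 * \<phi>2 s t"
proof -
  have "\<exists>s. 0 < s \<and> s < h \<and> (\<phi> h h - \<phi> h 0) - (\<phi> 0 h - \<phi> 0 0) = (h - 0) * (\<phi>1 s h - \<phi>1 s 0)"
    using assms(1) by (intro MVT2 DERIV_diff 1) auto
  then obtain s where s: "0 < s" "s < h" "(\<phi> h h - \<phi> h 0) - (\<phi> 0 h - \<phi> 0 0) = h * (\<phi>1 s h - \<phi>1 s 0)"
    by auto
  have "\<exists>t. 0 < t \<and> t < h \<and> \<phi>1 s h - \<phi>1 s 0 = (h - 0) * \<phi>2 s t"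
    using assms(1) s by (intro MVT2 2) auto
  then obtain t where t: "0 < t" "t < h" "\<phi>1 s h - \<phi>1 s 0 = h * \<phi>2 s t"
    by auto
  show ?thesis
    using s t by (intro exI[of _ s] exI[of _ t]) (simp add: power2_eq_square algebra_simps)
qed

lemma parallelogram_in_ball:
  fixes u v :: "'a::real_normed_vector"
  assumes "0 < (d::real)"
  obtains h where "0 < h" "\<And>s t. 0 \<le> s \<Longrightarrow> s \<le> h \<Longrightarrow> 0 \<le> t \<Longrightarrow> t \<le> h \<Longrightarrow> x + s *\<^sub>R u + t *\<^sub>R v \<in> ball x d"
proof
  \<comment> \<open>The summand 1 keeps the denominator positive when u = v = 0 and makes the final
    bound strict.\<close>
  define h where "h = d / (norm u + norm v + 1)"
  have pos: "norm u + norm v + 1 > 0"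
    using norm_ge_zero[of u] norm_ge_zero[of v] by linarith
  show "0 < h" using assms pos by (simp add: h_def)
  fix s t :: real
  assume st: "0 \<le> s" "s \<le> h" "0 \<le> t" "t \<le> h"
  have "norm (s *\<^sub>R u + t *\<^sub>R v) \<le> s * norm u + t * norm v"
    using norm_triangle_ineq[of "s *\<^sub>R u" "t *\<^sub>R v"] st by simp
  also have "\<dots> \<le> h * norm u + h * norm v"
    using st by (intro add_mono mult_right_mono) auto
  also have "\<dots> < h * (norm u + norm v + 1)"
    using \<open>0 < h\<close> by (simp add: algebra_simps)
  also have "\<dots> = d"
    using pos by (simp add: h_def)
  finally have "norm (s *\<^sub>R u + t *\<^sub>R v) < d" .
  moreover have "x - (x + s *\<^sub>R u + t *\<^sub>R v) = - (s *\<^sub>R u + t *\<^sub>R v)"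
    by simp
  ultimately show "x + s *\<^sub>R u + t *\<^sub>R v \<in> ball x d"
    by (simp only: mem_ball dist_norm norm_minus_cancel)
qed

text \<open>The second difference of f over a small parallelogram is symmetric in u and v. Evaluated
  by \<open>second_difference\<close> in either order it is h^2 times one of the two mixed
  derivatives at a nearby point, and continuity of both at x excludes different values.\<close>

lemma dird_commute:
  assumes "open S" "smooth_on S f" "x \<in> S"
  shows "dird u (dird v f) x = dird v (dird u f) x"
proof (rule ccontr)
  let ?F = "dird u (dird v f)" and ?G = "dird v (dird u f)"
  \<comment> \<open>Multiplication by the conjugate turns the difference into its squared modulus.
    Since e is half the modulus, the two continuity errors together stay strictly below it.\<close>
  define w where "w = cnj (?F x - ?G x)"
  define e where "e = norm w / 2"
  assume "?F x \<noteq> ?G x"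
  then have e: "e > 0" by (simp add: w_def e_def)
  have "smooth_on S ?F" "smooth_on S ?G"
    by (intro smooth_on_dird assms)+
  then have "isCont ?F x" "isCont ?G x"
    using assms differentiable_imp_continuous_within smooth_on_differentiable by blast+
  then have "eventually (\<lambda>y. dist (?F y) (?F x) < e) (at x)" "eventually (\<lambda>y. dist (?G y) (?G x) < e) (at x)"
    using e unfolding isCont_def by (auto intro: tendstoD)
  moreover have "eventually (\<lambda>y. y \<in> S) (at x)"
    using assms eventually_at_topological by blast
  ultimately have "eventually (\<lambda>y. y \<in> S \<and> dist (?F y) (?F x) < e \<and> dist (?G y) (?G x) < e) (at x)"
    by eventually_elim auto
  then obtain d where d: "d > 0" "\<And>y. y \<noteq> x \<Longrightarrow> dist y x < d \<Longrightarrow> y \<in> S \<and> dist (?F y) (?F x) < e \<and> dist (?G y) (?G x) < e"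
    unfolding eventually_at by auto
  then have d: "y \<in> S \<and> dist (?F y) (?F x) < e \<and> dist (?G y) (?G x) < e" if "y \<in> ball x d" for y
    using that assms(3) e d(2)[of y] by (cases "y = x") (auto simp: dist_commute[of x y])
  obtain h where h: "0 < h" "\<And>s t. 0 \<le> s \<Longrightarrow> s \<le> h \<Longrightarrow> 0 \<le> t \<Longrightarrow> t \<le> h \<Longrightarrow> x + s *\<^sub>R u + t *\<^sub>R v \<in> ball x d"
    by (rule parallelogram_in_ball[OF \<open>d > 0\<close>, where u = u and v = v and x = x]) (rule that)
  define \<phi> where "\<phi> s t = Re (w * f (x + s *\<^sub>R u + t *\<^sub>R v))" for s t
  have swap: "x + s *\<^sub>R u + t *\<^sub>R v = x + t *\<^sub>R v + s *\<^sub>R u" for s t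
    by (simp add: algebra_simps)
  have inS: "x + t *\<^sub>R v + s *\<^sub>R u \<in> S" "x + s *\<^sub>R u + t *\<^sub>R v \<in> S"
    if "0 \<le> s" "s \<le> h" "0 \<le> t" "t \<le> h" for s t
    using d[OF h(2)[OF that]] by (auto simp: swap)
  note diff = smooth_on_differentiable[OF assms(2,1)]
    smooth_on_differentiable[OF smooth_on_dird[OF assms(1,2)] assms(1)]
  have "\<exists>s t. 0 < s \<and> s < h \<and> 0 < t \<and> t < h \<and>
      \<phi> h h - \<phi> 0 h - \<phi> h 0 + \<phi> 0 0 = h\<^sup>2 * Re (w * ?G (x + s *\<^sub>R u + t *\<^sub>R v))"
  proof (rule second_difference[OF h(1)])
    fix s t assume st: "0 \<le> s" "s \<le> h" "0 \<le> t" "t \<le> h"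
    show "((\<lambda>s. \<phi> s t) has_real_derivative Re (w * dird u f (x + s *\<^sub>R u + t *\<^sub>R v))) (at s)"
      unfolding \<phi>_def swap by (intro dird_line_Re diff inS st)
    show "((\<lambda>t. Re (w * dird u f (x + s *\<^sub>R u + t *\<^sub>R v))) has_real_derivative Re (w * ?G (x + s *\<^sub>R u + t *\<^sub>R v))) (at t)"
      by (intro dird_line_Re diff inS st)
  qed
  then obtain s t where st: "0 < s" "s < h" "0 < t" "t < h"
     "\<phi> h h - \<phi> 0 h - \<phi> h 0 + \<phi> 0 0 = h\<^sup>2 * Re (w * ?G (x + s *\<^sub>R u + t *\<^sub>R v))"
    by blast
  have "\<exists>t s. 0 < t \<and> t < h \<and> 0 < s \<and> s < h \<and>
      \<phi> h h - \<phi> h 0 - \<phi> 0 h + \<phi> 0 0 = h\<^sup>2 * Re (w * ?F (x + t *\<^sub>R v + s *\<^sub>R u))"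
  proof (rule second_difference[OF h(1), where \<phi> = "\<lambda>t s. \<phi> s t"])
    fix s t assume st: "0 \<le> s" "s \<le> h" "0 \<le> t" "t \<le> h"
    show "((\<lambda>s. \<phi> t s) has_real_derivative Re (w * dird v f (x + s *\<^sub>R v + t *\<^sub>R u))) (at s)"
      unfolding \<phi>_def swap[symmetric] by (intro dird_line_Re diff inS st)
    show "((\<lambda>t. Re (w * dird v f (x + s *\<^sub>R v + t *\<^sub>R u))) has_real_derivative Re (w * ?F (x + s *\<^sub>R v + t *\<^sub>R u))) (at t)"
      by (intro dird_line_Re diff inS st)
  qed
  then obtain t' s' where st': "0 < t'" "t' < h" "0 < s'" "s' < h"
     "\<phi> h h - \<phi> h 0 - \<phi> 0 h + \<phi> 0 0 = h\<^sup>2 * Re (w * ?F (x + t' *\<^sub>R v + s' *\<^sub>R u))"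
    by blast
  define p q where "p = x + s *\<^sub>R u + t *\<^sub>R v" and "q = x + s' *\<^sub>R u + t' *\<^sub>R v"
  have pq: "p \<in> ball x d" "q \<in> ball x d"
    unfolding p_def q_def by (intro h(2); use st(1-4) st'(1-4) in linarith)+
  have "h\<^sup>2 * Re (w * ?G p) = h\<^sup>2 * Re (w * ?F q)"
    using st(5) st'(5) unfolding p_def[symmetric] swap[symmetric] q_def[symmetric] by linarith
  then have "Re (w * ?G p) = Re (w * ?F q)"
    using h(1) by simp
  then have "Re (w * (?F x - ?G x)) = Re (w * (?F x - ?F q)) + Re (w * (?G p - ?G x))"
    by (simp add: algebra_simps)
  also have "\<dots> \<le> norm (w * (?F x - ?F q)) + norm (w * (?G p - ?G x))"
    by (intro add_mono complex_Re_le_cmod)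
  also have "\<dots> < norm w * e + norm w * e"
    using d[OF pq(1)] d[OF pq(2)] e unfolding norm_mult
    by (intro add_strict_mono mult_strict_left_mono) (auto simp: dist_norm norm_minus_commute e_def)
  also have "\<dots> = (norm w)\<^sup>2"
    by (simp add: e_def power2_eq_square)
  also have "\<dots> = Re (w * (?F x - ?G x))"
    using arg_cong[OF complex_norm_square[of "?F x - ?G x"], of Re]
    by (simp only: w_def complex_mod_cnj mult.commute[of "cnj (?F x - ?G x)"] of_real_power[symmetric] Re_complex_of_real)
  finally show False by simp
qed

lemma partial_commute:
  assumes "open S" "smooth_on S f" "x \<in> S"
  shows "partial i (partial j f) x = partial j (partial i f) x"
  using dird_commute[OF assms, of "axis i 1" "axis j 1"] by simp

section \<open>Real analytic functions are smooth\<close>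

definition monomial :: "('n \<Rightarrow> nat) \<Rightarrow> real ^ 'n::finite \<Rightarrow> real" where
  "monomial m y = (\<Prod>i\<in>UNIV. (y $ i) ^ m i)"

text \<open>The exponent \<open>m i - 1\<close> is truncated to 0 when \<open>m i = 0\<close>; the
  factor \<open>real (m i)\<close> vanishes in that case.\<close>

definition monomial_partial :: "'n \<Rightarrow> ('n \<Rightarrow> nat) \<Rightarrow> real ^ 'n::finite \<Rightarrow> real" where
  "monomial_partial i m y = real (m i) * (y $ i) ^ (m i - 1) * (\<Prod>j\<in>UNIV - {i}. (y $ j) ^ m j)"

text \<open>After the shift of the multi-index at i, the differentiated series is again a series in
  the monomials.\<close>

lemma monomial_partial_Suc:
  "monomial_partial i (m(i := Suc (m i))) y = real (Suc (m i)) * monomial m y"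
proof -
  have "(\<Prod>j\<in>UNIV - {i}. (y $ j) ^ (m(i := Suc (m i))) j) = (\<Prod>j\<in>UNIV - {i}. (y $ j) ^ m j)"
    by (intro prod.cong) auto
  moreover have "monomial m y = (y $ i) ^ m i * (\<Prod>j\<in>UNIV - {i}. (y $ j) ^ m j)"
    unfolding monomial_def by (rule prod.remove) auto
  ultimately show ?thesis
    by (simp add: monomial_partial_def)
qed

lemma has_derivative_monomial:
  "((\<lambda>x. monomial m (x - a)) has_derivative (\<lambda>h. \<Sum>i\<in>UNIV. h $ i * monomial_partial i m (x - a))) (at x within S)"
proof -
  have "((\<lambda>x. ((x - a) $ i) ^ m i) has_derivative
      (\<lambda>h. real (m i) * h $ i * ((x - a) $ i) ^ (m i - 1))) (at x within S)" for i
  proof -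
    have "((\<lambda>x. (x - a) $ i) has_derivative (\<lambda>h. h $ i)) (at x within S)"
      by (auto intro!: derivative_eq_intros bounded_linear.has_derivative[OF bounded_linear_vec_nth])
    from has_derivative_power[OF this, of "m i"] show ?thesis .
  qed
  from has_derivative_prod[where f = "\<lambda>i x. ((x - a) $ i) ^ m i", OF this]
  show ?thesis
    unfolding monomial_def monomial_partial_def
    by (rule has_derivative_eq_rhs) (auto intro!: ext sum.cong simp: mult_ac)
qed

text \<open>The factor \<open>m i\<close> produced by differentiation is at most 2 to the power
  \<open>m i\<close>, and this is compensated by shrinking the radius from \<rho> to \<rho> /
  2.\<close>

lemma monomial_partial_bound:
  assumes "0 < \<rho>" "\<And>j. \<bar>y $ j\<bar> \<le> \<rho> / 2"
  shows "\<bar>monomial_partial i m y\<bar> \<le> 2 / \<rho> * (\<Prod>j\<in>UNIV. \<rho> ^ m j)"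
proof (cases "m i")
  case 0
  then show ?thesis
    using assms(1) by (simp add: monomial_partial_def prod_nonneg)
next
  case (Suc k)
  have "real (Suc k) \<le> 2 ^ Suc k"
    using less_exp[of "Suc k"] by (metis less_imp_le of_nat_le_iff of_nat_numeral of_nat_power)
  have "\<bar>y $ i\<bar> ^ k \<le> (\<rho> / 2) ^ k"
    by (intro power_mono assms(2)) auto
  then have "real (Suc k) * \<bar>y $ i\<bar> ^ k \<le> 2 ^ Suc k * (\<rho> / 2) ^ k"
    using \<open>real (Suc k) \<le> 2 ^ Suc k\<close> by (intro mult_mono) auto
  also have "\<dots> = 2 / \<rho> * \<rho> ^ m i"
    using assms(1) Suc by (simp add: power_divide)
  finally have 1: "real (Suc k) * \<bar>y $ i\<bar> ^ k \<le> 2 / \<rho> * \<rho> ^ m i" .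
  have 2: "(\<Prod>j\<in>UNIV - {i}. \<bar>y $ j\<bar> ^ m j) \<le> (\<Prod>j\<in>UNIV - {i}. \<rho> ^ m j)"
  proof (intro prod_mono conjI power_mono)
    show "\<bar>y $ j\<bar> \<le> \<rho>" for j
      using assms(2)[of j] assms(1) by linarith
  qed auto
  have "\<bar>monomial_partial i m y\<bar> = (real (Suc k) * \<bar>y $ i\<bar> ^ k) * (\<Prod>j\<in>UNIV - {i}. \<bar>y $ j\<bar> ^ m j)"
    by (simp add: monomial_partial_def Suc abs_mult abs_prod power_abs)
  also have "\<dots> \<le> (2 / \<rho> * \<rho> ^ m i) * (\<Prod>j\<in>UNIV - {i}. \<rho> ^ m j)"
    by (intro mult_mono 1 2) (use assms(1) in \<open>auto intro!: prod_nonneg\<close>)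
  also have "\<dots> = 2 / \<rho> * (\<Prod>j\<in>UNIV. \<rho> ^ m j)"
    by (subst prod.remove[of UNIV i]) auto
  finally show ?thesis .
qed

text \<open>Unconditional convergence at the single point a + (\<rho>, ..., \<rho>) is absolute
  convergence there, and it bounds the differentiated terms on a smaller ball by a summable majorant
  B. The series may therefore be differentiated term by term.\<close>

lemma power_series_partial:
  fixes f :: "real ^ 'n::finite \<Rightarrow> complex"
  assumes "0 < \<epsilon>"
    and f: "\<And>x. x \<in> ball a \<epsilon> \<Longrightarrow> ((\<lambda>m. c m * of_real (monomial m (x - a))) has_sum f x) UNIV"
  obtains \<sigma> where "0 < \<sigma>" "\<And>x. x \<in> ball a \<sigma> \<Longrightarrow> f differentiable (at x)"
    "\<And>i x. x \<in> ball a \<sigma> \<Longrightarrow>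
      ((\<lambda>m. (of_nat (Suc (m i)) * c (m(i := Suc (m i)))) * of_real (monomial m (x - a))) has_sum partial i f x) UNIV"
proof -
  define N where "N = real CARD('n)"
  have "N \<ge> 1"
    using zero_less_card_finite[where 'a = 'n] unfolding N_def by linarith
  \<comment> \<open>The norm of (\<rho>, ..., \<rho>) is at most N \<rho> = \<epsilon> / 2, so the
    point at which absolute convergence is used lies in the given ball.\<close>
  define \<rho> where "\<rho> = \<epsilon> / (2 * N)"
  define \<sigma> where "\<sigma> = min \<epsilon> (\<rho> / 2)"
  have pos: "0 < \<rho>" "0 < \<sigma>"
    using assms(1) \<open>N \<ge> 1\<close> by (auto simp: \<rho>_def \<sigma>_def)
  \<comment> \<open>The last factor N makes B bound the total derivative of a term, that is, the sum
    over its N partial derivatives.\<close>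
  define B where "B m = cmod (c m) * (2 / \<rho> * (\<Prod>j\<in>UNIV. \<rho> ^ m j)) * N" for m :: "'n \<Rightarrow> nat"
  have "norm (\<chi> i. \<rho> :: real ^ 'n) \<le> (\<Sum>i\<in>UNIV. \<bar>(\<chi> i. \<rho> :: real ^ 'n) $ i\<bar>)"
    by (rule norm_le_l1_cart)
  also have "\<dots> = N * \<rho>"
    using pos by (simp add: N_def)
  also have "\<dots> = \<epsilon> / 2"
    using \<open>N \<ge> 1\<close> by (simp add: \<rho>_def)
  also have "\<dots> < \<epsilon>"
    using assms(1) by simp
  finally have "norm (\<chi> i. \<rho> :: real ^ 'n) < \<epsilon>" .
  then have "a + (\<chi> i. \<rho>) \<in> ball a \<epsilon>"
    by (simp add: dist_norm)
  from f[OF this] have "(\<lambda>m. c m * of_real (monomial m (\<chi> i. \<rho>))) summable_on UNIV"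
    by (auto simp: summable_on_def)
  then have "(\<lambda>m. norm (c m * of_real (monomial m (\<chi> i. \<rho>)))) summable_on UNIV"
    by (simp only: summable_on_iff_abs_summable_on_complex)
  then have "(\<lambda>m. norm (c m * of_real (monomial m (\<chi> i. \<rho>))) * (2 / \<rho> * N)) summable_on UNIV"
    by (rule summable_on_cmult_left)
  moreover have "norm (c m * of_real (monomial m (\<chi> i. \<rho>))) * (2 / \<rho> * N) = B m" for m
    unfolding B_def norm_mult norm_of_real using pos by (simp add: monomial_def abs_prod power_abs)
  ultimately have sumB: "B summable_on UNIV"
    by simp
  have B: "B m \<ge> 0" for m
    unfolding B_def using pos \<open>N \<ge> 1\<close>
    by (intro mult_nonneg_nonneg prod_nonneg divide_nonneg_nonneg ballI zero_le_power) auto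
  define d where "d i m x = c m * of_real (monomial_partial i m (x - a))" for i m x
  have d: "norm (d i m x) * N \<le> B m" if "x \<in> ball a \<sigma>" for i m x
  proof -
    have "\<bar>(x - a) $ j\<bar> \<le> \<rho> / 2" for j
      using component_le_norm_cart[of "x - a" j] that by (simp add: \<sigma>_def dist_norm norm_minus_commute)
    then have "\<bar>monomial_partial i m (x - a)\<bar> \<le> 2 / \<rho> * (\<Prod>j\<in>UNIV. \<rho> ^ m j)"
      by (intro monomial_partial_bound pos)
    then show ?thesis
      unfolding d_def B_def norm_mult norm_of_real using \<open>N \<ge> 1\<close>
      by (intro mult_right_mono mult_left_mono) auto
  qed
  have inj: "inj (\<lambda>k. from_nat_into (UNIV :: ('n \<Rightarrow> nat) set) k)" and
    bij: "bij_betw (from_nat_into (UNIV :: ('n \<Rightarrow> nat) set)) UNIV UNIV"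
  proof -
    have "infinite (UNIV :: ('n \<Rightarrow> nat) set)"
      by (simp add: finite_UNIV_fun)
    then show "bij_betw (from_nat_into (UNIV :: ('n \<Rightarrow> nat) set)) UNIV UNIV"
      by (intro bij_betw_from_nat_into) auto
    then show "inj (\<lambda>k. from_nat_into (UNIV :: ('n \<Rightarrow> nat) set) k)"
      by (auto simp: bij_betw_def)
  qed
  \<comment> \<open>The multi-indices are enumerated in order to apply the differentiation theorem
    for sequential series; absolute convergence makes the enumeration immaterial.\<close>
  define e where "e = from_nat_into (UNIV :: ('n \<Rightarrow> nat) set)"
  have bij: "bij_betw e UNIV UNIV" using bij by (simp add: e_def)
  have sums: "(\<lambda>k. F (e k)) sums s" if "(F has_sum s) UNIV" for F :: "_ \<Rightarrow> complex" and s
    using that has_sum_reindex_bij_betw[OF bij, of F s] by (intro has_sum_imp_sums) simp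
  have sumB': "summable (\<lambda>k. B (e k))"
    using sumB summable_on_reindex_bij_betw[OF bij, of B] by (intro summable_on_imp_summable) simp
  have d_sum: "(\<lambda>m. d i m x) summable_on UNIV" if "x \<in> ball a \<sigma>" for i x
  proof -
    have "(\<lambda>m. norm (d i m x)) summable_on UNIV"
    proof (rule summable_on_comparison_test[OF sumB])
      show "norm (d i m x) \<le> B m" for m
        using d[OF that, of i m] \<open>N \<ge> 1\<close> mult_left_mono[of 1 N "norm (d i m x)"] by simp
    qed simp
    then show ?thesis
      by (rule abs_summable_summable)
  qed
  define D where "D i x = (\<Sum>\<^sub>\<infinity>m. d i m x)" for i x
  have D: "((\<lambda>m. d i m x) has_sum D i x) UNIV" if "x \<in> ball a \<sigma>" for i x
    unfolding D_def by (rule has_sum_infsum[OF d_sum[OF that]])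
  define G where "G k x h = (\<Sum>i\<in>UNIV. of_real (h $ i) * d i (e k) x)" for k x and h :: "real ^ 'n"
  have G: "norm (G k x h) \<le> B (e k) * norm h" if "x \<in> ball a \<sigma>" for k x h
  proof -
    have "norm (G k x h) \<le> (\<Sum>i\<in>(UNIV :: 'n set). norm h * (B (e k) / N))"
      unfolding G_def
    proof (intro sum_norm_le)
      fix i
      have "norm (d i (e k) x) \<le> B (e k) / N"
        using d[OF that, of i "e k"] \<open>N \<ge> 1\<close> by (simp add: field_simps)
      then show "norm (of_real (h $ i) * d i (e k) x) \<le> norm h * (B (e k) / N)"
        unfolding norm_mult norm_of_real using component_le_norm_cart[of h i]
        by (intro mult_mono) auto
    qed
    also have "\<dots> = B (e k) * norm h"
      using \<open>N \<ge> 1\<close> by (simp add: N_def)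
    finally show ?thesis .
  qed
  define G' where "G' x h = (\<Sum>i\<in>UNIV. of_real (h $ i) * D i x)" for x and h :: "real ^ 'n"
  have GG': "(\<lambda>k. G k x h) sums G' x h" if "x \<in> ball a \<sigma>" for x h
    unfolding G_def G'_def by (intro sums_sum sums_mult sums[OF D[OF that]])
  have tail: "norm ((\<Sum>k<n. G k x h) - G' x h) \<le> (\<Sum>k. B (e (k + n))) * norm h"
    if "x \<in> ball a \<sigma>" for x h n
  proof -
    have "(\<lambda>k. G (k + n) x h) sums (G' x h - (\<Sum>k<n. G k x h))"
      using GG'[OF that, of h] sums_iff_shift[of "\<lambda>k. G k x h" n] by simp
    then have "G' x h - (\<Sum>k<n. G k x h) = (\<Sum>k. G (k + n) x h)"
      by (rule sums_unique)
    moreover have B': "summable (\<lambda>k. B (e (k + n)))"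
      using sumB' by (rule summable_ignore_initial_segment)
    have "norm (\<Sum>k. G (k + n) x h) \<le> (\<Sum>k. B (e (k + n)) * norm h)"
      by (rule norm_suminf_le[OF G[OF that] summable_mult2[OF B']])
    moreover have "(\<Sum>k. B (e (k + n)) * norm h) = (\<Sum>k. B (e (k + n))) * norm h"
      by (rule suminf_mult2[OF B', symmetric])
    ultimately show ?thesis
      by (simp add: norm_minus_commute)
  qed
  have B0: "(\<lambda>n. \<Sum>k. B (e (k + n))) \<longlonglongrightarrow> 0"
    using sumB' by (rule suminf_exist_split2)
  have sub: "ball a \<sigma> \<subseteq> ball a \<epsilon>"
    by (auto simp: \<sigma>_def)
  have "\<exists>g. \<forall>x\<in>ball a \<sigma>. (\<lambda>k. c (e k) * of_real (monomial (e k) (x - a))) sums g x \<and>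
      (g has_derivative G' x) (at x within ball a \<sigma>)"
  proof (rule has_derivative_series)
    show "a \<in> ball a \<sigma>" using pos by simp
    show "(\<lambda>k. c (e k) * of_real (monomial (e k) (a - a))) sums f a"
      by (rule sums[OF f]) (use assms(1) in simp)
    show "((\<lambda>x. c (e k) * of_real (monomial (e k) (x - a))) has_derivative G k x) (at x within ball a \<sigma>)" for k x
      unfolding G_def d_def
      by (rule has_derivative_eq_rhs[OF has_derivative_mult_right[OF has_derivative_of_real[OF has_derivative_monomial]]])
        (auto simp: sum_distrib_left mult_ac)
    fix r :: real assume "r > 0"
    have "eventually (\<lambda>n. (\<Sum>k. B (e (k + n))) < r) sequentially"
      using order_tendstoD(2)[OF B0 \<open>r > 0\<close>] .
    then show "\<forall>\<^sub>F n in sequentially. \<forall>x\<in>ball a \<sigma>. \<forall>h. norm ((\<Sum>k<n. G k x h) - G' x h) \<le> r * norm h"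
    proof eventually_elim
      case (elim n)
      show ?case
      proof (intro ballI allI)
        fix x h assume "x \<in> ball a \<sigma>"
        have "norm ((\<Sum>k<n. G k x h) - G' x h) \<le> (\<Sum>k. B (e (k + n))) * norm h"
          by (rule tail[OF \<open>x \<in> ball a \<sigma>\<close>])
        also have "\<dots> \<le> r * norm h"
          using elim by (intro mult_right_mono) auto
        finally show "norm ((\<Sum>k<n. G k x h) - G' x h) \<le> r * norm h" .
      qed
    qed
  qed simp
  then obtain g where *: "\<forall>x\<in>ball a \<sigma>. (\<lambda>k. c (e k) * of_real (monomial (e k) (x - a))) sums g x \<and>
      (g has_derivative G' x) (at x within ball a \<sigma>)" ..
  have g: "(\<lambda>k. c (e k) * of_real (monomial (e k) (x - a))) sums g x"
    "(g has_derivative G' x) (at x within ball a \<sigma>)" if "x \<in> ball a \<sigma>" for x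
    using bspec[OF * that] by simp_all
  have fg: "f x = g x" if "x \<in> ball a \<sigma>" for x
  proof -
    have "x \<in> ball a \<epsilon>" using sub that by blast
    from sums_unique2[OF sums[OF f[OF this]] g(1)[OF that]] show ?thesis .
  qed
  have der: "(f has_derivative G' x) (at x)" if "x \<in> ball a \<sigma>" for x
  proof -
    have "(g has_derivative G' x) (at x)"
      using g(2)[OF that] unfolding at_within_open[OF that open_ball] .
    then show ?thesis
      by (rule has_derivative_transform_within_open[OF _ open_ball that]) (rule fg[symmetric])
  qed
  show ?thesis
  proof (rule that[OF pos(2)])
    show "f differentiable (at x)" if "x \<in> ball a \<sigma>" for x
      using der[OF that] by (rule differentiableI)
    fix i x assume x: "x \<in> ball a \<sigma>"
    have "partial i f x = D i x"
      using partial_eqI[OF der[OF x]] by (simp add: G'_def axis_sum)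
    then have "((\<lambda>m. d i m x) has_sum partial i f x) UNIV"
      using D[OF x] by simp
    moreover have inj: "inj (\<lambda>m :: 'n \<Rightarrow> nat. m(i := Suc (m i)))"
    proof (intro injI ext)
      fix m m' :: "'n \<Rightarrow> nat" and j
      assume "m(i := Suc (m i)) = m'(i := Suc (m' i))"
      from fun_cong[OF this, of j] show "m j = m' j"
        by (cases "j = i") auto
    qed
    \<comment> \<open>Multi-indices outside the range of the shift have \<open>m i = 0\<close>, and
      their terms are killed by the derivative.\<close>
    moreover have "((\<lambda>m. d i m x) has_sum partial i f x) UNIV \<longleftrightarrow>
        ((\<lambda>m. d i m x) has_sum partial i f x) (range (\<lambda>m. m(i := Suc (m i))))"
    proof (rule has_sum_cong_neutral)
      fix m assume m: "m \<in> UNIV - range (\<lambda>m. m(i := Suc (m i)))"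
      have "m i = 0"
      proof (rule ccontr)
        assume "m i \<noteq> 0"
        then have "m = (m(i := m i - 1))(i := Suc ((m(i := m i - 1)) i))"
          by (auto simp: fun_eq_iff)
        then show False using m by blast
      qed
      then show "d i m x = 0"
        by (simp add: d_def monomial_partial_def)
    qed auto
    ultimately have "((\<lambda>m. d i (m(i := Suc (m i))) x) has_sum partial i f x) UNIV"
      by (simp add: has_sum_reindex o_def)
    then show "((\<lambda>m. (of_nat (Suc (m i)) * c (m(i := Suc (m i)))) * of_real (monomial m (x - a))) has_sum partial i f x) UNIV"
      by (simp add: d_def monomial_partial_Suc mult_ac)
  qed
qed

text \<open>The real analytic functions themselves are a class as required by
  \<open>smooth_on_coinduct\<close>, because \<open>power_series_partial\<close> expands each
  partial derivative again.\<close>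

lemma real_analytic_on_smooth_on:
  assumes "open S" "real_analytic_on S f"
  shows "smooth_on S f"
proof (rule smooth_on_coinduct[OF assms(1), where K = "real_analytic_on S"])
  fix g :: "real ^ 'a::finite \<Rightarrow> complex"
  assume g: "real_analytic_on S g"
  have expand: "\<exists>\<sigma>>0. (\<forall>x\<in>ball a \<sigma>. g differentiable (at x)) \<and> (\<forall>i. \<exists>c. \<forall>x\<in>ball a \<sigma>.
      ((\<lambda>m. c m * of_real (\<Prod>i\<in>UNIV. (x $ i - a $ i) ^ m i)) has_sum partial i g x) UNIV)" if a: "a \<in> S" for a
  proof -
    obtain \<epsilon> c where "\<epsilon> > 0" and
      *: "\<forall>x\<in>ball a \<epsilon>. ((\<lambda>m. c m * of_real (\<Prod>i\<in>UNIV. (x $ i - a $ i) ^ m i)) has_sum g x) UNIV"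
      using g a unfolding real_analytic_on_def by blast
    have c: "((\<lambda>m. c m * of_real (monomial m (x - a))) has_sum g x) UNIV" if "x \<in> ball a \<epsilon>" for x
      using bspec[OF * that] by (simp only: monomial_def vector_minus_component)
    obtain \<sigma> where \<sigma>: "0 < \<sigma>"
      "\<And>x. x \<in> ball a \<sigma> \<Longrightarrow> g differentiable (at x)"
      "\<And>i x. x \<in> ball a \<sigma> \<Longrightarrow>
        ((\<lambda>m. (of_nat (Suc (m i)) * c (m(i := Suc (m i)))) * of_real (monomial m (x - a))) has_sum partial i g x) UNIV"
      by (rule power_series_partial[OF \<open>\<epsilon> > 0\<close> c], assumption) (rule that)
    show ?thesis
    proof (intro exI[of _ \<sigma>] conjI allI ballI \<sigma>(1) \<sigma>(2))
      fix i
      show "\<exists>c. \<forall>x\<in>ball a \<sigma>. ((\<lambda>m. c m * of_real (\<Prod>i\<in>UNIV. (x $ i - a $ i) ^ m i)) has_sum partial i g x) UNIV"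
        using \<sigma>(3)[of _ i] unfolding monomial_def vector_minus_component
        by (intro exI[of _ "\<lambda>m. of_nat (Suc (m i)) * c (m(i := Suc (m i)))"] ballI)
    qed
  qed
  show "g differentiable_on S"
    unfolding differentiable_on_eq_differentiable_at[OF assms(1)]
  proof
    fix a assume "a \<in> S"
    from expand[OF this] obtain \<sigma> where "\<sigma> > 0" "\<forall>x\<in>ball a \<sigma>. g differentiable (at x)"
      by blast
    then show "g differentiable (at a)" by simp
  qed
  fix i
  have "real_analytic_on S (partial i g)"
    unfolding real_analytic_on_def
  proof
    fix a assume "a \<in> S"
    from expand[OF this] obtain \<sigma> where "\<sigma> > 0" "\<exists>c. \<forall>x\<in>ball a \<sigma>.
        ((\<lambda>m. c m * of_real (\<Prod>i\<in>UNIV. (x $ i - a $ i) ^ m i)) has_sum partial i g x) UNIV"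
      by blast
    then show "\<exists>\<epsilon>>0. \<exists>c. \<forall>x\<in>ball a \<epsilon>.
        ((\<lambda>m. c m * of_real (\<Prod>i\<in>UNIV. (x $ i - a $ i) ^ m i)) has_sum partial i g x) UNIV"
      by blast
  qed
  then show "\<exists>h. real_analytic_on S h \<and> (\<forall>x\<in>S. partial i g x = h x)"
    by blast
qed (rule assms)

section \<open>The commutation relation on exponentials\<close>

definition expo :: "real ^ 'n \<Rightarrow> real ^ 'n::finite \<Rightarrow> complex" where
  "expo \<xi> x = exp (of_real (\<xi> \<bullet> x))"

lemma expo_nonzero [simp]: "expo \<xi> x \<noteq> 0"
  by (simp add: expo_def)

lemma has_derivative_expo: "(expo \<xi> has_derivative (\<lambda>h. of_real (\<xi> \<bullet> h) * expo \<xi> x)) (at x)"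
proof -
  have "((\<lambda>x. complex_of_real (\<xi> \<bullet> x)) has_derivative (\<lambda>h. of_real (\<xi> \<bullet> h))) (at x)"
    by (auto intro!: derivative_eq_intros)
  from has_derivative_compose[OF this DERIV_exp[unfolded has_field_derivative_def]]
  show ?thesis
    unfolding expo_def[abs_def] by (simp add: mult.commute)
qed

lemma partial_expo: "partial i (expo \<xi>) x = of_real (\<xi> $ i) * expo \<xi> x"
  using partial_eqI[OF has_derivative_expo[of \<xi> x]] by (simp add: inner_axis)

lemma differentiable_expo: "expo \<xi> differentiable (at x)"
  using has_derivative_expo by (rule differentiableI)

lemma smooth_on_expo:
  assumes "open S"
  shows "smooth_on S (expo \<xi>)"
proof (rule smooth_on_coinduct[OF assms, where K = "\<lambda>g. \<exists>c. g = (\<lambda>x. c * expo \<xi> x)"])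
  show "\<exists>c. expo \<xi> = (\<lambda>x. c * expo \<xi> x)"
    by (rule exI[of _ 1]) simp
  fix g :: "real ^ 'a::finite \<Rightarrow> complex" and i
  assume "\<exists>c. g = (\<lambda>x. c * expo \<xi> x)"
  then obtain c where g: "g = (\<lambda>x. c * expo \<xi> x)" by blast
  show "g differentiable_on S"
    unfolding g differentiable_on_eq_differentiable_at[OF assms]
    by (intro ballI differentiable_mult differentiable_const differentiable_expo)
  show "\<exists>h. (\<exists>c. h = (\<lambda>x. c * expo \<xi> x)) \<and> (\<forall>x\<in>S. partial i g x = h x)"
    unfolding g partial_cmult[OF differentiable_expo] partial_expo
    by (intro exI[of _ "\<lambda>x. (c * of_real (\<xi> $ i)) * expo \<xi> x"] conjI ballI exI[of _ "c * of_real (\<xi> $ i)"]) simp_all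
qed

text \<open>The conjugate of \<open>\<partial>\<^sub>i\<close> by multiplication with \<open>exp (\<xi> \<bullet> x)\<close>.\<close>

definition twisted :: "real ^ 'n \<Rightarrow> 'n \<Rightarrow> (real ^ 'n \<Rightarrow> complex) \<Rightarrow> real ^ 'n::finite \<Rightarrow> complex" where
  "twisted \<xi> i g x = partial i g x + of_real (\<xi> $ i) * g x"

lemma smooth_on_twisted:
  assumes "open S" "smooth_on S g"
  shows "smooth_on S (twisted \<xi> i g)"
  unfolding twisted_def[abs_def]
  by (intro smooth_on_add smooth_on_cmult smooth_on_partial assms)

lemma partial_mult_expo:
  assumes "open S" "smooth_on S g" "\<forall>y\<in>S. f y = g y * expo \<xi> y" "x \<in> S"
  shows "partial i f x = twisted \<xi> i g x * expo \<xi> x"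
proof -
  have "partial i f x = partial i (\<lambda>x. g x * expo \<xi> x) x"
    using assms(3) by (intro partial_cong[OF assms(1,4)]) blast
  also have "\<dots> = partial i g x * expo \<xi> x + g x * (of_real (\<xi> $ i) * expo \<xi> x)"
    unfolding partial_mult[OF smooth_on_differentiable[OF assms(2,1,4)] differentiable_expo] partial_expo ..
  finally show ?thesis
    by (simp add: twisted_def algebra_simps)
qed

lemma partial2_mult_expo:
  assumes "open S" "smooth_on S g" "\<forall>y\<in>S. f y = g y * expo \<xi> y" "x \<in> S"
  shows "partial i (partial j f) x = twisted \<xi> i (twisted \<xi> j g) x * expo \<xi> x"
proof -
  have "\<forall>y\<in>S. partial j f y = twisted \<xi> j g y * expo \<xi> y"
    using partial_mult_expo[OF assms(1-3)] by blast
  from partial_mult_expo[OF assms(1) smooth_on_twisted[OF assms(1,2)] this assms(4)] show ?thesis .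
qed

lemma partial4_mult_expo:
  assumes "open S" "smooth_on S g" "\<forall>y\<in>S. f y = g y * expo \<xi> y" "x \<in> S"
  shows "partial i (partial j (partial k (partial l f))) x =
    twisted \<xi> i (twisted \<xi> j (twisted \<xi> k (twisted \<xi> l g))) x * expo \<xi> x"
proof -
  have "\<forall>y\<in>S. partial k (partial l f) y = twisted \<xi> k (twisted \<xi> l g) y * expo \<xi> y"
    using partial2_mult_expo[OF assms(1-3)] by blast
  from partial2_mult_expo[OF assms(1) smooth_on_twisted[OF assms(1) smooth_on_twisted[OF assms(1,2)]] this assms(4)]
  show ?thesis .
qed

text \<open>The conjugate of \<open>quartic_op\<close> by multiplication with exp(\<xi> \<bullet>
  x). Applied to the constant function 1 it is the full symbol of P at \<xi>.\<close>

definition twisted_quartic ::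
  "('n \<Rightarrow> real ^ 'n::_ \<Rightarrow> complex) \<Rightarrow> ('n \<Rightarrow> 'n \<Rightarrow> real ^ 'n::_ \<Rightarrow> complex) \<Rightarrow>
   ('n \<Rightarrow> real ^ 'n::_ \<Rightarrow> complex) \<Rightarrow> (real ^ 'n::_ \<Rightarrow> complex) \<Rightarrow>
   real ^ 'n::_ \<Rightarrow> (real ^ ('n::{finite,linorder}) \<Rightarrow> complex) \<Rightarrow> real ^ 'n::_ \<Rightarrow> complex" where
  "twisted_quartic a2 a11 a1 a0 \<xi> g x =
     (\<Sum>i\<in>UNIV. \<Sum>j | i < j. twisted \<xi> i (twisted \<xi> i (twisted \<xi> j (twisted \<xi> j g))) x)
     + (\<Sum>i\<in>UNIV. a2 i x * twisted \<xi> i (twisted \<xi> i g) x)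
     + (\<Sum>i\<in>UNIV. \<Sum>j | i < j. a11 i j x * twisted \<xi> i (twisted \<xi> j g) x)
     + (\<Sum>i\<in>UNIV. a1 i x * twisted \<xi> i g x)
     + a0 x * g x"

lemma quartic_op_mult_expo:
  assumes "open S" "smooth_on S g" "\<forall>y\<in>S. f y = g y * expo \<xi> y" "x \<in> S"
  shows "quartic_op a2 a11 a1 a0 f x = twisted_quartic a2 a11 a1 a0 \<xi> g x * expo \<xi> x"
  unfolding quartic_op_def twisted_quartic_def partial4_mult_expo[OF assms]
    partial2_mult_expo[OF assms] partial_mult_expo[OF assms] bspec[OF assms(3,4)]
  by (simp add: sum_distrib_right distrib_right mult.assoc)

lemma schroedinger_op_mult_expo:
  assumes "open S" "smooth_on S g" "\<forall>y\<in>S. f y = g y * expo \<xi> y" "x \<in> S"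
  shows "schroedinger_op R f x = (- (\<Sum>i\<in>UNIV. twisted \<xi> i (twisted \<xi> i g) x) + R x * g x) * expo \<xi> x"
  unfolding schroedinger_op_def partial2_mult_expo[OF assms] bspec[OF assms(3,4)]
  by (simp add: sum_distrib_left algebra_simps)

lemma twisted_const: "twisted \<xi> i (\<lambda>x. c) = (\<lambda>x. of_real (\<xi> $ i) * c)"
  by (rule ext) (simp add: twisted_def)

lemma twisted2:
  assumes "open S" "smooth_on S g" "x \<in> S"
  shows "twisted \<xi> i (twisted \<xi> j g) x = partial i (partial j g) x + of_real (\<xi> $ j) * partial i g x
     + of_real (\<xi> $ i) * partial j g x + of_real (\<xi> $ i) * of_real (\<xi> $ j) * g x"
proof -
  have "partial i (twisted \<xi> j g) x = partial i (partial j g) x + of_real (\<xi> $ j) * partial i g x"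
    unfolding twisted_def[abs_def]
    using smooth_on_differentiable[OF smooth_on_partial[OF assms(2)] assms(1,3), of j]
      smooth_on_differentiable[OF assms(2,1,3)]
    by (simp add: partial_add partial_cmult)
  then show ?thesis
    by (simp add: twisted_def[of \<xi> i] twisted_def[of \<xi> j] algebra_simps)
qed

text \<open>One fixed shape with four summands serves both the square of \<open>twisted\<close> and
  the symbol sorted by powers of s; missing summands are padded with zeros.\<close>

lemma partial_linear_combination4:
  assumes "f1 differentiable (at x)" "f2 differentiable (at x)" "f3 differentiable (at x)" "f4 differentiable (at x)"
  shows "partial i (\<lambda>x. f1 x + c2 * f2 x + c3 * f3 x + c4 * f4 x) x =
    partial i f1 x + c2 * partial i f2 x + c3 * partial i f3 x + c4 * partial i f4 x"
  using assms by (simp add: partial_add partial_cmult)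

lemma twisted4:
  assumes "open S" "smooth_on S g" "x \<in> S"
  shows "twisted \<xi> i (twisted \<xi> i (twisted \<xi> j (twisted \<xi> j g))) x =
     partial i (partial i (partial j (partial j g))) x
     + 2 * of_real (\<xi> $ j) * partial i (partial i (partial j g)) x
     + 2 * of_real (\<xi> $ i) * partial i (partial j (partial j g)) x
     + (of_real (\<xi> $ j))\<^sup>2 * partial i (partial i g) x + (of_real (\<xi> $ i))\<^sup>2 * partial j (partial j g) x
     + 4 * of_real (\<xi> $ i) * of_real (\<xi> $ j) * partial i (partial j g) x
     + 2 * of_real (\<xi> $ i) * (of_real (\<xi> $ j))\<^sup>2 * partial i g x
     + 2 * (of_real (\<xi> $ i))\<^sup>2 * of_real (\<xi> $ j) * partial j g x
     + (of_real (\<xi> $ i))\<^sup>2 * (of_real (\<xi> $ j))\<^sup>2 * g x"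
proof -
  let ?l = "\<lambda>k. complex_of_real (\<xi> $ k)"
  let ?t = "\<lambda>y. partial j (partial j g) y + (2 * ?l j) * partial j g y + ?l j * ?l j * g y + 0 * g y"
  have t: "twisted \<xi> j (twisted \<xi> j g) y = ?t y" if "y \<in> S" for y
    using twisted2[OF assms(1,2) that, of \<xi> j j] by (simp add: algebra_simps)
  note d = smooth_on_differentiable[OF assms(2) assms(1)]
    smooth_on_differentiable[OF smooth_on_partial[OF assms(2)] assms(1)]
    smooth_on_differentiable[OF smooth_on_partial[OF smooth_on_partial[OF assms(2)]] assms(1)]
    smooth_on_differentiable[OF smooth_on_partial[OF smooth_on_partial[OF smooth_on_partial[OF assms(2)]]] assms(1)]
  have sm: "smooth_on S (twisted \<xi> j (twisted \<xi> j g))"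
    by (intro smooth_on_twisted assms)
  have p1: "partial i (twisted \<xi> j (twisted \<xi> j g)) y =
      partial i (partial j (partial j g)) y + (2 * ?l j) * partial i (partial j g) y + ?l j * ?l j * partial i g y + 0 * partial i g y"
    if "y \<in> S" for y
  proof -
    have "partial i (twisted \<xi> j (twisted \<xi> j g)) y = partial i ?t y"
      by (rule partial_cong[OF assms(1) that]) (rule t)
    also have "\<dots> = partial i (partial j (partial j g)) y + (2 * ?l j) * partial i (partial j g) y + ?l j * ?l j * partial i g y + 0 * partial i g y"
      by (rule partial_linear_combination4) (rule d[OF that])+
    finally show ?thesis .
  qed
  have p2: "partial i (partial i (twisted \<xi> j (twisted \<xi> j g))) x =
      partial i (partial i (partial j (partial j g))) x + (2 * ?l j) * partial i (partial i (partial j g)) x + ?l j * ?l j * partial i (partial i g) x + 0 * partial i (partial i g) x"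
  proof -
    have "partial i (partial i (twisted \<xi> j (twisted \<xi> j g))) x =
      partial i (\<lambda>y. partial i (partial j (partial j g)) y + (2 * ?l j) * partial i (partial j g) y + ?l j * ?l j * partial i g y + 0 * partial i g y) x"
      by (rule partial_cong[OF assms(1,3)]) (rule p1)
    also have "\<dots> = partial i (partial i (partial j (partial j g))) x + (2 * ?l j) * partial i (partial i (partial j g)) x + ?l j * ?l j * partial i (partial i g) x + 0 * partial i (partial i g) x"
      by (rule partial_linear_combination4) (rule d[OF assms(3)])+
    finally show ?thesis .
  qed
  show ?thesis
    unfolding twisted2[OF assms(1) sm assms(3)] p2 p1[OF assms(3)] t[OF assms(3)]
    by (simp add: algebra_simps power2_eq_square)
qed

section \<open>Comparing coefficients of polynomials in \<xi>\<close>

text \<open>A cubic is determined by its values at 0, 1, -1 and 2.\<close>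

lemma cubic_coefficients_zero:
  fixes c0 c1 c2 c3 :: complex
  assumes "\<And>s :: real. c0 + of_real s * c1 + (of_real s)\<^sup>2 * c2 + (of_real s) ^ 3 * c3 = 0"
  shows "c1 = 0" "c2 = 0" "c3 = 0"
proof -
  have 0: "c0 = 0" using assms[of 0] by simp
  have 1: "c1 + c2 + c3 = 0" using assms[of 1] 0 by simp
  have 2: "- c1 + c2 - c3 = 0" using assms[of "-1"] 0 by simp
  have 3: "2 * c1 + 4 * c2 + 8 * c3 = 0" using assms[of 2] 0 by (simp add: power2_eq_square power3_eq_cube)
  have "2 * c2 = (c1 + c2 + c3) + (- c1 + c2 - c3)" by simp
  then show c2: "c2 = 0" unfolding 1 2 by simp
  have "6 * c3 = (2 * c1 + 4 * c2 + 8 * c3) - 2 * (c1 + c2 + c3) - 2 * c2" by simp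
  then have "6 * c3 = 0" unfolding 1 3 by (simp add: c2)
  then show c3: "c3 = 0" by simp
  show "c1 = 0" using 1 c2 c3 by simp
qed

lemma twisted_linear:
  assumes "open S" "smooth_on S f" "smooth_on S g" "\<forall>y\<in>S. F y = f y + c * g y"
  shows "\<forall>x\<in>S. twisted \<xi> i F x = twisted \<xi> i f x + c * twisted \<xi> i g x"
proof
  fix x assume x: "x \<in> S"
  have d: "f differentiable (at x)" "g differentiable (at x)"
    by (rule smooth_on_differentiable[OF assms(2,1) x] smooth_on_differentiable[OF assms(3,1) x])+
  have "partial i F x = partial i (\<lambda>y. f y + c * g y) x"
    using assms(4) by (intro partial_cong[OF assms(1) x]) blast
  also have "\<dots> = partial i f x + c * partial i g x"
    using d by (simp add: partial_add partial_cmult)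
  finally show "twisted \<xi> i F x = twisted \<xi> i f x + c * twisted \<xi> i g x"
    using bspec[OF assms(4) x] by (simp add: twisted_def algebra_simps)
qed

lemma twisted_quartic_linear:
  assumes "open S" "smooth_on S f" "smooth_on S g" "\<forall>y\<in>S. F y = f y + c * g y" "x \<in> S"
  shows "twisted_quartic a2 a11 a1 a0 \<xi> F x =
    twisted_quartic a2 a11 a1 a0 \<xi> f x + c * twisted_quartic a2 a11 a1 a0 \<xi> g x"
proof -
  note sm = smooth_on_twisted[OF assms(1)]
  note 1 = twisted_linear[OF assms(1-4)]
  note 2 = twisted_linear[OF assms(1) sm[OF assms(2)] sm[OF assms(3)] 1]
  note 3 = twisted_linear[OF assms(1) sm[OF sm[OF assms(2)]] sm[OF sm[OF assms(3)]] 2]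
  note 4 = twisted_linear[OF assms(1) sm[OF sm[OF sm[OF assms(2)]]] sm[OF sm[OF sm[OF assms(3)]]] 3]
  show ?thesis
    unfolding twisted_quartic_def 1[rule_format, OF assms(5)] 2[rule_format, OF assms(5)]
      4[rule_format, OF assms(5)] assms(4)[rule_format, OF assms(5)]
    by (simp add: sum.distrib sum_distrib_left algebra_simps)
qed

text \<open>Turns the sums over i < j in the operator into sums over all pairs, to which
  polarisation applies. The subtracted diagonal is the source of the Kronecker terms in the
  identities below.\<close>

lemma sum_less_symmetrize:
  fixes f :: "'n::{finite,linorder} \<Rightarrow> 'n \<Rightarrow> complex"
  shows "(\<Sum>i\<in>UNIV. \<Sum>j | i < j. f i j + f j i) = (\<Sum>i\<in>UNIV. \<Sum>j\<in>UNIV. f i j) - (\<Sum>i\<in>UNIV. f i i)"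
proof -
  have *: "(\<Sum>j | P j. g j) = (\<Sum>j\<in>UNIV. if P j then g j else 0)" for P and g :: "'n \<Rightarrow> complex"
    by (simp add: sum.If_cases)
  have "(\<Sum>i\<in>UNIV. \<Sum>j | i < j. f j i) = (\<Sum>j\<in>UNIV. \<Sum>i\<in>UNIV. if i < j then f j i else 0)"
    unfolding * by (rule sum.swap)
  then have "(\<Sum>i\<in>UNIV. \<Sum>j | i < j. f i j + f j i) =
      (\<Sum>i\<in>UNIV. \<Sum>j\<in>UNIV. (if i < j then f i j else 0) + (if j < i then f i j else 0))"
    by (simp only: sum.distrib *)
  also have "\<dots> = (\<Sum>i\<in>UNIV. \<Sum>j\<in>UNIV. f i j - (if i = j then f i j else 0))"
    by (intro sum.cong refl) auto
  also have "\<dots> = (\<Sum>i\<in>UNIV. \<Sum>j\<in>UNIV. f i j) - (\<Sum>i\<in>UNIV. f i i)"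
    by (simp add: sum_subtractf)
  finally show ?thesis .
qed

lemma linear_form_zero:
  fixes b :: "'n::finite \<Rightarrow> complex"
  assumes "\<And>\<xi> :: real ^ 'n. (\<Sum>i\<in>UNIV. of_real (\<xi> $ i) * b i) = 0"
  shows "b i = 0"
  using assms[of "axis i 1"] by (simp only: axis_sum)

text \<open>Polarisation: the form sees the symmetric part of b, which is recovered from its values
  at e_i, e_j and e_i + e_j.\<close>

lemma quadratic_form_zero:
  fixes b :: "'n::finite \<Rightarrow> 'n \<Rightarrow> complex"
  assumes "\<And>\<xi> :: real ^ 'n. (\<Sum>i\<in>UNIV. of_real (\<xi> $ i) * (\<Sum>j\<in>UNIV. of_real (\<xi> $ j) * b i j)) = 0"
  shows "b i j + b j i = 0"
proof -
  define B where "B u v = (\<Sum>i\<in>UNIV. of_real (u $ i) * (\<Sum>j\<in>UNIV. of_real (v $ j) * b i j))" for u v :: "real ^ 'n"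
  have 1: "B (u + v) w = B u w + B v w" "B w (u + v) = B w u + B w v" for u v w
    by (simp_all add: B_def distrib_right distrib_left sum.distrib)
  have 0: "B u u = 0" for u
    unfolding B_def by (rule assms)
  have "B (axis i 1) (axis j 1) + B (axis j 1) (axis i 1) = 0"
    using 0[of "axis i 1 + axis j 1"] 0[of "axis i 1"] 0[of "axis j 1"] by (simp add: 1 add.commute)
  then show ?thesis
    by (simp only: B_def axis_sum)
qed

text \<open>Polarisation by inclusion and exclusion over the seven non-empty partial sums of three
  axis vectors. All six orderings occur because the form sees the symmetrisation of b.\<close>

lemma cubic_form_zero:
  fixes b :: "'n::finite \<Rightarrow> 'n \<Rightarrow> 'n \<Rightarrow> complex"
  assumes "\<And>\<xi> :: real ^ 'n. (\<Sum>k\<in>UNIV. of_real (\<xi> $ k) * (\<Sum>i\<in>UNIV. of_real (\<xi> $ i) * (\<Sum>j\<in>UNIV. of_real (\<xi> $ j) * b k i j))) = 0"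
  shows "b k i j + b k j i + b i k j + b i j k + b j k i + b j i k = 0"
proof -
  define B where "B u v w = (\<Sum>k\<in>UNIV. of_real (u $ k) * (\<Sum>i\<in>UNIV. of_real (v $ i) * (\<Sum>j\<in>UNIV. of_real (w $ j) * b k i j)))" for u v w :: "real ^ 'n"
  have 1: "B (u + v) w z = B u w z + B v w z" "B w (u + v) z = B w u z + B w v z" "B w z (u + v) = B w z u + B w z v" for u v w z
    by (simp_all add: B_def distrib_right distrib_left sum.distrib)
  have 0: "B u u u = 0" for u
    unfolding B_def by (rule assms)
  have "B u v w + B u w v + B v u w + B v w u + B w u v + B w v u =
      B (u + v + w) (u + v + w) (u + v + w) - B (u + v) (u + v) (u + v) - B (u + w) (u + w) (u + w)
      - B (v + w) (v + w) (v + w) + B u u u + B v v v + B w w w" for u v w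
    unfolding 1 by (simp add: algebra_simps)
  then have "B u v w + B u w v + B v u w + B v w u + B w u v + B w v u = 0" for u v w
    unfolding 0 by simp
  from this[of "axis k 1" "axis i 1" "axis j 1"] show ?thesis
    by (simp only: B_def axis_sum)
qed

section \<open>Symbol identities of a commuting pair\<close>

definition laplacian :: "(real ^ 'n \<Rightarrow> complex) \<Rightarrow> real ^ 'n::finite \<Rightarrow> complex" where
  "laplacian f x = (\<Sum>i\<in>UNIV. partial i (partial i f) x)"

lemma smooth_on_laplacian:
  assumes "open S" "smooth_on S f"
  shows "smooth_on S (laplacian f)"
  unfolding laplacian_def[abs_def]
  by (intro smooth_on_sum smooth_on_partial assms)

text \<open>The identities are local, so the setting is an arbitrary open set with smooth data; the
  shape of R near the hyperplanes enters later.\<close>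

locale commuting_pair =
  fixes a2 a1 :: "'n::{finite,linorder} \<Rightarrow> real ^ 'n::_ \<Rightarrow> complex"
    and a11 :: "'n \<Rightarrow> 'n \<Rightarrow> real ^ 'n::_ \<Rightarrow> complex"
    and a0 R :: "real ^ 'n::_ \<Rightarrow> complex"
    and D :: "(real ^ 'n::_) set"
  assumes D: "open D"
    and smooth_R: "smooth_on D R"
    and smooth_a2: "\<And>i. smooth_on D (a2 i)"
    and smooth_a11: "\<And>i j. i < j \<Longrightarrow> smooth_on D (a11 i j)"
    and smooth_a1: "\<And>i. smooth_on D (a1 i)"
    and smooth_a0: "smooth_on D a0"
    and commute: "commute_on D (schroedinger_op R) (quartic_op a2 a11 a1 a0)"
begin

text \<open>The symmetric matrix of the second-order part of P: each \<open>a11 i j\<close>,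
  meaningful for i < j, is split equally between the entries (i, j) and (j, i).\<close>

definition second_order :: "'n \<Rightarrow> 'n \<Rightarrow> real ^ 'n::_ \<Rightarrow> complex" where
  "second_order i j x = (if i = j then a2 i x else if i < j then a11 i j x / 2 else a11 j i x / 2)"

lemma second_order_sym: "second_order i j = second_order j i"
  by (rule ext) (auto simp: second_order_def)

lemma smooth_second_order: "smooth_on D (second_order i j)"
proof -
  consider "i = j" | "i < j" | "j < i" by (rule linorder_cases)
  then show ?thesis
  proof cases
    case 1
    then show ?thesis using smooth_a2[of i] by (simp add: second_order_def[abs_def])
  next
    case 2
    then have "second_order i j = (\<lambda>x. (1/2) * a11 i j x)"
      by (auto simp: second_order_def fun_eq_iff)
    then show ?thesis
      using smooth_on_cmult[OF D smooth_a11[OF 2], of "1/2"] by simp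
  next
    case 3
    then have "second_order i j = (\<lambda>x. (1/2) * a11 j i x)"
      by (auto simp: second_order_def fun_eq_iff)
    then show ?thesis
      using smooth_on_cmult[OF D smooth_a11[OF 3], of "1/2"] by simp
  qed
qed

lemma symmetrize_second_order:
  "(\<Sum>i\<in>UNIV. a2 i x * (2 * (c i * d i))) + (\<Sum>i\<in>UNIV. \<Sum>j | i < j. a11 i j x * (c i * d j + c j * d i))
    = 2 * (\<Sum>i\<in>UNIV. c i * (\<Sum>j\<in>UNIV. d j * second_order i j x))"
proof -
  define f where "f i j = 2 * (c i * d j * second_order i j x)" for i j
  have "(\<Sum>i\<in>UNIV. \<Sum>j | i < j. a11 i j x * (c i * d j + c j * d i)) = (\<Sum>i\<in>UNIV. \<Sum>j | i < j. f i j + f j i)"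
    by (intro sum.cong refl) (auto simp: f_def second_order_def algebra_simps)
  moreover have "(\<Sum>i\<in>UNIV. a2 i x * (2 * (c i * d i))) = (\<Sum>i\<in>UNIV. f i i)"
    by (intro sum.cong refl) (simp add: f_def second_order_def algebra_simps)
  moreover have "(\<Sum>i\<in>UNIV. \<Sum>j\<in>UNIV. f i j) = 2 * (\<Sum>i\<in>UNIV. c i * (\<Sum>j\<in>UNIV. d j * second_order i j x))"
    by (simp add: f_def sum_distrib_left mult.assoc)
  ultimately show ?thesis
    unfolding sum_less_symmetrize by simp
qed

text \<open>Here h is the symbol of P at \<xi>. Both compositions are applied to
  \<open>expo \<xi>\<close>, on which L acts as multiplication by R - |\<xi>|^2 and P as
  multiplication by h. The products of |\<xi>|^2 with h on the two sides cancel.\<close>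

lemma exponential_identity:
  assumes h: "smooth_on D h" "\<forall>y\<in>D. h y = twisted_quartic a2 a11 a1 a0 \<xi> (\<lambda>_. 1) y" and x: "x \<in> D"
  shows "- laplacian h x - 2 * (\<Sum>i\<in>UNIV. of_real (\<xi> $ i) * partial i h x) + R x * h x
    = twisted_quartic a2 a11 a1 a0 \<xi> R x"
proof -
  define c where "c = (\<Sum>i\<in>(UNIV :: 'n set). (complex_of_real (\<xi> $ i))\<^sup>2)"
  let ?g = "\<lambda>y. R y + (- c) * 1"
  have one: "smooth_on D (\<lambda>_. 1 :: complex)"
    by (rule smooth_on_const[OF D])
  have sg: "smooth_on D ?g"
    by (intro smooth_on_add smooth_R smooth_on_cmult one D)
  have e: "\<forall>y\<in>D. expo \<xi> y = 1 * expo \<xi> y"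
    by simp
  have L: "\<forall>y\<in>D. schroedinger_op R (expo \<xi>) y = ?g y * expo \<xi> y"
  proof
    fix y assume "y \<in> D"
    show "schroedinger_op R (expo \<xi>) y = ?g y * expo \<xi> y"
      unfolding schroedinger_op_mult_expo[OF D one e \<open>y \<in> D\<close>]
      by (simp add: twisted_const c_def power2_eq_square)
  qed
  have P: "\<forall>y\<in>D. quartic_op a2 a11 a1 a0 (expo \<xi>) y = h y * expo \<xi> y"
    using quartic_op_mult_expo[OF D one e] h(2) by simp
  have "schroedinger_op R (quartic_op a2 a11 a1 a0 (expo \<xi>)) x = quartic_op a2 a11 a1 a0 (schroedinger_op R (expo \<xi>)) x"
    using commute x smooth_on_expo[OF D] unfolding commute_on_def by blast
  then have "- (\<Sum>i\<in>UNIV. twisted \<xi> i (twisted \<xi> i h) x) + R x * h x = twisted_quartic a2 a11 a1 a0 \<xi> ?g x"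
    unfolding schroedinger_op_mult_expo[OF D h(1) P x] quartic_op_mult_expo[OF D sg L x] by simp
  also have "\<dots> = twisted_quartic a2 a11 a1 a0 \<xi> R x + (- c) * h x"
    unfolding bspec[OF h(2) x] by (rule twisted_quartic_linear[OF D smooth_R one _ x]) simp
  also have "(\<Sum>i\<in>UNIV. twisted \<xi> i (twisted \<xi> i h) x) =
      laplacian h x + 2 * (\<Sum>i\<in>UNIV. of_real (\<xi> $ i) * partial i h x) + c * h x"
    unfolding twisted2[OF D h(1) x] laplacian_def c_def
    by (simp add: sum.distrib sum_distrib_left sum_distrib_right power2_eq_square mult_ac)
  finally show ?thesis
    by (simp add: algebra_simps)
qed

text \<open>Scaling \<xi> by s makes the degree visible as a power of s. The last bracket is the
  full symbol of P and stays in one piece, because for f = R it cancels against the product R h in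
  \<open>exponential_identity\<close>.\<close>

lemma twisted_quartic_expand:
  fixes \<xi> :: "real ^ 'n::_" and s :: real
  assumes f: "smooth_on D f" and x: "x \<in> D"
  defines "X \<equiv> \<lambda>i. complex_of_real (\<xi> $ i)" and "z \<equiv> complex_of_real s"
  shows "twisted_quartic a2 a11 a1 a0 (s *\<^sub>R \<xi>) f x =
      ((\<Sum>i\<in>UNIV. \<Sum>j | i < j. partial i (partial i (partial j (partial j f))) x)
        + (\<Sum>i\<in>UNIV. a2 i x * partial i (partial i f) x)
        + (\<Sum>i\<in>UNIV. \<Sum>j | i < j. a11 i j x * partial i (partial j f) x)
        + (\<Sum>i\<in>UNIV. a1 i x * partial i f x))
    + z * ((\<Sum>i\<in>UNIV. \<Sum>j | i < j. 2 * X j * partial i (partial i (partial j f)) x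
              + 2 * X i * partial i (partial j (partial j f)) x)
        + ((\<Sum>i\<in>UNIV. a2 i x * (2 * (X i * partial i f x)))
        + (\<Sum>i\<in>UNIV. \<Sum>j | i < j. a11 i j x * (X i * partial j f x + X j * partial i f x))))
    + z\<^sup>2 * (\<Sum>i\<in>UNIV. \<Sum>j | i < j. (X j)\<^sup>2 * partial i (partial i f) x + (X i)\<^sup>2 * partial j (partial j f) x
              + 4 * X i * X j * partial i (partial j f) x)
    + z ^ 3 * (\<Sum>i\<in>UNIV. \<Sum>j | i < j. 2 * X i * (X j)\<^sup>2 * partial i f x + 2 * (X i)\<^sup>2 * X j * partial j f x)
    + (z ^ 4 * (\<Sum>i\<in>UNIV. \<Sum>j | i < j. (X i)\<^sup>2 * (X j)\<^sup>2)
       + z\<^sup>2 * (\<Sum>i\<in>UNIV. X i * (\<Sum>j\<in>UNIV. X j * second_order i j x))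
       + z * (\<Sum>i\<in>UNIV. X i * a1 i x) + a0 x) * f x"
proof -
  have c: "complex_of_real ((s *\<^sub>R \<xi>) $ i) = z * X i" for i
    by (simp add: X_def z_def)
  have "2 * ((\<Sum>i\<in>UNIV. a2 i x * (X i * X i)) + (\<Sum>i\<in>UNIV. \<Sum>j | i < j. a11 i j x * (X i * X j)))
      = (\<Sum>i\<in>UNIV. a2 i x * (2 * (X i * X i))) + (\<Sum>i\<in>UNIV. \<Sum>j | i < j. a11 i j x * (X i * X j + X j * X i))"
    unfolding distrib_left[of 2] sum_distrib_left
    by (intro arg_cong2[where f = "(+)"] sum.cong refl) (simp_all add: algebra_simps)
  then have q: "(\<Sum>i\<in>UNIV. X i * (\<Sum>j\<in>UNIV. X j * second_order i j x)) =
      (\<Sum>i\<in>UNIV. a2 i x * (X i * X i)) + (\<Sum>i\<in>UNIV. \<Sum>j | i < j. a11 i j x * (X i * X j))"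
    unfolding symmetrize_second_order mult_cancel_left by simp
  have t1: "(\<Sum>i\<in>UNIV. \<Sum>j | i < j. twisted (s *\<^sub>R \<xi>) i (twisted (s *\<^sub>R \<xi>) i (twisted (s *\<^sub>R \<xi>) j (twisted (s *\<^sub>R \<xi>) j f))) x) =
      (\<Sum>i\<in>UNIV. \<Sum>j | i < j. partial i (partial i (partial j (partial j f))) x)
      + z * (\<Sum>i\<in>UNIV. \<Sum>j | i < j. 2 * X j * partial i (partial i (partial j f)) x
              + 2 * X i * partial i (partial j (partial j f)) x)
      + z\<^sup>2 * (\<Sum>i\<in>UNIV. \<Sum>j | i < j. (X j)\<^sup>2 * partial i (partial i f) x + (X i)\<^sup>2 * partial j (partial j f) x
              + 4 * X i * X j * partial i (partial j f) x)
      + z ^ 3 * (\<Sum>i\<in>UNIV. \<Sum>j | i < j. 2 * X i * (X j)\<^sup>2 * partial i f x + 2 * (X i)\<^sup>2 * X j * partial j f x)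
      + z ^ 4 * (\<Sum>i\<in>UNIV. \<Sum>j | i < j. (X i)\<^sup>2 * (X j)\<^sup>2) * f x"
    unfolding twisted4[OF D f x] c sum_distrib_left sum_distrib_right sum.distrib[symmetric]
    by (intro sum.cong refl) (simp add: algebra_simps power2_eq_square power3_eq_cube power4_eq_xxxx)
  have t2: "(\<Sum>i\<in>UNIV. a2 i x * twisted (s *\<^sub>R \<xi>) i (twisted (s *\<^sub>R \<xi>) i f) x) =
      (\<Sum>i\<in>UNIV. a2 i x * partial i (partial i f) x)
      + z * (\<Sum>i\<in>UNIV. a2 i x * (2 * (X i * partial i f x)))
      + z\<^sup>2 * (\<Sum>i\<in>UNIV. a2 i x * (X i * X i)) * f x"
    unfolding twisted2[OF D f x] c sum_distrib_left sum_distrib_right sum.distrib[symmetric]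
    by (intro sum.cong refl) (simp add: algebra_simps power2_eq_square)
  have t3: "(\<Sum>i\<in>UNIV. \<Sum>j | i < j. a11 i j x * twisted (s *\<^sub>R \<xi>) i (twisted (s *\<^sub>R \<xi>) j f) x) =
      (\<Sum>i\<in>UNIV. \<Sum>j | i < j. a11 i j x * partial i (partial j f) x)
      + z * (\<Sum>i\<in>UNIV. \<Sum>j | i < j. a11 i j x * (X i * partial j f x + X j * partial i f x))
      + z\<^sup>2 * (\<Sum>i\<in>UNIV. \<Sum>j | i < j. a11 i j x * (X i * X j)) * f x"
    unfolding twisted2[OF D f x] c sum_distrib_left sum_distrib_right sum.distrib[symmetric]
    by (intro sum.cong refl) (simp add: algebra_simps power2_eq_square)
  have t4: "(\<Sum>i\<in>UNIV. a1 i x * twisted (s *\<^sub>R \<xi>) i f x) =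
      (\<Sum>i\<in>UNIV. a1 i x * partial i f x) + z * (\<Sum>i\<in>UNIV. X i * a1 i x) * f x"
    unfolding twisted_def c sum_distrib_left sum_distrib_right sum.distrib[symmetric]
    by (intro sum.cong refl) (simp add: algebra_simps)
  show ?thesis
    unfolding twisted_quartic_def t1 t2 t3 t4 q by (simp add: algebra_simps)
qed

text \<open>These are the coefficients of s^3, s^2 and s in \<open>exponential_identity\<close> at s
  \<xi>. No higher power occurs: the degree-four part of the symbol of P is constant in x, so every
  derivative kills it, and the products of R with the symbol cancel.\<close>

lemma symbol_identities:
  fixes \<xi> :: "real ^ 'n::_"
  assumes x: "x \<in> D"
  defines "X \<equiv> \<lambda>i. complex_of_real (\<xi> $ i)"
  shows "(\<Sum>k\<in>UNIV. X k * (\<Sum>i\<in>UNIV. X i * (\<Sum>j\<in>UNIV. X j * partial k (second_order i j) x)))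
      + (\<Sum>i\<in>UNIV. \<Sum>j | i < j. X i * (X j)\<^sup>2 * partial i R x + (X i)\<^sup>2 * X j * partial j R x) = 0" (is ?c3)
    and "(\<Sum>i\<in>UNIV. X i * (\<Sum>j\<in>UNIV. X j * laplacian (second_order i j) x))
      + 2 * (\<Sum>k\<in>UNIV. X k * (\<Sum>i\<in>UNIV. X i * partial k (a1 i) x))
      + (\<Sum>i\<in>UNIV. \<Sum>j | i < j. (X j)\<^sup>2 * partial i (partial i R) x + (X i)\<^sup>2 * partial j (partial j R) x
              + 4 * X i * X j * partial i (partial j R) x) = 0" (is ?c2)
    and "(\<Sum>i\<in>UNIV. X i * laplacian (a1 i) x) + 2 * (\<Sum>k\<in>UNIV. X k * partial k a0 x)
      + (\<Sum>i\<in>UNIV. \<Sum>j | i < j. 2 * X j * partial i (partial i (partial j R)) x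
              + 2 * X i * partial i (partial j (partial j R)) x)
      + 2 * (\<Sum>i\<in>UNIV. X i * (\<Sum>j\<in>UNIV. partial j R x * second_order i j x)) = 0" (is ?c1)
proof -
  define q2 where "q2 y = (\<Sum>i\<in>UNIV. X i * (\<Sum>j\<in>UNIV. X j * second_order i j y))" for y
  define q1 where "q1 y = (\<Sum>i\<in>UNIV. X i * a1 i y)" for y
  define p where "p = (\<Sum>i\<in>UNIV. \<Sum>j | i < j. (X i)\<^sup>2 * (X j)\<^sup>2)"
  have X: "complex_of_real (\<xi> $ i) = X i" for i
    by (simp add: X_def)
  note dsm = smooth_on_differentiable[OF _ D]
  have sq2: "smooth_on D q2" and sq1: "smooth_on D q1"
    unfolding q2_def[abs_def] q1_def[abs_def]
    by (intro smooth_on_sum smooth_on_cmult smooth_second_order smooth_a1 D)+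
  have q2': "partial k q2 y = (\<Sum>i\<in>UNIV. X i * (\<Sum>j\<in>UNIV. X j * partial k (second_order i j) y))" if "y \<in> D" for k y
  proof -
    have d: "second_order i j differentiable (at y)" for i j
      by (rule dsm[OF smooth_second_order that])
    then have d1: "(\<lambda>y. X j * second_order i j y) differentiable (at y)" for i j
      by (intro differentiable_mult differentiable_const)
    then have d2: "(\<lambda>y. \<Sum>j\<in>UNIV. X j * second_order i j y) differentiable (at y)" for i
      by (intro differentiable_sum) auto
    then have d3: "(\<lambda>y. X i * (\<Sum>j\<in>UNIV. X j * second_order i j y)) differentiable (at y)" for i
      by (intro differentiable_mult differentiable_const)
    show ?thesis
      unfolding q2_def[abs_def] partial_sum[OF d3] partial_cmult[OF d2] partial_sum[OF d1] partial_cmult[OF d] ..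
  qed
  have q1': "partial k q1 y = (\<Sum>i\<in>UNIV. X i * partial k (a1 i) y)" if "y \<in> D" for k y
  proof -
    have d: "a1 i differentiable (at y)" for i
      by (rule dsm[OF smooth_a1 that])
    then have d1: "(\<lambda>y. X i * a1 i y) differentiable (at y)" for i
      by (intro differentiable_mult differentiable_const)
    show ?thesis
      unfolding q1_def[abs_def] partial_sum[OF d1] partial_cmult[OF d] ..
  qed
  have q2'': "partial k (partial k q2) x = (\<Sum>i\<in>UNIV. X i * (\<Sum>j\<in>UNIV. X j * partial k (partial k (second_order i j)) x))" for k
  proof -
    have "partial k (partial k q2) x = partial k (\<lambda>y. \<Sum>i\<in>UNIV. X i * (\<Sum>j\<in>UNIV. X j * partial k (second_order i j) y)) x"
      by (rule partial_cong[OF D x]) (rule q2')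
    have d: "partial k (second_order i j) differentiable (at x)" for i j
      by (rule dsm[OF smooth_on_partial[OF smooth_second_order] x])
    then have d1: "(\<lambda>y. X j * partial k (second_order i j) y) differentiable (at x)" for i j
      by (intro differentiable_mult differentiable_const)
    then have d2: "(\<lambda>y. \<Sum>j\<in>UNIV. X j * partial k (second_order i j) y) differentiable (at x)" for i
      by (intro differentiable_sum) auto
    then have d3: "(\<lambda>y. X i * (\<Sum>j\<in>UNIV. X j * partial k (second_order i j) y)) differentiable (at x)" for i
      by (intro differentiable_mult differentiable_const)
    show ?thesis
      unfolding \<open>partial k (partial k q2) x = _\<close>
        partial_sum[OF d3] partial_cmult[OF d2] partial_sum[OF d1] partial_cmult[OF d] ..
  qed
  have q1'': "partial k (partial k q1) x = (\<Sum>i\<in>UNIV. X i * partial k (partial k (a1 i)) x)" for k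
  proof -
    have "partial k (partial k q1) x = partial k (\<lambda>y. \<Sum>i\<in>UNIV. X i * partial k (a1 i) y) x"
      by (rule partial_cong[OF D x]) (rule q1')
    have d: "partial k (a1 i) differentiable (at x)" for i
      by (rule dsm[OF smooth_on_partial[OF smooth_a1] x])
    then have d1: "(\<lambda>y. X i * partial k (a1 i) y) differentiable (at x)" for i
      by (intro differentiable_mult differentiable_const)
    show ?thesis
      unfolding \<open>partial k (partial k q1) x = _\<close> partial_sum[OF d1] partial_cmult[OF d] ..
  qed
  have lap2: "laplacian q2 x = (\<Sum>i\<in>UNIV. X i * (\<Sum>j\<in>UNIV. X j * laplacian (second_order i j) x))"
    unfolding laplacian_def q2'' sum_distrib_left
    by (rule trans[OF sum.swap]) (intro sum.cong refl sum.swap)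
  have lap1: "laplacian q1 x = (\<Sum>i\<in>UNIV. X i * laplacian (a1 i) x)"
    unfolding laplacian_def q1'' sum_distrib_left by (rule sum.swap)
  define S0 where "S0 = ((\<Sum>i\<in>UNIV. \<Sum>j | i < j. partial i (partial i (partial j (partial j R))) x)
        + (\<Sum>i\<in>UNIV. a2 i x * partial i (partial i R) x)
        + (\<Sum>i\<in>UNIV. \<Sum>j | i < j. a11 i j x * partial i (partial j R) x)
        + (\<Sum>i\<in>UNIV. a1 i x * partial i R x))"
  define S1 where "S1 = (\<Sum>i\<in>UNIV. \<Sum>j | i < j. 2 * X j * partial i (partial i (partial j R)) x
              + 2 * X i * partial i (partial j (partial j R)) x)"
  define S2 where "S2 = (\<Sum>i\<in>UNIV. \<Sum>j | i < j. (X j)\<^sup>2 * partial i (partial i R) x + (X i)\<^sup>2 * partial j (partial j R) x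
              + 4 * X i * X j * partial i (partial j R) x)"
  define S3 where "S3 = (\<Sum>i\<in>UNIV. \<Sum>j | i < j. X i * (X j)\<^sup>2 * partial i R x + (X i)\<^sup>2 * X j * partial j R x)"
  have S3': "(\<Sum>i\<in>UNIV. \<Sum>j | i < j. 2 * X i * (X j)\<^sup>2 * partial i R x + 2 * (X i)\<^sup>2 * X j * partial j R x) = 2 * S3"
    unfolding S3_def sum_distrib_left by (intro sum.cong refl) (simp add: algebra_simps)
  define Q where "Q = 2 * (\<Sum>i\<in>UNIV. X i * (\<Sum>j\<in>UNIV. partial j R x * second_order i j x))"
  have Q: "(\<Sum>i\<in>UNIV. a2 i x * (2 * (X i * partial i R x)))
        + (\<Sum>i\<in>UNIV. \<Sum>j | i < j. a11 i j x * (X i * partial j R x + X j * partial i R x)) = Q"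
    unfolding Q_def by (rule symmetrize_second_order)
  define N2 where "N2 = (\<Sum>k\<in>UNIV. X k * partial k q2 x)"
  define N1 where "N1 = (\<Sum>k\<in>UNIV. X k * partial k q1 x)"
  define N0 where "N0 = (\<Sum>k\<in>UNIV. X k * partial k a0 x)"
  have main: "(laplacian a0 x + S0) + of_real s * (laplacian q1 x + 2 * N0 + S1 + Q)
      + (of_real s)\<^sup>2 * (laplacian q2 x + 2 * N1 + S2) + (of_real s) ^ 3 * (2 * (N2 + S3)) = 0" for s
  proof -
    let ?z = "complex_of_real s"
    let ?h = "\<lambda>y. ?z ^ 4 * p + ?z\<^sup>2 * q2 y + ?z * q1 y + 1 * a0 y"
    have one: "smooth_on D (\<lambda>_. 1 :: complex)" and cst: "smooth_on D (\<lambda>_. ?z ^ 4 * p)"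
      by (rule smooth_on_const[OF D])+
    have sh: "smooth_on D ?h"
      by (intro smooth_on_add cst smooth_on_cmult sq1 sq2 smooth_a0 D)
    have "\<forall>y\<in>D. ?h y = twisted_quartic a2 a11 a1 a0 (s *\<^sub>R \<xi>) (\<lambda>_. 1) y"
    proof
      fix y assume "y \<in> D"
      show "?h y = twisted_quartic a2 a11 a1 a0 (s *\<^sub>R \<xi>) (\<lambda>_. 1) y"
        unfolding twisted_quartic_expand[OF one \<open>y \<in> D\<close>] p_def q2_def q1_def X_def
          by simp
    qed
    note id = exponential_identity[OF sh this x]
    have h1: "partial i ?h y = ?z\<^sup>2 * partial i q2 y + ?z * partial i q1 y + partial i a0 y" if "y \<in> D" for i y
      by (rule trans[OF partial_linear_combination4[OF dsm[OF cst that] dsm[OF sq2 that] dsm[OF sq1 that] dsm[OF smooth_a0 that]]]) simp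
    have h2: "partial i (partial i ?h) x = ?z\<^sup>2 * partial i (partial i q2) x + ?z * partial i (partial i q1) x + partial i (partial i a0) x" for i
    proof -
      have "partial i (partial i ?h) x = partial i (\<lambda>y. 0 + ?z\<^sup>2 * partial i q2 y + ?z * partial i q1 y + 1 * partial i a0 y) x"
        by (rule partial_cong[OF D x]) (use h1 in simp)
      also have "\<dots> = ?z\<^sup>2 * partial i (partial i q2) x + ?z * partial i (partial i q1) x + partial i (partial i a0) x"
        by (rule trans[OF partial_linear_combination4[OF dsm[OF smooth_on_const[OF D] x] dsm[OF smooth_on_partial[OF sq2] x]
              dsm[OF smooth_on_partial[OF sq1] x] dsm[OF smooth_on_partial[OF smooth_a0] x]]]) simp
      finally show ?thesis .
    qed
    have lap: "laplacian ?h x = ?z\<^sup>2 * laplacian q2 x + ?z * laplacian q1 x + laplacian a0 x"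
      unfolding laplacian_def h2 by (simp add: sum.distrib sum_distrib_left)
    have grad: "(\<Sum>i\<in>UNIV. of_real ((s *\<^sub>R \<xi>) $ i) * partial i ?h x) = ?z ^ 3 * N2 + ?z\<^sup>2 * N1 + ?z * N0"
      unfolding h1[OF x] N2_def N1_def N0_def X_def sum_distrib_left sum.distrib[symmetric]
      by (intro sum.cong refl) (simp add: algebra_simps power2_eq_square power3_eq_cube)
    have tq: "twisted_quartic a2 a11 a1 a0 (s *\<^sub>R \<xi>) R x = S0 + ?z * (S1 + Q) + ?z\<^sup>2 * S2 + ?z ^ 3 * (2 * S3) + ?h x * R x"
      unfolding twisted_quartic_expand[OF smooth_R x] X S0_def[symmetric] S1_def[symmetric] S2_def[symmetric]
        S3' Q p_def[symmetric] q2_def[symmetric] q1_def[symmetric] by simp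
    show ?thesis
      using id unfolding lap grad tq by (simp add: algebra_simps)
  qed
  note c = cubic_coefficients_zero[OF main]
  have "N2 + S3 = 0"
    using c(3) by (metis mult_eq_0_iff zero_neq_numeral)
  then show ?c3 unfolding N2_def S3_def q2'[OF x] .
  show ?c2 using c(2) unfolding N1_def S2_def lap2 q1'[OF x] .
  show ?c1 using c(1) unfolding N0_def S1_def lap1 Q_def .
qed

end

section \<open>Identities for the matrix M and the curl-free vector field\<close>

context commuting_pair
begin

lemma sum_mult_delta: "(\<Sum>j\<in>UNIV. c j * (if i = j then d else 0)) = c i * (d :: complex)" for i :: 'n
  by (simp add: if_distrib cong: if_cong)

text \<open>Polarisation of the cubic symbol identity. Symmetry of the matrix identifies the six
  orderings in pairs, which leaves three terms.\<close>

lemma first_identity: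
  assumes x: "x \<in> D"
  shows "partial k (second_order i j) x + partial i (second_order j k) x + partial j (second_order k i) x
     + ((if i = j then partial k R x else 0) + (if j = k then partial i R x else 0) + (if k = i then partial j R x else 0))
     = (if k = i \<and> i = j then 3 * partial k R x else 0)"
proof -
  \<comment> \<open>The contribution of R to the cubic form is the sum over k \<noteq> i of \<xi>_k
    \<xi>_i^2 times the k-th derivative of R. It is stored at the index (k, i, i), with the full
    diagonal removed.\<close>
  define b where "b k i j = partial k (second_order i j) x + (if i = j then partial k R x - (if k = i then partial k R x else 0) else 0)" for k i j
  have "b k i j + b k j i + b i k j + b i j k + b j k i + b j i k = 0"
  proof (rule cubic_form_zero)
    fix \<xi> :: "real ^ 'n::_"
    let ?X = "\<lambda>i. complex_of_real (\<xi> $ i)"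
    define f where "f i j = ?X i * (?X j)\<^sup>2 * partial i R x" for i j
    have "(\<Sum>k\<in>UNIV. ?X k * (\<Sum>i\<in>UNIV. ?X i * (\<Sum>j\<in>UNIV. ?X j * b k i j))) =
       (\<Sum>k\<in>UNIV. ?X k * (\<Sum>i\<in>UNIV. ?X i * (\<Sum>j\<in>UNIV. ?X j * partial k (second_order i j) x)))
       + (\<Sum>k\<in>UNIV. ?X k * ((\<Sum>i\<in>UNIV. ?X i * (?X i * partial k R x)) - (?X k * ?X k) * partial k R x))"
      unfolding b_def distrib_left sum.distrib sum_mult_delta right_diff_distrib sum_subtractf
        sum_mult_delta[of "\<lambda>i. ?X i * ?X i", unfolded mult.assoc] by (simp only: mult.assoc)
    also have "(\<Sum>k\<in>UNIV. ?X k * ((\<Sum>i\<in>UNIV. ?X i * (?X i * partial k R x)) - (?X k * ?X k) * partial k R x))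
        = (\<Sum>i\<in>UNIV. \<Sum>j\<in>UNIV. f i j) - (\<Sum>i\<in>UNIV. f i i)"
      unfolding f_def right_diff_distrib sum_subtractf sum_distrib_left
      by (simp add: power2_eq_square mult_ac)
    also have "\<dots> = (\<Sum>i\<in>UNIV. \<Sum>j | i < j. f i j + f j i)"
      by (rule sum_less_symmetrize[symmetric])
    also have "\<dots> = (\<Sum>i\<in>UNIV. \<Sum>j | i < j. ?X i * (?X j)\<^sup>2 * partial i R x + (?X i)\<^sup>2 * ?X j * partial j R x)"
      by (intro sum.cong refl) (simp add: f_def mult_ac)
    finally show "(\<Sum>k\<in>UNIV. ?X k * (\<Sum>i\<in>UNIV. ?X i * (\<Sum>j\<in>UNIV. ?X j * b k i j))) = 0"
      using symbol_identities(1)[OF x, of \<xi>] by simp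
  qed
  moreover have "b k i j = b k j i" "b i k j = b i j k" "b j k i = b j i k"
    unfolding b_def second_order_sym[of i j] second_order_sym[of k j] second_order_sym[of k i] by auto
  ultimately have "2 * (b k i j + b i j k + b j k i) = 0"
    by (simp add: algebra_simps)
  then have "b k i j + b i j k + b j k i = 0"
    by (metis mult_eq_0_iff zero_neq_numeral)
  then show ?thesis
    by (auto simp: b_def algebra_simps split: if_splits)
qed

lemma second_identity:
  assumes x: "x \<in> D"
  shows "partial i (a1 j) x + partial j (a1 i) x + laplacian (second_order i j) x + 2 * partial i (partial j R) x
    + (if i = j then laplacian R x - 3 * partial i (partial i R) x else 0) = 0"
proof -
  \<comment> \<open>The 3 arises when the sum over i < j is completed to all pairs: a diagonal term
    carries one second derivative from the squares and two from the mixed part.\<close>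
  define b where "b i j = laplacian (second_order i j) x + 2 * partial i (a1 j) x + 2 * partial i (partial j R) x
    + (if i = j then laplacian R x - 3 * partial i (partial i R) x else 0)" for i j
  have "b i j + b j i = 0"
  proof (rule quadratic_form_zero)
    fix \<xi> :: "real ^ 'n::_"
    let ?X = "\<lambda>i. complex_of_real (\<xi> $ i)"
    define f where "f i j = (?X j)\<^sup>2 * partial i (partial i R) x + 2 * ?X i * ?X j * partial i (partial j R) x" for i j
    have "(\<Sum>i\<in>UNIV. ?X i * (\<Sum>j\<in>UNIV. ?X j * b i j)) =
       (\<Sum>i\<in>UNIV. ?X i * (\<Sum>j\<in>UNIV. ?X j * laplacian (second_order i j) x))
       + 2 * (\<Sum>i\<in>UNIV. ?X i * (\<Sum>j\<in>UNIV. ?X j * partial i (a1 j) x))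
       + (2 * (\<Sum>i\<in>UNIV. ?X i * (\<Sum>j\<in>UNIV. ?X j * partial i (partial j R) x))
          + (\<Sum>i\<in>UNIV. ?X i * (?X i * (laplacian R x - 3 * partial i (partial i R) x))))"
      unfolding b_def distrib_left sum.distrib sum_mult_delta mult.left_commute[of _ 2] sum_distrib_left[symmetric]
      by (simp only: add.assoc)
    also have "2 * (\<Sum>i\<in>UNIV. ?X i * (\<Sum>j\<in>UNIV. ?X j * partial i (partial j R) x))
          + (\<Sum>i\<in>UNIV. ?X i * (?X i * (laplacian R x - 3 * partial i (partial i R) x)))
        = (\<Sum>i\<in>UNIV. \<Sum>j\<in>UNIV. f i j) - (\<Sum>i\<in>UNIV. f i i)"
    proof -
      have "(\<Sum>i\<in>UNIV. \<Sum>j\<in>UNIV. (?X j)\<^sup>2 * partial i (partial i R) x) = (\<Sum>j\<in>UNIV. ?X j * (?X j * laplacian R x))"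
        unfolding laplacian_def sum_distrib_left by (subst sum.swap) (simp add: power2_eq_square mult_ac)
      moreover have "(\<Sum>i\<in>UNIV. \<Sum>j\<in>UNIV. 2 * ?X i * ?X j * partial i (partial j R) x)
          = 2 * (\<Sum>i\<in>UNIV. ?X i * (\<Sum>j\<in>UNIV. ?X j * partial i (partial j R) x))"
        by (simp only: sum_distrib_left mult.assoc)
      moreover have "(\<Sum>i\<in>UNIV. f i i) = (\<Sum>i\<in>UNIV. ?X i * (?X i * (3 * partial i (partial i R) x)))"
        unfolding f_def by (intro sum.cong refl) (simp add: power2_eq_square algebra_simps)
      ultimately show ?thesis
        by (simp add: f_def[of _ _] sum.distrib right_diff_distrib sum_subtractf)
    qed
    also have "\<dots> = (\<Sum>i\<in>UNIV. \<Sum>j | i < j. f i j + f j i)"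
      by (rule sum_less_symmetrize[symmetric])
    also have "\<dots> = (\<Sum>i\<in>UNIV. \<Sum>j | i < j. (?X j)\<^sup>2 * partial i (partial i R) x + (?X i)\<^sup>2 * partial j (partial j R) x
              + 4 * ?X i * ?X j * partial i (partial j R) x)"
    proof (intro sum.cong refl)
      fix i j
      show "f i j + f j i = (?X j)\<^sup>2 * partial i (partial i R) x + (?X i)\<^sup>2 * partial j (partial j R) x
              + 4 * ?X i * ?X j * partial i (partial j R) x"
        unfolding f_def partial_commute[OF D smooth_R x, of j i] by (simp add: algebra_simps)
    qed
    finally show "(\<Sum>i\<in>UNIV. ?X i * (\<Sum>j\<in>UNIV. ?X j * b i j)) = 0"
      using symbol_identities(2)[OF x, of \<xi>] by simp
  qed
  then have "2 * (partial i (a1 j) x + partial j (a1 i) x + laplacian (second_order i j) x + 2 * partial i (partial j R) x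
    + (if i = j then laplacian R x - 3 * partial i (partial i R) x else 0)) = 0"
    unfolding b_def second_order_sym[of j i] partial_commute[OF D smooth_R x, of j i]
    by (auto simp: algebra_simps)
  then show ?thesis
    by (metis mult_eq_0_iff zero_neq_numeral)
qed

lemma third_identity:
  assumes x: "x \<in> D"
  shows "laplacian (a1 i) x + 2 * partial i a0 x + 2 * (\<Sum>j\<in>UNIV. partial i (partial j (partial j R)) x)
     - 2 * partial i (partial i (partial i R)) x + 2 * (\<Sum>j\<in>UNIV. partial j R x * second_order i j x) = 0"
proof -
  define b where "b i = laplacian (a1 i) x + 2 * partial i a0 x + 2 * (\<Sum>j\<in>UNIV. partial i (partial j (partial j R)) x)
     - 2 * partial i (partial i (partial i R)) x + 2 * (\<Sum>j\<in>UNIV. partial j R x * second_order i j x)" for i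
  have "b i = 0"
  proof (rule linear_form_zero)
    fix \<xi> :: "real ^ 'n::_"
    let ?X = "\<lambda>i. complex_of_real (\<xi> $ i)"
    define f where "f i j = 2 * ?X i * partial i (partial j (partial j R)) x" for i j
    have "(\<Sum>i\<in>UNIV. ?X i * b i) = (\<Sum>i\<in>UNIV. ?X i * laplacian (a1 i) x) + 2 * (\<Sum>i\<in>UNIV. ?X i * partial i a0 x)
        + ((\<Sum>i\<in>UNIV. \<Sum>j\<in>UNIV. f i j) - (\<Sum>i\<in>UNIV. f i i))
        + 2 * (\<Sum>i\<in>UNIV. ?X i * (\<Sum>j\<in>UNIV. partial j R x * second_order i j x))"
      unfolding b_def f_def
      by (simp add: distrib_left right_diff_distrib sum.distrib sum_subtractf sum_distrib_left mult_ac)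
    also have "(\<Sum>i\<in>UNIV. \<Sum>j\<in>UNIV. f i j) - (\<Sum>i\<in>UNIV. f i i) = (\<Sum>i\<in>UNIV. \<Sum>j | i < j. f i j + f j i)"
      by (rule sum_less_symmetrize[symmetric])
    also have "\<dots> = (\<Sum>i\<in>UNIV. \<Sum>j | i < j. 2 * ?X j * partial i (partial i (partial j R)) x
              + 2 * ?X i * partial i (partial j (partial j R)) x)"
    proof (intro sum.cong refl)
      fix i j
      have "partial i (partial i (partial j R)) x = partial i (partial j (partial i R)) x"
        by (rule partial_cong[OF D x]) (rule partial_commute[OF D smooth_R])
      also have "\<dots> = partial j (partial i (partial i R)) x"
        by (rule partial_commute[OF D smooth_on_partial[OF smooth_R] x])
      finally show "f i j + f j i = 2 * ?X j * partial i (partial i (partial j R)) x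
              + 2 * ?X i * partial i (partial j (partial j R)) x"
        by (simp add: f_def)
    qed
    finally show "(\<Sum>i\<in>UNIV. ?X i * b i) = 0"
      using symbol_identities(3)[OF x, of \<xi>] by simp
  qed
  then show ?thesis
    by (simp only: b_def)
qed

text \<open>All identities hold on D, not everywhere. As D is open, agreement on D is respected by
  \<open>partial\<close> and \<open>laplacian\<close>, so it can be used for rewriting under
  derivatives.\<close>

definition eqv :: "(real ^ 'n::_ \<Rightarrow> complex) \<Rightarrow> (real ^ 'n::_ \<Rightarrow> complex) \<Rightarrow> bool" (infix "\<doteq>" 50) where
  "f \<doteq> g \<longleftrightarrow> (\<forall>x\<in>D. f x = g x)"

lemma eqvI: "(\<And>x. x \<in> D \<Longrightarrow> f x = g x) \<Longrightarrow> f \<doteq> g"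
  by (simp add: eqv_def)

lemma eqvD: "f \<doteq> g \<Longrightarrow> x \<in> D \<Longrightarrow> f x = g x"
  by (simp add: eqv_def)

lemma eqv_trans [trans]: "f \<doteq> g \<Longrightarrow> g \<doteq> h \<Longrightarrow> f \<doteq> h"
  by (simp add: eqv_def)

lemma eqv_sym: "f \<doteq> g \<Longrightarrow> g \<doteq> f"
  by (simp add: eqv_def)

lemma eqv_partial: "f \<doteq> g \<Longrightarrow> partial i f \<doteq> partial i g"
  unfolding eqv_def using partial_cong[OF D] by metis

lemma eqv_commute: "smooth_on D f \<Longrightarrow> partial i (partial j f) \<doteq> partial j (partial i f)"
  by (rule eqvI) (rule partial_commute[OF D])

lemma eqv_commute2: "smooth_on D f \<Longrightarrow> partial i (partial j (partial j f)) \<doteq> partial j (partial j (partial i f))"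
  by (rule eqv_trans[OF eqv_commute[OF smooth_on_partial] eqv_partial[OF eqv_commute]])

lemma partial_laplacian:
  assumes "smooth_on D f"
  shows "partial i (laplacian f) \<doteq> laplacian (partial i f)"
proof (rule eqvI)
  fix x assume x: "x \<in> D"
  have "partial i (laplacian f) x = (\<Sum>m\<in>UNIV. partial i (partial m (partial m f)) x)"
    unfolding laplacian_def[abs_def]
    by (rule partial_sum) (rule smooth_on_differentiable[OF smooth_on_partial[OF smooth_on_partial[OF assms]] D x])
  then show "partial i (laplacian f) x = laplacian (partial i f) x"
    using eqvD[OF eqv_commute2[OF assms] x] by (simp add: laplacian_def)
qed

lemma partial_sum_eqv:
  assumes "\<And>m. smooth_on D (f m)"
  shows "partial i (\<lambda>x. \<Sum>m\<in>K. f m x) \<doteq> (\<lambda>x. \<Sum>m\<in>K. partial i (f m) x)"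
  by (intro eqvI partial_sum smooth_on_differentiable[OF assms D])

lemma partial_lincomb_eqv:
  assumes "smooth_on D f" "smooth_on D g"
  shows "partial i (\<lambda>x. c * f x + d * g x) \<doteq> (\<lambda>x. c * partial i f x + d * partial i g x)"
proof (rule eqvI)
  fix x assume "x \<in> D"
  note this[THEN smooth_on_differentiable[OF assms(1) D]] this[THEN smooth_on_differentiable[OF assms(2) D]]
  then show "partial i (\<lambda>x. c * f x + d * g x) x = c * partial i f x + d * partial i g x"
    by (simp add: partial_add partial_cmult)
qed

lemma laplacian_lincomb_eqv:
  assumes "smooth_on D f" "smooth_on D g"
  shows "laplacian (\<lambda>x. c * f x + d * g x) \<doteq> (\<lambda>x. c * laplacian f x + d * laplacian g x)"
proof (rule eqvI)
  fix x assume "x \<in> D"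
  have "partial i (partial i (\<lambda>x. c * f x + d * g x)) \<doteq> (\<lambda>x. c * partial i (partial i f) x + d * partial i (partial i g) x)" for i
    by (rule eqv_trans[OF eqv_partial[OF partial_lincomb_eqv] partial_lincomb_eqv]) (intro assms smooth_on_partial)+
  from eqvD[OF this \<open>x \<in> D\<close>] show "laplacian (\<lambda>x. c * f x + d * g x) x = c * laplacian f x + d * laplacian g x"
    by (simp add: laplacian_def sum.distrib sum_distrib_left)
qed

lemma laplacian_cong: "f \<doteq> g \<Longrightarrow> laplacian f \<doteq> laplacian g"
  unfolding laplacian_def[abs_def]
  by (rule eqvI) (intro sum.cong refl, rule eqvD[OF eqv_partial[OF eqv_partial]])

lemma laplacian_sum_eqv:
  assumes "\<And>m. smooth_on D (f m)"
  shows "laplacian (\<lambda>x. \<Sum>m\<in>K. f m x) \<doteq> (\<lambda>x. \<Sum>m\<in>K. laplacian (f m) x)"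
proof (rule eqvI)
  fix x assume "x \<in> D"
  have "partial i (partial i (\<lambda>x. \<Sum>m\<in>K. f m x)) \<doteq> (\<lambda>x. \<Sum>m\<in>K. partial i (partial i (f m)) x)" for i
    by (rule eqv_trans[OF eqv_partial[OF partial_sum_eqv] partial_sum_eqv]) (intro assms smooth_on_partial)+
  from eqvD[OF this \<open>x \<in> D\<close>] show "laplacian (\<lambda>x. \<Sum>m\<in>K. f m x) x = (\<Sum>m\<in>K. laplacian (f m) x)"
    unfolding laplacian_def by (simp add: sum.swap[of _ K])
qed

text \<open>The matrix M of the overview. The added R absorbs the terms of
  \<open>first_identity\<close> in which just two indices coincide, so a right-hand side survives on
  the full diagonal alone.\<close>

definition shifted :: "'n \<Rightarrow> 'n \<Rightarrow> real ^ 'n::_ \<Rightarrow> complex" where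
  "shifted i j x = second_order i j x + (if i = j then R x else 0)"

lemma shifted_sym: "shifted i j = shifted j i"
  by (rule ext) (simp add: shifted_def second_order_sym[of i j])

lemma smooth_shifted: "smooth_on D (shifted i j)"
  unfolding shifted_def[abs_def]
  by (cases "i = j") (simp_all add: smooth_on_add[OF D smooth_second_order smooth_R] smooth_second_order)

lemma partial_shifted:
  "partial k (shifted i j) \<doteq> (\<lambda>x. partial k (second_order i j) x + (if i = j then partial k R x else 0))"
proof (rule eqvI)
  fix x assume "x \<in> D"
  note d = smooth_on_differentiable[OF smooth_second_order D this] smooth_on_differentiable[OF smooth_R D this]
  show "partial k (shifted i j) x = partial k (second_order i j) x + (if i = j then partial k R x else 0)"
    unfolding shifted_def[abs_def] using d by (cases "i = j") (simp_all add: partial_add)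
qed

lemma laplacian_shifted:
  "laplacian (shifted i j) \<doteq> (\<lambda>x. laplacian (second_order i j) x + (if i = j then laplacian R x else 0))"
proof (cases "i = j")
  case True
  show ?thesis
    using laplacian_lincomb_eqv[OF smooth_second_order[of i j] smooth_R, of 1 1] True
    by (simp add: shifted_def[abs_def])
qed (simp add: shifted_def[abs_def] eqv_def)

lemma shifted_identity:
  assumes x: "x \<in> D"
  shows "partial k (shifted i j) x + partial i (shifted j k) x + partial j (shifted k i) x
    = (if k = i \<and> i = j then 3 * partial k R x else 0)"
  using first_identity[OF x, of k i j] unfolding partial_shifted[THEN eqvD, OF x] by (simp add: algebra_simps)

lemma shifted_diagonal: "partial k (shifted k k) \<doteq> partial k R"
proof (rule eqvI)
  fix x assume "x \<in> D"
  have "3 * partial k (shifted k k) x = 3 * partial k R x"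
    using shifted_identity[OF \<open>x \<in> D\<close>, of k k k] by simp
  then show "partial k (shifted k k) x = partial k R x" by simp
qed

text \<open>For k \<noteq> l the identities with indices (l, k, k) and (k, l, l) give
  \<open>\<partial>\<^sub>l\<^sup>2 M\<^sub>k\<^sub>k = - 2 \<partial>\<^sub>k \<partial>\<^sub>l
  M\<^sub>k\<^sub>l = \<partial>\<^sub>k\<^sup>2 M\<^sub>l\<^sub>l\<close>. Applying
  \<open>\<partial>\<^sub>k \<partial>\<^sub>l\<close> and replacing diagonal derivatives by
  \<open>shifted_diagonal\<close> leaves R alone.\<close>

lemma fourth_order_identity: "partial l (partial k (partial k (partial k R))) \<doteq> partial k (partial l (partial l (partial l R)))"
proof (cases "k = l")
  case False
  have b: "partial l (partial l (shifted k k)) \<doteq> (\<lambda>x. (- 2) * partial l (partial k (shifted k l)) x + 0 * R x)" if "k \<noteq> l" for k l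
  proof -
    have "partial l (shifted k k) \<doteq> (\<lambda>x. (- 2) * partial k (shifted k l) x + 0 * R x)"
    proof (rule eqvI)
      fix x assume "x \<in> D"
      then have "partial l (shifted k k) x + partial k (shifted k l) x + partial k (shifted k l) x = 0"
        using shifted_identity[OF \<open>x \<in> D\<close>, of l k k] that by (simp add: shifted_sym[of l k])
      then show "partial l (shifted k k) x = (- 2) * partial k (shifted k l) x + 0 * R x"
        by (simp add: eq_neg_iff_add_eq_0 add.commute)
    qed
    from eqv_trans[OF eqv_partial[OF this] partial_lincomb_eqv[OF smooth_on_partial[OF smooth_shifted] smooth_R, of l]]
    show ?thesis by (simp add: eqv_def)
  qed
  have "partial l (partial l (shifted k k)) \<doteq> partial k (partial k (shifted l l))"
    using b[OF False] b[OF False[symmetric]] eqv_commute[OF smooth_shifted[of k l], of l k]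
    unfolding eqv_def shifted_sym[of l k] by simp
  then have 1: "partial k (partial l (partial l (shifted k k))) \<doteq> partial k (partial k (partial k (shifted l l)))"
    by (rule eqv_partial)
  note sp = smooth_on_partial
  have 2: "partial k (partial l (partial l (shifted k k))) \<doteq> partial l (partial l (partial k R))"
    by (rule eqv_trans[OF eqv_commute2[OF smooth_shifted] eqv_partial[OF eqv_partial[OF shifted_diagonal]]])
  have "partial l (partial l (partial l (partial k R))) \<doteq> partial l (partial k (partial k (partial k (shifted l l))))"
    by (rule eqv_partial[OF eqv_trans[OF eqv_sym[OF 2] 1]])
  also have "\<dots> \<doteq> partial k (partial l (partial k (partial k (shifted l l))))"
    by (rule eqv_commute[OF sp[OF sp[OF smooth_shifted]]])
  also have "\<dots> \<doteq> partial k (partial k (partial k (partial l (shifted l l))))"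
    by (rule eqv_partial[OF eqv_commute2[OF smooth_shifted]])
  also have "\<dots> \<doteq> partial k (partial k (partial k (partial l R)))"
    by (rule eqv_partial[OF eqv_partial[OF eqv_partial[OF shifted_diagonal]]])
  finally have 3: "partial l (partial l (partial l (partial k R))) \<doteq> partial k (partial k (partial k (partial l R)))" .
  have 4: "partial k (partial l (partial l (partial l R))) \<doteq> partial l (partial l (partial l (partial k R)))" for k l
    by (rule eqv_trans[OF eqv_commute[OF sp[OF sp[OF smooth_R]]] eqv_partial[OF eqv_commute2[OF smooth_R]]])
  show ?thesis
    by (rule eqv_trans[OF 4[of l k] eqv_sym[OF eqv_trans[OF 4[of k l] 3]]])
qed (simp add: eqv_def)

text \<open>The divergence of \<open>second_identity\<close> in one index produces
  \<open>laplacian (a1 l)\<close> and the gradient of the divergence of \<open>a1\<close>. The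
  divergence V of the matrix M is itself a gradient, determined by R and the trace T. Only the
  diagonal correction, three times a pure third derivative of R, is not absorbed in \<Psi>.\<close>

lemma laplacian_first_order:
  obtains \<Psi> where "smooth_on D \<Psi>" "\<And>l. laplacian (a1 l) \<doteq> (\<lambda>x. partial l \<Psi> x + 3 * partial l (partial l (partial l R)) x)"
proof -
  define dv where "dv x = (\<Sum>m\<in>UNIV. partial m (a1 m) x)" for x
  define T where "T x = (\<Sum>m\<in>UNIV. shifted m m x)" for x
  define V where "V l x = (\<Sum>m\<in>UNIV. partial m (shifted m l) x)" for l x
  note sp = smooth_on_partial and sl = smooth_on_laplacian[OF D]
  have sT: "smooth_on D T" and sdv: "smooth_on D dv"
    unfolding T_def[abs_def] dv_def[abs_def] by (intro smooth_on_sum D smooth_shifted sp smooth_a1)+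
  \<comment> \<open>The factor - 7 / 2 collects - 2 from the Hessian of R in
    \<open>second_identity\<close> and - 3 / 2 from R in V; the 1 / 2 at T comes from V as
    well.\<close>
  define \<Psi> where "\<Psi> x = 1 * (- 1 * dv x + (- 7 / 2) * laplacian R x) + (1 / 2) * laplacian T x" for x
  have V: "V l \<doteq> (\<lambda>x. (3 / 2) * partial l R x + (- 1 / 2) * partial l T x)" for l
  proof (rule eqvI)
    fix x assume x: "x \<in> D"
    have "partial l T x + 2 * V l x = (\<Sum>m\<in>UNIV. partial l (shifted m m) x + partial m (shifted m l) x + partial m (shifted l m) x)"
      unfolding T_def[abs_def] eqvD[OF partial_sum_eqv[OF smooth_shifted] x] V_def
      by (simp add: sum.distrib shifted_sym[of l] sum_distrib_left)
    also have "\<dots> = 3 * partial l R x"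
      unfolding shifted_identity[OF x] by simp
    finally show "V l x = (3 / 2) * partial l R x + (- 1 / 2) * partial l T x"
      by (simp add: field_simps)
  qed
  have LV: "laplacian (V l) \<doteq> (\<lambda>x. (3 / 2) * laplacian (partial l R) x + (- 1 / 2) * laplacian (partial l T) x)" for l
    by (rule eqv_trans[OF laplacian_cong[OF V] laplacian_lincomb_eqv[OF sp[OF smooth_R] sp[OF sT]]])
  have LV': "laplacian (V l) \<doteq> (\<lambda>x. \<Sum>m\<in>UNIV. laplacian (partial m (shifted m l)) x)" for l
    unfolding V_def[abs_def] by (rule laplacian_sum_eqv[OF sp[OF smooth_shifted]])
  have e: "(\<lambda>x. 1 * partial m (a1 l) x + 1 * partial l (a1 m) x) \<doteq>
      (\<lambda>x. 1 * (- 1 * laplacian (shifted m l) x + (- 2) * partial m (partial l R) x) + (if m = l then 3 else 0) * partial l (partial l R) x)" for m l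
  proof (rule eqvI)
    fix x assume x: "x \<in> D"
    show "1 * partial m (a1 l) x + 1 * partial l (a1 m) x =
      1 * (- 1 * laplacian (shifted m l) x + (- 2) * partial m (partial l R) x) + (if m = l then 3 else 0) * partial l (partial l R) x"
      using second_identity[OF x, of m l] unfolding eqvD[OF laplacian_shifted x]
      by (simp add: eq_neg_iff_add_eq_0 algebra_simps split: if_splits)
  qed
  have de: "1 * partial m (partial m (a1 l)) x + 1 * partial m (partial l (a1 m)) x =
      1 * (- 1 * partial m (laplacian (shifted m l)) x + (- 2) * partial m (partial m (partial l R)) x)
      + (if m = l then 3 else 0) * partial m (partial l (partial l R)) x" if "x \<in> D" for m l x
  proof -
    let ?f = "\<lambda>x. - 1 * laplacian (shifted m l) x + (- 2) * partial m (partial l R) x"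
    have sf: "smooth_on D ?f"
      by (intro smooth_on_add smooth_on_cmult D sl smooth_shifted sp smooth_R)
    have "1 * partial m (partial m (a1 l)) x + 1 * partial m (partial l (a1 m)) x = partial m (\<lambda>x. 1 * partial m (a1 l) x + 1 * partial l (a1 m) x) x"
      by (rule eqvD[OF partial_lincomb_eqv[OF sp[OF smooth_a1] sp[OF smooth_a1]] that, symmetric])
    also have "\<dots> = partial m (\<lambda>x. 1 * ?f x + (if m = l then 3 else 0) * partial l (partial l R) x) x"
      by (rule eqvD[OF eqv_partial[OF e] that])
    also have "\<dots> = 1 * partial m ?f x + (if m = l then 3 else 0) * partial m (partial l (partial l R)) x"
      by (rule eqvD[OF partial_lincomb_eqv[OF sf sp[OF sp[OF smooth_R]]] that])
    also have "partial m ?f x = - 1 * partial m (laplacian (shifted m l)) x + (- 2) * partial m (partial m (partial l R)) x"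
      by (rule eqvD[OF partial_lincomb_eqv[OF sl[OF smooth_shifted] sp[OF sp[OF smooth_R]]] that])
    finally show ?thesis .
  qed
  have "laplacian (a1 l) \<doteq> (\<lambda>x. partial l \<Psi> x + 3 * partial l (partial l (partial l R)) x)" for l
  proof (rule eqvI)
    fix x assume x: "x \<in> D"
    have "laplacian (a1 l) x + partial l dv x = (\<Sum>m\<in>UNIV. 1 * partial m (partial m (a1 l)) x + 1 * partial m (partial l (a1 m)) x)"
      unfolding laplacian_def dv_def[abs_def] eqvD[OF partial_sum_eqv[OF sp[OF smooth_a1]] x]
        partial_commute[OF D smooth_a1 x, of l] by (simp add: sum.distrib)
    also have "\<dots> = (\<Sum>m\<in>UNIV. - laplacian (partial m (shifted m l)) x) + (\<Sum>m\<in>UNIV. (- 2) * partial m (partial m (partial l R)) x)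
       + (\<Sum>m\<in>UNIV. if m = l then 3 * partial m (partial l (partial l R)) x else 0)"
      unfolding de[OF x] eqvD[OF partial_laplacian[OF smooth_shifted] x] sum.distrib[symmetric]
      by (intro sum.cong refl) simp
    also have "\<dots> = - laplacian (V l) x - 2 * laplacian (partial l R) x + 3 * partial l (partial l (partial l R)) x"
      unfolding eqvD[OF LV' x] by (simp add: sum_negf laplacian_def sum_distrib_left)
    also have "\<dots> = (- 7 / 2) * partial l (laplacian R) x + (1 / 2) * partial l (laplacian T) x + 3 * partial l (partial l (partial l R)) x"
      unfolding eqvD[OF LV x] eqvD[OF partial_laplacian[OF smooth_R] x] eqvD[OF partial_laplacian[OF sT] x]
      by (simp add: field_simps)
    finally have 1: "laplacian (a1 l) x + partial l dv x = (- 7 / 2) * partial l (laplacian R) x + (1 / 2) * partial l (laplacian T) x + 3 * partial l (partial l (partial l R)) x" .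
    let ?f = "\<lambda>x. - 1 * dv x + (- 7 / 2) * laplacian R x"
    have sf: "smooth_on D ?f"
      by (intro smooth_on_add smooth_on_cmult D sl sdv smooth_R)
    have "partial l \<Psi> x = 1 * partial l ?f x + (1 / 2) * partial l (laplacian T) x"
      unfolding \<Psi>_def[abs_def] by (rule eqvD[OF partial_lincomb_eqv[OF sf sl[OF sT]] x])
    also have "partial l ?f x = - 1 * partial l dv x + (- 7 / 2) * partial l (laplacian R) x"
      by (rule eqvD[OF partial_lincomb_eqv[OF sdv sl[OF smooth_R]] x])
    finally have 2: "partial l \<Psi> x = - partial l dv x + (- 7 / 2) * partial l (laplacian R) x + (1 / 2) * partial l (laplacian T) x"
      by simp
    show "laplacian (a1 l) x = partial l \<Psi> x + 3 * partial l (partial l (partial l R)) x"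
      unfolding 2 using 1 by (simp add: algebra_simps)
  qed
  moreover have "smooth_on D \<Psi>"
    unfolding \<Psi>_def[abs_def] by (intro smooth_on_add smooth_on_cmult D sl sdv sT smooth_R)
  ultimately show thesis
    using that by blast
qed

end

lemma dird_sum:
  assumes "\<And>k. k \<in> K \<Longrightarrow> f k differentiable (at x)"
  shows "dird u (\<lambda>x. \<Sum>k\<in>K. f k x) x = (\<Sum>k\<in>K. dird u (f k) x)"
proof -
  have "partial i (\<lambda>x. \<Sum>k\<in>K. f k x) x = (\<Sum>k\<in>K. partial i (f k) x)" for i
    by (rule partial_sum) (rule assms)
  then show ?thesis
    unfolding dird_def by (simp only: sum_distrib_left) (rule sum.swap)
qed

lemma dird_cmult:
  assumes "f differentiable (at x)"
  shows "dird u (\<lambda>x. c * f x) x = c * dird u f x"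
  unfolding dird_def partial_cmult[OF assms] sum_distrib_left by (simp add: mult.left_commute)

lemma dird_add:
  assumes "f differentiable (at x)" "g differentiable (at x)"
  shows "dird u (\<lambda>x. f x + g x) x = dird u f x + dird u g x"
  unfolding dird_def partial_add[OF assms] by (simp add: distrib_left sum.distrib)

lemma dird_diff:
  assumes "f differentiable (at x)" "g differentiable (at x)"
  shows "dird u (\<lambda>x. f x - g x) x = dird u f x - dird u g x"
  unfolding dird_def partial_diff[OF assms] by (simp add: right_diff_distrib sum_subtractf)

lemma dird_mult:
  assumes "f differentiable (at x)" "g differentiable (at x)"
  shows "dird u (\<lambda>x. f x * g x) x = dird u f x * g x + f x * dird u g x"
  unfolding dird_def partial_mult[OF assms]
  by (simp add: algebra_simps sum.distrib sum_distrib_left sum_distrib_right)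

lemma dird_cong:
  assumes "open S" "x \<in> S" "\<And>y. y \<in> S \<Longrightarrow> f y = g y"
  shows "dird u f x = dird u g x"
  unfolding dird_def by (intro sum.cong refl arg_cong2[where f = "(*)"] partial_cong[OF assms(1,2)] assms(3))

context commuting_pair
begin

text \<open>\<open>third_identity\<close> with \<open>laplacian_first_order\<close> inserted: of the
  pure third derivatives 3 - 2 = 1 remains, and division by 2 gives the factor - 1 / 2. Everything
  else is a gradient.\<close>

lemma gradient_identity:
  obtains \<Theta> where "smooth_on D \<Theta>"
    "\<And>k. (\<lambda>x. \<Sum>j\<in>UNIV. partial j R x * second_order k j x) \<doteq>
       (\<lambda>x. 1 * partial k \<Theta> x + (- 1 / 2) * partial k (partial k (partial k R)) x)"
proof -
  obtain \<Psi> where \<Psi>: "smooth_on D \<Psi>"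
    "\<And>l. laplacian (a1 l) \<doteq> (\<lambda>x. partial l \<Psi> x + 3 * partial l (partial l (partial l R)) x)"
    by (rule laplacian_first_order) (rule that)
  note sl = smooth_on_laplacian[OF D]
  let ?f = "\<lambda>x. (- 1 / 2) * \<Psi> x + (- 1) * a0 x"
  define \<Theta> where "\<Theta> x = 1 * ?f x + (- 1) * laplacian R x" for x
  have sf: "smooth_on D ?f"
    by (intro smooth_on_add smooth_on_cmult D \<Psi>(1) smooth_a0)
  have s\<Theta>: "smooth_on D \<Theta>"
    unfolding \<Theta>_def[abs_def] by (intro smooth_on_add smooth_on_cmult D \<Psi>(1) smooth_a0 sl smooth_R)
  have solve: "g = 1 * ((- 1 / 2) * p - a - L) + (- 1 / 2) * r"
    if "p + 3 * r + 2 * a + 2 * L - 2 * r + 2 * g = 0" for p r a L g :: complex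
  proof -
    have "2 * (g - (1 * ((- 1 / 2) * p - a - L) + (- 1 / 2) * r)) = p + 3 * r + 2 * a + 2 * L - 2 * r + 2 * g"
      by (simp add: algebra_simps)
    then have "g - (1 * ((- 1 / 2) * p - a - L) + (- 1 / 2) * r) = 0"
      unfolding that by (metis mult_eq_0_iff zero_neq_numeral)
    then show ?thesis
      by (simp only: eq_iff_diff_eq_0[symmetric])
  qed
  have "(\<lambda>x. \<Sum>j\<in>UNIV. partial j R x * second_order k j x) \<doteq>
       (\<lambda>x. 1 * partial k \<Theta> x + (- 1 / 2) * partial k (partial k (partial k R)) x)" for k
  proof (rule eqvI)
    fix x assume x: "x \<in> D"
    have "partial k \<Theta> x = 1 * partial k ?f x + (- 1) * partial k (laplacian R) x"
      unfolding \<Theta>_def[abs_def] by (rule eqvD[OF partial_lincomb_eqv[OF sf sl[OF smooth_R]] x])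
    also have "partial k ?f x = (- 1 / 2) * partial k \<Psi> x + (- 1) * partial k a0 x"
      by (rule eqvD[OF partial_lincomb_eqv[OF \<Psi>(1) smooth_a0] x])
    finally have 1: "partial k \<Theta> x = (- 1 / 2) * partial k \<Psi> x - partial k a0 x - partial k (laplacian R) x"
      by simp
    have 2: "(\<Sum>j\<in>UNIV. partial k (partial j (partial j R)) x) = partial k (laplacian R) x"
      unfolding laplacian_def[abs_def]
      by (rule eqvD[OF partial_sum_eqv x, symmetric]) (intro smooth_on_partial smooth_R)
    show "(\<Sum>j\<in>UNIV. partial j R x * second_order k j x) =
        1 * partial k \<Theta> x + (- 1 / 2) * partial k (partial k (partial k R)) x"
      using third_identity[OF x, of k] unfolding 1 2 eqvD[OF \<Psi>(2) x] by (rule solve)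
  qed
  with s\<Theta> show thesis by (rule that)
qed

text \<open>Passing from \<open>second_order\<close> to \<open>shifted\<close> adds R \<nabla>R,
  which is half the gradient of R^2. The part of \<open>gradient_identity\<close> that is not a
  gradient has vanishing curl by \<open>fourth_order_identity\<close>.\<close>

lemma curl_free:
  assumes x: "x \<in> D"
  shows "partial l (\<lambda>x. \<Sum>j\<in>UNIV. shifted k j x * partial j R x) x = partial k (\<lambda>x. \<Sum>j\<in>UNIV. shifted l j x * partial j R x) x"
proof -
  obtain \<Theta> where \<Theta>: "smooth_on D \<Theta>"
    "\<And>k. (\<lambda>x. \<Sum>j\<in>UNIV. partial j R x * second_order k j x) \<doteq>
       (\<lambda>x. 1 * partial k \<Theta> x + (- 1 / 2) * partial k (partial k (partial k R)) x)"
    by (rule gradient_identity) (rule that)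
  note sp = smooth_on_partial
  note d = smooth_on_differentiable[OF _ D x]
  have *: "partial l (\<lambda>x. \<Sum>j\<in>UNIV. shifted k j x * partial j R x) x =
      (partial l (partial k \<Theta>) x + (- 1 / 2) * partial l (partial k (partial k (partial k R))) x)
      + (partial l R x * partial k R x + R x * partial l (partial k R) x)" for k l
  proof -
    let ?f = "\<lambda>x. 1 * partial k \<Theta> x + (- 1 / 2) * partial k (partial k (partial k R)) x"
    have sf: "smooth_on D ?f"
      by (intro smooth_on_add smooth_on_cmult sp D \<Theta>(1) smooth_R)
    have "partial l (\<lambda>x. \<Sum>j\<in>UNIV. shifted k j x * partial j R x) x = partial l (\<lambda>x. ?f x + R x * partial k R x) x"
    proof (rule partial_cong[OF D x])
      fix y assume y: "y \<in> D"
      have "(\<Sum>j\<in>UNIV. shifted k j y * partial j R y) =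
          (\<Sum>j\<in>UNIV. partial j R y * second_order k j y) + (\<Sum>j\<in>UNIV. partial j R y * (if k = j then R y else 0))"
        by (simp only: shifted_def mult.commute[of _ "partial _ R y"] distrib_left sum.distrib)
      then show "(\<Sum>j\<in>UNIV. shifted k j y * partial j R y) = ?f y + R y * partial k R y"
        unfolding eqvD[OF \<Theta>(2) y] sum_mult_delta by (simp add: mult.commute)
    qed
    also have "\<dots> = partial l ?f x + (partial l R x * partial k R x + R x * partial l (partial k R) x)"
      unfolding partial_mult[OF d[OF smooth_R] d[OF sp[OF smooth_R]], symmetric]
      by (rule partial_add[OF d[OF sf] differentiable_mult[OF d[OF smooth_R] d[OF sp[OF smooth_R]]]])
    also have "partial l ?f x = 1 * partial l (partial k \<Theta>) x + (- 1 / 2) * partial l (partial k (partial k (partial k R))) x"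
      by (rule eqvD[OF partial_lincomb_eqv[OF sp[OF \<Theta>(1)] sp[OF sp[OF sp[OF smooth_R]]]] x])
    finally show ?thesis by simp
  qed
  show ?thesis
    unfolding * partial_commute[OF D \<Theta>(1) x, of l k] partial_commute[OF D smooth_R x, of l k]
      eqvD[OF fourth_order_identity x, of l k] by simp
qed

text \<open>M as a bilinear form, so that the identities can be read in directions adapted to a
  root.\<close>

definition shifted_form :: "real ^ 'n::_ \<Rightarrow> real ^ 'n::_ \<Rightarrow> real ^ 'n::_ \<Rightarrow> complex" where
  "shifted_form u v x = (\<Sum>i\<in>UNIV. of_real (u $ i) * (\<Sum>j\<in>UNIV. of_real (v $ j) * shifted i j x))"

lemma smooth_shifted_form: "smooth_on D (shifted_form u v)"
  unfolding shifted_form_def[abs_def]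
  by (intro smooth_on_sum smooth_on_cmult D smooth_shifted)

lemma shifted_form_sym: "shifted_form u v = shifted_form v u"
proof (rule ext)
  fix x
  show "shifted_form u v x = shifted_form v u x"
    unfolding shifted_form_def sum_distrib_left
    by (subst sum.swap) (simp add: shifted_sym mult.left_commute)
qed

lemma shifted_form_axis: "shifted_form u v x = (\<Sum>k\<in>UNIV. of_real (v $ k) * shifted_form u (axis k 1) x)"
  unfolding shifted_form_def axis_sum sum_distrib_left
  by (subst sum.swap) (simp add: mult.left_commute)

lemma dird_shifted_form:
  assumes x: "x \<in> D"
  shows "dird w (shifted_form u v) x =
    (\<Sum>k\<in>UNIV. of_real (w $ k) * (\<Sum>i\<in>UNIV. of_real (u $ i) * (\<Sum>j\<in>UNIV. of_real (v $ j) * partial k (shifted i j) x)))"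
proof -
  have d: "shifted i j differentiable (at x)" for i j
    by (rule smooth_on_differentiable[OF smooth_shifted D x])
  then have d1: "(\<lambda>x. of_real (v $ j) * shifted i j x) differentiable (at x)" for i j
    by (intro differentiable_mult differentiable_const)
  then have d2: "(\<lambda>x. \<Sum>j\<in>UNIV. of_real (v $ j) * shifted i j x) differentiable (at x)" for i
    by (intro differentiable_sum) auto
  then have d3: "(\<lambda>x. of_real (u $ i) * (\<Sum>j\<in>UNIV. of_real (v $ j) * shifted i j x)) differentiable (at x)" for i
    by (intro differentiable_mult differentiable_const)
  show ?thesis
    unfolding dird_def shifted_form_def[abs_def] partial_sum[OF d3] partial_cmult[OF d2] partial_sum[OF d1] partial_cmult[OF d] ..
qed

text \<open>The diagonal term of \<open>shifted_identity\<close> is not invariant under rotations,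
  so in general directions it becomes the coordinatewise product of the three vectors, applied to
  the gradient of R.\<close>

lemma shifted_form_identity:
  assumes x: "x \<in> D"
  shows "dird u (shifted_form v w) x + dird v (shifted_form w u) x + dird w (shifted_form u v) x
    = 3 * (\<Sum>k\<in>UNIV. of_real (u $ k * v $ k * w $ k) * partial k R x)"
proof -
  let ?c = "\<lambda>v i. complex_of_real (v $ i)"
  have 1: "dird u (shifted_form v w) x = (\<Sum>k\<in>UNIV. \<Sum>i\<in>UNIV. \<Sum>j\<in>UNIV. ?c u k * ?c v i * ?c w j * partial k (shifted i j) x)"
    unfolding dird_shifted_form[OF x] sum_distrib_left by (simp add: mult.assoc)
  have 2: "dird v (shifted_form w u) x = (\<Sum>k\<in>UNIV. \<Sum>i\<in>UNIV. \<Sum>j\<in>UNIV. ?c u k * ?c v i * ?c w j * partial i (shifted j k) x)"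
    unfolding dird_shifted_form[OF x] sum_distrib_left
    by (rule trans[OF sum.cong[OF refl sum.swap] trans[OF sum.swap]]) (simp add: mult_ac)
  have 3: "dird w (shifted_form u v) x = (\<Sum>k\<in>UNIV. \<Sum>i\<in>UNIV. \<Sum>j\<in>UNIV. ?c u k * ?c v i * ?c w j * partial j (shifted k i) x)"
    unfolding dird_shifted_form[OF x] sum_distrib_left
    by (rule trans[OF sum.swap], rule sum.cong[OF refl], rule trans[OF sum.swap]) (simp add: mult_ac)
  have "dird u (shifted_form v w) x + dird v (shifted_form w u) x + dird w (shifted_form u v) x =
      (\<Sum>k\<in>UNIV. \<Sum>i\<in>UNIV. \<Sum>j\<in>UNIV. ?c u k * ?c v i * ?c w j * (if k = i \<and> i = j then 3 * partial k R x else 0))"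
    unfolding 1 2 3 sum.distrib[symmetric] distrib_left[symmetric] shifted_identity[OF x] ..
  also have "\<dots> = (\<Sum>k\<in>UNIV. \<Sum>i\<in>UNIV. \<Sum>j\<in>UNIV. if i = j then (if k = i then ?c u k * ?c v k * ?c w k * (3 * partial k R x) else 0) else 0)"
    by (intro sum.cong refl) auto
  also have "\<dots> = 3 * (\<Sum>k\<in>UNIV. of_real (u $ k * v $ k * w $ k) * partial k R x)"
    by (simp add: sum_distrib_left mult_ac)
  finally show ?thesis .
qed

lemma shifted_form_curl_free:
  assumes x: "x \<in> D"
  shows "dird v (\<lambda>x. \<Sum>k\<in>UNIV. shifted_form u (axis k 1) x * partial k R x) x
    = dird u (\<lambda>x. \<Sum>k\<in>UNIV. shifted_form v (axis k 1) x * partial k R x) x"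
proof -
  define G where "G i x = (\<Sum>k\<in>UNIV. shifted i k x * partial k R x)" for i x
  have dG: "G i differentiable (at x)" for i
    unfolding G_def[abs_def]
    by (intro differentiable_sum ballI differentiable_mult smooth_on_differentiable[OF smooth_shifted D x]
        smooth_on_differentiable[OF smooth_on_partial[OF smooth_R] D x]) simp
  have "(\<Sum>k\<in>UNIV. shifted_form u (axis k 1) y * partial k R y) = (\<Sum>i\<in>UNIV. of_real (u $ i) * G i y)" for u y
    unfolding shifted_form_def axis_sum G_def sum_distrib_left sum_distrib_right
    by (subst sum.swap) (simp add: mult.assoc)
  moreover have "dird v (\<lambda>x. \<Sum>i\<in>UNIV. of_real (u $ i) * G i x) x =
     (\<Sum>i\<in>UNIV. of_real (u $ i) * (\<Sum>l\<in>UNIV. of_real (v $ l) * partial l (G i) x))" for u v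
    using dG by (simp add: dird_sum dird_cmult differentiable_mult) (simp add: dird_def)
  moreover have "partial l (G k) x = partial k (G l) x" for k l
    unfolding G_def[abs_def] by (rule curl_free[OF x])
  ultimately show ?thesis
    unfolding sum_distrib_left by (simp add: mult.left_commute) (subst sum.swap, simp)
qed

end

section \<open>Behaviour near a generic point of a singular hyperplane\<close>

lemma smooth_on_subset:
  assumes "smooth_on S f" "T \<subseteq> S"
  shows "smooth_on T f"
  using assms unfolding smooth_on_def by (blast intro: differentiable_on_subset)

lemma dird_inverse_power:
  assumes "\<gamma> \<bullet> x \<noteq> 0"
  shows "(\<lambda>x. inverse (complex_of_real (\<gamma> \<bullet> x)) ^ n) differentiable (at x)"
    and "dird u (\<lambda>x. inverse (complex_of_real (\<gamma> \<bullet> x)) ^ n) x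
      = - of_nat n * of_real (\<gamma> \<bullet> u) * inverse (of_real (\<gamma> \<bullet> x)) ^ Suc n"
proof -
  let ?D = "- of_nat n * inverse (complex_of_real (\<gamma> \<bullet> x)) ^ Suc n"
  have "complex_of_real (\<gamma> \<bullet> x) \<noteq> 0"
    using assms by simp
  from DERIV_power[OF DERIV_inverse[OF this], of n]
  have "((\<lambda>z. inverse z ^ n) has_field_derivative ?D) (at (complex_of_real (\<gamma> \<bullet> x)))"
    by (rule DERIV_cong) (cases n; simp add: algebra_simps)
  then have 1: "((\<lambda>z. inverse z ^ n) has_derivative (\<lambda>h. ?D * h)) (at (complex_of_real (\<gamma> \<bullet> x)))"
    unfolding has_field_derivative_def .
  have 2: "((\<lambda>x. complex_of_real (\<gamma> \<bullet> x)) has_derivative (\<lambda>h. of_real (\<gamma> \<bullet> h))) (at x)"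
    by (auto intro!: derivative_eq_intros)
  have *: "((\<lambda>x. inverse (complex_of_real (\<gamma> \<bullet> x)) ^ n) has_derivative (\<lambda>h. ?D * of_real (\<gamma> \<bullet> h))) (at x)"
    by (rule has_derivative_compose[OF 2 1])
  then show d: "(\<lambda>x. inverse (complex_of_real (\<gamma> \<bullet> x)) ^ n) differentiable (at x)"
    by (rule differentiableI)
  have "complex_of_real (\<gamma> \<bullet> u) = (\<Sum>i\<in>UNIV. of_real (u $ i) * of_real (\<gamma> $ i))"
    by (simp add: inner_vec_def mult.commute)
  then show "dird u (\<lambda>x. inverse (complex_of_real (\<gamma> \<bullet> x)) ^ n) x
      = - of_nat n * of_real (\<gamma> \<bullet> u) * inverse (of_real (\<gamma> \<bullet> x)) ^ Suc n"
    unfolding dird_def partial_eqI[OF *] by (simp add: inner_axis sum_distrib_left sum_distrib_right mult_ac)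
qed

lemma smooth_on_inverse_power:
  assumes "open S" "\<And>x. x \<in> S \<Longrightarrow> \<gamma> \<bullet> x \<noteq> 0"
  shows "smooth_on S (\<lambda>x. inverse (complex_of_real (\<gamma> \<bullet> x)) ^ n)"
proof (rule smooth_on_coinduct[OF assms(1),
      where K = "\<lambda>g. \<exists>c n. g = (\<lambda>x. c * inverse (complex_of_real (\<gamma> \<bullet> x)) ^ n)"])
  show "\<exists>c m. (\<lambda>x. inverse (complex_of_real (\<gamma> \<bullet> x)) ^ n) = (\<lambda>x. c * inverse (complex_of_real (\<gamma> \<bullet> x)) ^ m)"
    by (intro exI[of _ 1] exI[of _ n]) simp
  fix g :: "real ^ 'a::finite \<Rightarrow> complex" and i
  assume "\<exists>c n. g = (\<lambda>x. c * inverse (complex_of_real (\<gamma> \<bullet> x)) ^ n)"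
  then obtain c n where g: "g = (\<lambda>x. c * inverse (complex_of_real (\<gamma> \<bullet> x)) ^ n)" by blast
  show "g differentiable_on S"
    unfolding g differentiable_on_eq_differentiable_at[OF assms(1)]
    by (intro ballI differentiable_mult differentiable_const dird_inverse_power(1) assms(2))
  have "\<forall>x\<in>S. partial i g x = (- c * of_nat n * of_real (\<gamma> \<bullet> axis i 1)) * inverse (complex_of_real (\<gamma> \<bullet> x)) ^ Suc n"
  proof
    fix x assume "x \<in> S"
    note d = dird_inverse_power[OF assms(2)[OF this], where n = n]
    show "partial i g x = (- c * of_nat n * of_real (\<gamma> \<bullet> axis i 1)) * inverse (complex_of_real (\<gamma> \<bullet> x)) ^ Suc n"
      unfolding g partial_cmult[OF d(1)] using d(2)[of "axis i 1"] by simp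
  qed
  then show "\<exists>h. (\<exists>c n. h = (\<lambda>x. c * inverse (complex_of_real (\<gamma> \<bullet> x)) ^ n)) \<and> (\<forall>x\<in>S. partial i g x = h x)"
    by blast
qed

lemma dird_lincomb:
  assumes "f differentiable (at x)" "g differentiable (at x)"
  shows "dird u (\<lambda>x. c * f x + d * g x) x = c * dird u f x + d * dird u g x"
  using assms by (simp add: dird_add dird_cmult differentiable_mult)

section \<open>Growth rates along a line ending at a wall\<close>

text \<open>This is f = O(t^(-n)) with a bound valid on the whole interval up to T, so that sums,
  products and integrals need no shrinking of the interval.\<close>

definition growth :: "real \<Rightarrow> nat \<Rightarrow> (real \<Rightarrow> complex) \<Rightarrow> bool" where
  "growth T n f \<longleftrightarrow> (\<exists>K. \<forall>t. 0 < t \<and> t \<le> T \<longrightarrow> norm (f t) * t ^ n \<le> K)"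

lemma growthI: "(\<And>t. 0 < t \<Longrightarrow> t \<le> T \<Longrightarrow> norm (f t) * t ^ n \<le> K) \<Longrightarrow> growth T n f"
  unfolding growth_def by blast

lemma growthE:
  assumes "growth T n f"
  obtains K where "K \<ge> 0" "\<And>t. 0 < t \<Longrightarrow> t \<le> T \<Longrightarrow> norm (f t) * t ^ n \<le> K"
proof -
  obtain K where K: "\<forall>t. 0 < t \<and> t \<le> T \<longrightarrow> norm (f t) * t ^ n \<le> K"
    using assms unfolding growth_def by blast
  show thesis
  proof (rule that[of "max K 0"])
    show "norm (f t) * t ^ n \<le> max K 0" if "0 < t" "t \<le> T" for t
      using K that by (meson max.coboundedI1)
  qed simp
qed

lemma growth_cong:
  assumes "growth T n f" "\<And>t. 0 < t \<Longrightarrow> t \<le> T \<Longrightarrow> g t = f t"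
  shows "growth T n g"
  using assms(1) unfolding growth_def by (metis assms(2))

lemma growth_add:
  assumes "growth T n f" "growth T n g"
  shows "growth T n (\<lambda>t. f t + g t)"
proof -
  obtain K where K: "\<And>t. 0 < t \<Longrightarrow> t \<le> T \<Longrightarrow> norm (f t) * t ^ n \<le> K"
    using assms(1) by (rule growthE) (rule that)
  obtain L where L: "\<And>t. 0 < t \<Longrightarrow> t \<le> T \<Longrightarrow> norm (g t) * t ^ n \<le> L"
    using assms(2) by (rule growthE) (rule that)
  show ?thesis
  proof (rule growthI)
    fix t :: real assume t: "0 < t" "t \<le> T"
    have "norm (f t + g t) * t ^ n \<le> (norm (f t) + norm (g t)) * t ^ n"
      using t by (intro mult_right_mono norm_triangle_ineq) auto
    also have "\<dots> \<le> K + L"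
      using K[OF t] L[OF t] by (simp add: distrib_right)
    finally show "norm (f t + g t) * t ^ n \<le> K + L" .
  qed
qed

lemma growth_mult:
  assumes "growth T m f" "growth T n g"
  shows "growth T (m + n) (\<lambda>t. f t * g t)"
proof -
  obtain K where K: "K \<ge> 0" "\<And>t. 0 < t \<Longrightarrow> t \<le> T \<Longrightarrow> norm (f t) * t ^ m \<le> K"
    using assms(1) by (rule growthE) (rule that)
  obtain L where L: "\<And>t. 0 < t \<Longrightarrow> t \<le> T \<Longrightarrow> norm (g t) * t ^ n \<le> L"
    using assms(2) by (rule growthE) (rule that)
  show ?thesis
  proof (rule growthI)
    fix t :: real assume t: "0 < t" "t \<le> T"
    have "norm (f t * g t) * t ^ (m + n) = (norm (f t) * t ^ m) * (norm (g t) * t ^ n)"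
      by (simp add: norm_mult power_add)
    also have "\<dots> \<le> K * L"
      using t K L by (intro mult_mono) auto
    finally show "norm (f t * g t) * t ^ (m + n) \<le> K * L" .
  qed
qed

lemma growth_const: "growth T 0 (\<lambda>t. c)"
  by (rule growthI[where K = "norm c"]) simp

lemma growth_cmult: "growth T n f \<Longrightarrow> growth T n (\<lambda>t. c * f t)"
  using growth_mult[OF growth_const] by simp

lemma growth_diff: "growth T n f \<Longrightarrow> growth T n g \<Longrightarrow> growth T n (\<lambda>t. f t - g t)"
  using growth_add[OF _ growth_cmult[of T n g "- 1"], of f] by simp

lemma growth_mono:
  assumes "growth T 0 f" "growth T n g"
  shows "growth T n (\<lambda>t. f t * g t)"
  using growth_mult[OF assms] by simp

lemma growth_le:
  assumes "growth T 0 f"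
  shows "growth T n f"
proof -
  have "growth T n (\<lambda>t. 1)"
    by (rule growthI[where K = "T ^ n"]) (simp add: power_mono)
  from growth_mono[OF assms this] show ?thesis by simp
qed

lemma growth_zero: "growth T n (\<lambda>t. 0)"
  using growth_le[OF growth_const] .

lemma growth_sum:
  assumes "finite K" "\<And>k. k \<in> K \<Longrightarrow> growth T n (f k)"
  shows "growth T n (\<lambda>t. \<Sum>k\<in>K. f k t)"
  using assms
proof (induction K rule: finite_induct)
  case empty
  show ?case by (simp add: growth_zero)
next
  case (insert k K)
  have "growth T n (\<lambda>t. f k t + (\<Sum>k\<in>K. f k t))"
    by (intro growth_add insert.IH insert.prems) auto
  then show ?case using insert.hyps by simp
qed

lemma growth_continuous:
  assumes "continuous_on {0..T} f"
  shows "growth T 0 f"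
proof -
  have "bounded (f ` {0..T})"
    by (intro compact_imp_bounded compact_continuous_image assms compact_Icc)
  then obtain K where "\<forall>x\<in>f ` {0..T}. norm x \<le> K"
    unfolding bounded_iff by blast
  then show ?thesis
    by (intro growthI[where K = K]) auto
qed

text \<open>On [t, T] the derivative is at most K / t^n, so f differs from its value at T by at most
  T K / t^n. The crude estimate gains no power of t, which is sufficient against a pole of order n +
  1.\<close>

lemma growth_integrate:
  assumes "0 < T" "\<And>t. 0 < t \<Longrightarrow> t \<le> T \<Longrightarrow> (f has_vector_derivative f' t) (at t)" "growth T n f'"
  shows "growth T n f"
proof -
  obtain K where K: "K \<ge> 0" "\<And>t. 0 < t \<Longrightarrow> t \<le> T \<Longrightarrow> norm (f' t) * t ^ n \<le> K"
    using assms(3) by (rule growthE) (rule that)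
  show ?thesis
  proof (rule growthI)
    fix t :: real assume t: "0 < t" "t \<le> T"
    have "norm (f t - f T) \<le> K / t ^ n * norm (t - T)"
    proof (rule differentiable_bound[where S = "{t..T}" and f' = "\<lambda>s h. h *\<^sub>R f' s"])
      fix s assume s: "s \<in> {t..T}"
      show "(f has_derivative (\<lambda>h. h *\<^sub>R f' s)) (at s within {t..T})"
        using assms(2)[of s] s t unfolding has_vector_derivative_def
        by (auto intro: has_derivative_at_withinI)
      have "norm (f' s) * t ^ n \<le> norm (f' s) * s ^ n"
        using s t by (intro mult_left_mono power_mono) auto
      also have "\<dots> \<le> K"
        using s t by (intro K) auto
      finally have "norm (f' s) \<le> K / t ^ n"
        using t by (simp add: field_simps)
      then show "onorm (\<lambda>h. h *\<^sub>R f' s) \<le> K / t ^ n"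
        by (simp add: onorm_scaleR_left onorm_id)
    qed (use t in auto)
    also have "\<dots> \<le> K / t ^ n * T"
      using t K by (intro mult_left_mono) auto
    finally have "norm (f t) \<le> norm (f T) + K / t ^ n * T"
      using norm_triangle_sub[of "f t" "f T"] by linarith
    then have "norm (f t) * t ^ n \<le> (norm (f T) + K / t ^ n * T) * t ^ n"
      using t by (intro mult_right_mono) auto
    also have "\<dots> = norm (f T) * t ^ n + K * T"
      using t by (simp add: field_simps)
    also have "\<dots> \<le> norm (f T) * T ^ n + K * T"
      using t by (intro add_right_mono mult_left_mono power_mono) auto
    finally show "norm (f t) * t ^ n \<le> norm (f T) * T ^ n + K * T" .
  qed
qed

section \<open>Local analysis at one wall\<close>

text \<open>V is a half ball on one side of the wall of \<alpha>, and B plays the role of M. The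
  remainder S is smooth across the wall, whereas nothing is assumed about B at the wall itself. The
  cube conditions say that the entries of \<alpha> and \<beta> are 0, 1 or -1; the conditions with
  \<kappa> turn coordinatewise products in \<open>B_identity\<close> into multiples of \<alpha> and
  \<beta>.\<close>

locale wall_model =
  fixes p \<alpha> \<beta> :: "real ^ 'n::finite" and \<delta> \<kappa> :: real and C :: complex
    and R S :: "real ^ 'n \<Rightarrow> complex" and B :: "real ^ 'n \<Rightarrow> real ^ 'n \<Rightarrow> real ^ 'n \<Rightarrow> complex"
    and V :: "(real ^ 'n) set"
  assumes \<delta>: "0 < \<delta>" and C: "C \<noteq> 0" and \<alpha>: "\<alpha> \<noteq> 0"
    and p: "\<alpha> \<bullet> p = 0" and orth: "\<alpha> \<bullet> \<beta> = 0"
    and cube: "\<And>k. (\<alpha> $ k) ^ 3 = \<alpha> $ k" "\<And>k. (\<beta> $ k) ^ 3 = \<beta> $ k"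
    and mixed: "\<And>k. (\<alpha> $ k)\<^sup>2 * \<beta> $ k = \<kappa> * \<beta> $ k" "\<And>k. (\<beta> $ k)\<^sup>2 * \<alpha> $ k = \<kappa> * \<alpha> $ k"
    and \<kappa>: "3 * \<kappa> \<noteq> 1"
    and V_def: "V = {x \<in> ball p \<delta>. 0 < \<alpha> \<bullet> x}"
    and smooth_S: "smooth_on (ball p \<delta>) S"
    and R: "\<And>x. x \<in> V \<Longrightarrow> R x = C * inverse (of_real (\<alpha> \<bullet> x)) ^ 2 + S x"
    and smooth_R: "smooth_on V R"
    and smooth_B: "\<And>u v. smooth_on V (B u v)"
    and B_sym: "\<And>u v. B u v = B v u"
    and B_axis: "\<And>u v x. B u v x = (\<Sum>k\<in>UNIV. of_real (v $ k) * B u (axis k 1) x)"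
    and B_identity: "\<And>u v w x. x \<in> V \<Longrightarrow> dird u (B v w) x + dird v (B w u) x + dird w (B u v) x
        = 3 * (\<Sum>k\<in>UNIV. of_real (u $ k * v $ k * w $ k) * partial k R x)"
    and B_curl_free: "\<And>u v x. x \<in> V \<Longrightarrow> dird v (\<lambda>x. \<Sum>k\<in>UNIV. B u (axis k 1) x * partial k R x) x
        = dird u (\<lambda>x. \<Sum>k\<in>UNIV. B v (axis k 1) x * partial k R x) x"
begin

definition \<rho> :: "real ^ 'n \<Rightarrow> complex" where
  "\<rho> x = inverse (of_real (\<alpha> \<bullet> x))"

lemma open_V: "open V"
proof -
  have "V = ball p \<delta> \<inter> {x. \<alpha> \<bullet> x > 0}"
    by (auto simp: V_def)
  then show ?thesis
    by (simp add: open_Int open_halfspace_gt)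
qed

lemma V_subset: "V \<subseteq> ball p \<delta>"
  by (auto simp: V_def)

lemma in_V: "x \<in> V \<Longrightarrow> \<alpha> \<bullet> x \<noteq> 0"
  by (auto simp: V_def)

lemmas smS = smooth_on_subset[OF smooth_S V_subset]

lemmas dV = smooth_on_differentiable[OF _ open_V]

lemmas smd = smooth_on_dird[OF open_V]

lemma dird_\<rho>:
  assumes "x \<in> V"
  shows "(\<lambda>x. \<rho> x ^ n) differentiable (at x)"
    and "dird u (\<lambda>x. \<rho> x ^ n) x = - of_nat n * of_real (\<alpha> \<bullet> u) * \<rho> x ^ Suc n"
  unfolding \<rho>_def using dird_inverse_power[OF in_V[OF assms]] by auto

lemma dird_R:
  assumes "x \<in> V"
  shows "dird u R x = (- 2 * C * of_real (\<alpha> \<bullet> u)) * \<rho> x ^ 3 + dird u S x"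
proof -
  have "dird u R x = dird u (\<lambda>x. C * \<rho> x ^ 2 + S x) x"
    by (rule dird_cong[OF open_V assms]) (simp add: R \<rho>_def)
  also have "\<dots> = dird u (\<lambda>x. C * \<rho> x ^ 2) x + dird u S x"
    by (intro dird_add differentiable_mult differentiable_const dird_\<rho>(1) assms dV[OF smS])
  also have "dird u (\<lambda>x. C * \<rho> x ^ 2) x = C * dird u (\<lambda>x. \<rho> x ^ 2) x"
    by (rule dird_cmult[OF dird_\<rho>(1)[OF assms]])
  finally show ?thesis
    unfolding dird_\<rho>(2)[OF assms] by (simp add: eval_nat_numeral)
qed

lemma dird_\<beta>_R: "x \<in> V \<Longrightarrow> dird \<beta> R x = dird \<beta> S x"
  by (simp add: dird_R orth)

lemma dird_dird_\<beta>_R: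
  assumes "x \<in> V"
  shows "dird u (dird \<beta> R) x = dird u (dird \<beta> S) x"
  by (rule dird_cong[OF open_V assms]) (rule dird_\<beta>_R)

lemma cubic_sum:
  assumes "\<And>k. u $ k * v $ k * w $ k = c * z $ k"
  shows "(\<Sum>k\<in>UNIV. of_real (u $ k * v $ k * w $ k) * partial k R x) = of_real c * dird z R x"
  unfolding assms dird_def by (simp add: sum_distrib_left mult.assoc)

lemma B_\<alpha>\<alpha>: "x \<in> V \<Longrightarrow> dird \<alpha> (B \<alpha> \<alpha>) x = dird \<alpha> R x"
  using B_identity[of x \<alpha> \<alpha> \<alpha>] cubic_sum[of \<alpha> \<alpha> \<alpha> 1 \<alpha> x] cube(1) by (simp add: power3_eq_cube)

lemma B_\<beta>\<beta>: "x \<in> V \<Longrightarrow> dird \<beta> (B \<beta> \<beta>) x = dird \<beta> S x"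
  using B_identity[of x \<beta> \<beta> \<beta>] cubic_sum[of \<beta> \<beta> \<beta> 1 \<beta> x] cube(2) dird_\<beta>_R[of x] by (simp add: power3_eq_cube)

text \<open>The singular part of M(\<alpha>, \<alpha>) is that of R: by
  \<open>B_\<alpha>\<alpha>\<close> the difference is constant along \<alpha>, so it and its
  derivatives stay bounded on lines normal to the wall.\<close>

definition \<phi> :: "real ^ 'n \<Rightarrow> complex" where
  "\<phi> x = B \<alpha> \<alpha> x - R x"

lemma smooth_\<phi>: "smooth_on V \<phi>"
  unfolding \<phi>_def[abs_def] by (intro smooth_on_diff open_V smooth_B smooth_R)

lemma dird_\<phi>:
  assumes "x \<in> V"
  shows "dird u (B \<alpha> \<alpha>) x = dird u \<phi> x + dird u R x"
  unfolding \<phi>_def[abs_def] dird_diff[OF dV[OF smooth_B assms] dV[OF smooth_R assms]] by simp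

lemma dird_zero: "dird u (\<lambda>x. 0) x = 0"
  by (simp add: dird_def)

lemma \<alpha>_\<phi>: "x \<in> V \<Longrightarrow> dird \<alpha> \<phi> x = 0"
  using dird_\<phi>[of x \<alpha>] B_\<alpha>\<alpha>[of x] by simp

lemma \<alpha>_v_\<phi>:
  assumes "x \<in> V"
  shows "dird \<alpha> (dird v \<phi>) x = 0"
proof -
  have "dird v (dird \<alpha> \<phi>) x = dird v (\<lambda>x. 0) x"
    by (rule dird_cong[OF open_V assms]) (rule \<alpha>_\<phi>)
  then show ?thesis
    using dird_commute[OF open_V smooth_\<phi> assms, of \<alpha> v] by (simp add: dird_zero)
qed

lemma \<alpha>_w_v_\<phi>:
  assumes "x \<in> V"
  shows "dird \<alpha> (dird w (dird v \<phi>)) x = 0"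
proof -
  have "dird w (dird \<alpha> (dird v \<phi>)) x = dird w (\<lambda>x. 0) x"
    by (rule dird_cong[OF open_V assms]) (rule \<alpha>_v_\<phi>)
  then show ?thesis
    using dird_commute[OF open_V smd[OF smooth_\<phi>] assms, of \<alpha> w] by (simp add: dird_zero)
qed

lemma \<alpha>_B_\<alpha>:
  assumes "x \<in> V"
  shows "2 * dird \<alpha> (B \<alpha> v) x = 3 * (\<Sum>k\<in>UNIV. of_real (\<alpha> $ k * \<alpha> $ k * v $ k) * partial k R x) - dird v \<phi> x - dird v R x"
  using B_identity[OF assms, of \<alpha> \<alpha> v] dird_\<phi>[OF assms, of v] B_sym[of v \<alpha>] by (simp add: algebra_simps)

text \<open>Since \<alpha> and \<beta> are orthogonal, differentiation along \<beta> does not see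
  the pole of R. The normal derivative of \<open>B \<alpha> \<beta>\<close> is therefore free of
  singular terms.\<close>

lemma \<alpha>_B_\<alpha>_\<beta>:
  assumes "x \<in> V"
  shows "dird \<alpha> (B \<alpha> \<beta>) x = of_real ((3 * \<kappa> - 1) / 2) * dird \<beta> S x + (- 1 / 2) * dird \<beta> \<phi> x"
proof -
  have "\<alpha> $ k * \<alpha> $ k * \<beta> $ k = \<kappa> * \<beta> $ k" for k
    using mixed(1)[of k] by (simp add: power2_eq_square)
  note c = cubic_sum[of \<alpha> \<alpha> \<beta> \<kappa> \<beta> x, OF this]
  have "2 * dird \<alpha> (B \<alpha> \<beta>) x = 3 * (of_real \<kappa> * dird \<beta> S x) - dird \<beta> \<phi> x - dird \<beta> S x"
    using \<alpha>_B_\<alpha>[OF assms, of \<beta>] unfolding c dird_\<beta>_R[OF assms] .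
  also have "\<dots> = 2 * (of_real ((3 * \<kappa> - 1) / 2) * dird \<beta> S x + (- 1 / 2) * dird \<beta> \<phi> x)"
    by (simp add: algebra_simps)
  finally show ?thesis
    unfolding mult_cancel_left by simp
qed

text \<open>The identity for \<alpha>, \<beta>, \<beta> still contains normal derivatives of R and
  of \<open>B \<beta> \<beta>\<close>. One more derivative along \<beta> reduces both to S, by
  orthogonality and by \<open>B_\<beta>\<beta>\<close>. The direction \<beta> is tangent to the
  wall, so values of \<open>B \<alpha> \<beta>\<close> at the wall control the left-hand
  side.\<close>

lemma \<beta>_\<beta>_B_\<alpha>_\<beta>:
  assumes "x \<in> V"
  shows "2 * dird \<beta> (dird \<beta> (B \<alpha> \<beta>)) x = of_real (3 * \<kappa> - 1) * dird \<alpha> (dird \<beta> S) x"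
proof -
  have m: "\<alpha> $ k * \<beta> $ k * \<beta> $ k = \<kappa> * \<alpha> $ k" for k
    using mixed(2)[of k] by (simp add: power2_eq_square mult_ac)
  have 1: "dird \<beta> (B \<alpha> \<beta>) y = of_real (3 * \<kappa> / 2) * dird \<alpha> R y + (- 1 / 2) * dird \<alpha> (B \<beta> \<beta>) y" if "y \<in> V" for y
  proof -
    have "dird \<alpha> (B \<beta> \<beta>) y + dird \<beta> (B \<alpha> \<beta>) y + dird \<beta> (B \<alpha> \<beta>) y = 3 * (of_real \<kappa> * dird \<alpha> R y)"
      using B_identity[OF that, of \<alpha> \<beta> \<beta>] unfolding cubic_sum[of \<alpha> \<beta> \<beta> \<kappa> \<alpha> y, OF m] B_sym[of \<beta> \<alpha>] .
    then have "2 * dird \<beta> (B \<alpha> \<beta>) y = 3 * (of_real \<kappa> * dird \<alpha> R y) - dird \<alpha> (B \<beta> \<beta>) y"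
      by (simp add: eq_diff_eq add_ac)
    also have "\<dots> = 2 * (of_real (3 * \<kappa> / 2) * dird \<alpha> R y + (- 1 / 2) * dird \<alpha> (B \<beta> \<beta>) y)"
      by (simp add: algebra_simps)
    finally show ?thesis
      unfolding mult_cancel_left by simp
  qed
  have "dird \<beta> (dird \<beta> (B \<alpha> \<beta>)) x = dird \<beta> (\<lambda>y. of_real (3 * \<kappa> / 2) * dird \<alpha> R y + (- 1 / 2) * dird \<alpha> (B \<beta> \<beta>) y) x"
    by (rule dird_cong[OF open_V assms]) (rule 1)
  also have "\<dots> = of_real (3 * \<kappa> / 2) * dird \<beta> (dird \<alpha> R) x + (- 1 / 2) * dird \<beta> (dird \<alpha> (B \<beta> \<beta>)) x"
    by (rule dird_lincomb[OF dV[OF smd[OF smooth_R] assms] dV[OF smd[OF smooth_B] assms]])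
  also have "dird \<beta> (dird \<alpha> R) x = dird \<alpha> (dird \<beta> S) x"
    using dird_commute[OF open_V smooth_R assms] dird_dird_\<beta>_R[OF assms] by simp
  also have "dird \<beta> (dird \<alpha> (B \<beta> \<beta>)) x = dird \<alpha> (dird \<beta> S) x"
    using dird_commute[OF open_V smooth_B assms] dird_cong[OF open_V assms B_\<beta>\<beta>] by simp
  finally show ?thesis
    by (simp add: field_simps)
qed

text \<open>The curl identity for \<alpha> and \<beta> with R split into pole and remainder. A
  fourth power of \<rho> arises only when the normal derivative hits the cube of \<rho> in the
  gradient of the pole; on the other side orthogonality removes it.\<close>

lemma curl_equation:
  assumes x: "x \<in> V"
  shows "6 * C * of_real (\<alpha> \<bullet> \<alpha>) * \<rho> x ^ 4 * B \<alpha> \<beta> x =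
    2 * C * (\<rho> x ^ 3 * dird \<alpha> (B \<alpha> \<beta>) x)
    - (\<Sum>k\<in>UNIV. dird \<alpha> (B \<beta> (axis k 1)) x * partial k S x + B \<beta> (axis k 1) x * dird \<alpha> (partial k S) x)
    - 2 * C * (\<rho> x ^ 3 * (dird \<beta> \<phi> x + dird \<beta> S x))
    + (\<Sum>k\<in>UNIV. dird \<beta> (B \<alpha> (axis k 1)) x * partial k S x + B \<alpha> (axis k 1) x * dird \<beta> (partial k S) x)"
proof -
  have G: "(\<Sum>k\<in>UNIV. B u (axis k 1) y * partial k R y) = (- 2 * C) * (\<rho> y ^ 3 * B u \<alpha> y) + (\<Sum>k\<in>UNIV. B u (axis k 1) y * partial k S y)"
    if "y \<in> V" for u y
  proof -
    have pk: "partial k R y = (- 2 * C * of_real (\<alpha> $ k)) * \<rho> y ^ 3 + partial k S y" for k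
      using dird_R[OF that, of "axis k 1"] by (simp add: inner_axis)
    have "(\<Sum>k\<in>UNIV. B u (axis k 1) y * partial k R y) =
        (\<Sum>k\<in>UNIV. (- 2 * C) * (\<rho> y ^ 3 * (of_real (\<alpha> $ k) * B u (axis k 1) y)) + B u (axis k 1) y * partial k S y)"
      unfolding pk by (intro sum.cong refl) (simp add: algebra_simps)
    then show ?thesis
      unfolding sum.distrib sum_distrib_left[symmetric] B_axis[of u \<alpha> y, symmetric] .
  qed
  have dG: "dird v (\<lambda>x. \<Sum>k\<in>UNIV. B u (axis k 1) x * partial k R x) x =
     (- 2 * C) * ((- 3 * of_real (\<alpha> \<bullet> v) * \<rho> x ^ 4) * B u \<alpha> x + \<rho> x ^ 3 * dird v (B u \<alpha>) x)
     + (\<Sum>k\<in>UNIV. dird v (B u (axis k 1)) x * partial k S x + B u (axis k 1) x * dird v (partial k S) x)" for u v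
  proof -
    note dB = dV[OF smooth_B x] and dS = dV[OF smooth_on_partial[OF smS] x]
    have d1: "(\<lambda>x. \<rho> x ^ 3 * B u \<alpha> x) differentiable (at x)"
      by (intro differentiable_mult dird_\<rho>(1) x dB)
    have d2: "(\<lambda>x. B u (axis k 1) x * partial k S x) differentiable (at x)" for k
      by (intro differentiable_mult dB dS)
    have d3: "(\<lambda>x. \<Sum>k\<in>UNIV. B u (axis k 1) x * partial k S x) differentiable (at x)"
      by (intro differentiable_sum ballI d2) simp
    have "dird v (\<lambda>x. \<Sum>k\<in>UNIV. B u (axis k 1) x * partial k R x) x =
        dird v (\<lambda>y. (- 2 * C) * (\<rho> y ^ 3 * B u \<alpha> y) + (\<Sum>k\<in>UNIV. B u (axis k 1) y * partial k S y)) x"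
      by (rule dird_cong[OF open_V x]) (rule G)
    also have "\<dots> = dird v (\<lambda>y. (- 2 * C) * (\<rho> y ^ 3 * B u \<alpha> y)) x + dird v (\<lambda>y. \<Sum>k\<in>UNIV. B u (axis k 1) y * partial k S y) x"
      by (rule dird_add) (intro differentiable_mult differentiable_const d1 d3)+
    also have "dird v (\<lambda>y. (- 2 * C) * (\<rho> y ^ 3 * B u \<alpha> y)) x = (- 2 * C) * (dird v (\<lambda>y. \<rho> y ^ 3) x * B u \<alpha> x + \<rho> x ^ 3 * dird v (B u \<alpha>) x)"
      unfolding dird_cmult[OF d1] dird_mult[OF dird_\<rho>(1)[OF x] dB] ..
    also have "dird v (\<lambda>y. \<Sum>k\<in>UNIV. B u (axis k 1) y * partial k S y) x =
       (\<Sum>k\<in>UNIV. dird v (B u (axis k 1)) x * partial k S x + B u (axis k 1) x * dird v (partial k S) x)"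
      unfolding dird_sum[OF d2] dird_mult[OF dB dS] ..
    finally show ?thesis
      unfolding dird_\<rho>(2)[OF x] by (simp add: eval_nat_numeral)
  qed
  have e: "dird \<beta> (B \<alpha> \<alpha>) x = dird \<beta> \<phi> x + dird \<beta> S x"
    using dird_\<phi>[OF x] dird_\<beta>_R[OF x] by simp
  have solve: "6 * c * a * r4 * b = 2 * c * (r3 * d) - X - 2 * c * (r3 * f) + Y"
    if "(- 2 * c) * ((- 3 * a * r4) * b + r3 * d) + X = (- 2 * c) * (r3 * f) + Y" for c a r4 b r3 d X f Y :: complex
  proof -
    have "6 * c * a * r4 * b = ((- 2 * c) * ((- 3 * a * r4) * b + r3 * d) + X) + 2 * c * (r3 * d) - X"
      by (simp add: algebra_simps)
    then show ?thesis unfolding that by (simp add: algebra_simps)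
  qed
  show ?thesis
    using B_curl_free[OF x, of \<alpha> \<beta>] unfolding dG e orth B_sym[of \<beta> \<alpha>]
    by (intro solve) (simp add: algebra_simps)
qed

lemma continuous_line:
  assumes "smooth_on (ball p \<delta>) F" "\<And>t. 0 \<le> t \<Longrightarrow> t \<le> T \<Longrightarrow> y + t *\<^sub>R \<alpha> \<in> ball p \<delta>"
  shows "growth T 0 (\<lambda>t. F (y + t *\<^sub>R \<alpha>))"
proof (rule growth_continuous)
  have "continuous_on (ball p \<delta>) F"
    by (rule differentiable_imp_continuous_on[OF smooth_on_differentiable_on[OF assms(1)]])
  moreover have "continuous_on {0..T} (\<lambda>t. y + t *\<^sub>R \<alpha>)"
    by (intro continuous_intros)
  moreover have "(\<lambda>t. y + t *\<^sub>R \<alpha>) ` {0..T} \<subseteq> ball p \<delta>"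
    using assms(2) by auto
  ultimately show "continuous_on {0..T} (\<lambda>t. F (y + t *\<^sub>R \<alpha>))"
    by (rule continuous_on_compose2)
qed

text \<open>On the normal line at y every term on the right of \<open>curl_equation\<close> is
  O(t^(-3)), by bounds integrated inward from the fixed end T, whereas the factor of
  \<open>B \<alpha> \<beta>\<close> on the left has size t^(-4). This leaves
  \<open>B \<alpha> \<beta>\<close> = O(t).\<close>

lemma form_tendsto_zero:
  assumes y: "\<alpha> \<bullet> y = 0" "y \<in> ball p \<delta>"
  shows "((\<lambda>t. B \<alpha> \<beta> (y + t *\<^sub>R \<alpha>)) \<longlongrightarrow> 0) (at_right 0)"
proof -
  \<comment> \<open>Both edges of the parallelogram are \<alpha>; taking s = 0 gives a segment
    normal to the wall.\<close>
  obtain T where T: "0 < T" "\<And>s t. 0 \<le> s \<Longrightarrow> s \<le> T \<Longrightarrow> 0 \<le> t \<Longrightarrow> t \<le> T \<Longrightarrow>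
      y + s *\<^sub>R \<alpha> + t *\<^sub>R \<alpha> \<in> ball y (\<delta> - dist p y)"
    by (rule parallelogram_in_ball[of "\<delta> - dist p y"]) (use y in simp, rule that)
  let ?c = "\<lambda>t. y + t *\<^sub>R \<alpha>"
  have ball: "?c t \<in> ball p \<delta>" if "0 \<le> t" "t \<le> T" for t
  proof -
    have "dist y (?c t) < \<delta> - dist p y"
      using T(2)[of 0 t] that \<open>0 < T\<close> by simp
    then show ?thesis
      using dist_triangle[of p "?c t" y] by simp
  qed
  define a where "a = \<alpha> \<bullet> \<alpha>"
  have a: "a > 0" using \<alpha> by (simp add: a_def)
  have inner: "\<alpha> \<bullet> ?c t = t * a" for t
    using y(1) by (simp add: inner_add_right a_def)
  have cV: "?c t \<in> V" if "0 < t" "t \<le> T" for t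
  proof -
    have "?c t \<in> ball p \<delta>" using ball that by simp
    moreover have "0 < \<alpha> \<bullet> ?c t"
      unfolding inner using that a by simp
    ultimately show ?thesis unfolding V_def by blast
  qed
  define gr where "gr n f \<longleftrightarrow> growth T n (\<lambda>t. f (?c t))" for n and f :: "real ^ 'n \<Rightarrow> complex"
  have gr_cong: "gr n f" if "gr n g" "\<And>x. x \<in> V \<Longrightarrow> f x = g x" for n f g
    using that(1) unfolding gr_def by (rule growth_cong) (rule that(2)[OF cV])
  have gr_int: "gr n f" if "smooth_on V f" "gr n (dird \<alpha> f)" for n f
    unfolding gr_def
  proof (rule growth_integrate[OF T(1)])
    show "((\<lambda>t. f (?c t)) has_vector_derivative dird \<alpha> f (?c t)) (at t)" if "0 < t" "t \<le> T" for t
      by (rule dird_line[OF dV[OF \<open>smooth_on V f\<close> cV[OF that]]])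
    show "growth T n (\<lambda>t. dird \<alpha> f (?c t))"
      using that(2) by (simp add: gr_def)
  qed
  have gr_add: "gr n (\<lambda>x. f x + g x)" and gr_diff: "gr n (\<lambda>x. f x - g x)" if "gr n f" "gr n g" for n f g
    using that unfolding gr_def by (auto intro: growth_add growth_diff)
  have gr_cmult: "gr n (\<lambda>x. c * f x)" if "gr n f" for n c f
    using that unfolding gr_def by (rule growth_cmult)
  have gr_mult: "gr n (\<lambda>x. f x * g x)" if "gr n f" "gr 0 g" for n f g
    using that growth_mult[of T n _ 0] unfolding gr_def by simp
  have gr_mult': "gr n (\<lambda>x. f x * g x)" if "gr 0 f" "gr n g" for n f g
    using that growth_mult[of T 0 _ n] unfolding gr_def by simp
  have gr_sum: "gr n (\<lambda>x. \<Sum>k\<in>UNIV. f k x)" if "\<And>k. gr n (f k)" for n and f :: "'n \<Rightarrow> _"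
    using that unfolding gr_def by (intro growth_sum) auto
  have gr_le: "gr n f" if "gr 0 f" for n f
    using that growth_le unfolding gr_def by blast
  have gr_zero: "gr n (\<lambda>x. 0)" for n
    unfolding gr_def by (rule growth_zero)
  have sS: "smooth_on (ball p \<delta>) (dird u S)" "smooth_on (ball p \<delta>) (dird v (dird u S))" for u v
    by (intro smooth_on_dird open_ball smooth_S)+
  have gr_ball: "gr 0 F" if "smooth_on (ball p \<delta>) F" for F
    unfolding gr_def by (rule continuous_line[OF that ball])
  note gr_S = gr_ball[OF sS(1)] gr_ball[OF sS(2)]
  have gr_pS: "gr 0 (partial k S)" "gr 0 (dird v (partial k S))" for v k
    using gr_S(1)[of "axis k 1"] gr_S(2)[of v "axis k 1"] by simp_all
  have \<rho>c: "\<rho> (?c t) = inverse (of_real (t * a))" for t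
    unfolding \<rho>_def inner ..
  have norm_\<rho>: "norm (\<rho> (?c t)) = inverse (t * a)" if "0 < t" for t
    using mult_pos_pos[OF that a] by (simp only: \<rho>c norm_inverse norm_of_real abs_of_pos)
  have gr_\<rho>: "gr 3 (\<lambda>x. \<rho> x ^ 3)"
    unfolding gr_def
  proof (rule growthI)
    fix t :: real assume "0 < t" "t \<le> T"
    then show "norm (\<rho> (?c t) ^ 3) * t ^ 3 \<le> inverse a ^ 3"
      using a by (simp add: norm_power norm_\<rho> power_mult_distrib field_simps)
  qed
  have gr_R: "gr 3 (dird u R)" for u
    by (rule gr_cong[OF gr_add[OF gr_cmult[OF gr_\<rho>] gr_le[OF gr_S(1)]] dird_R])
  have gr_pR: "gr 3 (partial k R)" for k
    using gr_R[of "axis k 1"] by simp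
  have gr_\<phi>1: "gr 0 (dird v \<phi>)" for v
    by (rule gr_int[OF smd[OF smooth_\<phi>]], rule gr_cong[OF gr_zero]) (rule \<alpha>_v_\<phi>)
  have gr_\<phi>2: "gr 0 (dird w (dird v \<phi>))" for v w
    by (rule gr_int[OF smd[OF smd[OF smooth_\<phi>]]], rule gr_cong[OF gr_zero]) (rule \<alpha>_w_v_\<phi>)
  note gr_\<phi> = gr_\<phi>1 gr_\<phi>2
  have half: "z = (1 / 2) * w" if "2 * z = w" for z w :: complex
    using that by auto
  have g1: "gr 3 (B \<alpha> v)" for v
  proof (rule gr_int[OF smooth_B], rule gr_cong)
    show "dird \<alpha> (B \<alpha> v) x = (1 / 2) * (3 * (\<Sum>k\<in>UNIV. of_real (\<alpha> $ k * \<alpha> $ k * v $ k) * partial k R x) - dird v \<phi> x - dird v R x)"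
      if "x \<in> V" for x
      by (rule half[OF \<alpha>_B_\<alpha>[OF that]])
    show "gr 3 (\<lambda>x. (1 / 2) * (3 * (\<Sum>k\<in>UNIV. of_real (\<alpha> $ k * \<alpha> $ k * v $ k) * partial k R x) - dird v \<phi> x - dird v R x))"
      by (intro gr_cmult gr_diff gr_sum gr_pR gr_R gr_le[OF gr_\<phi>(1)])
  qed
  have g2: "gr 0 (dird \<alpha> (B \<alpha> \<beta>))"
    by (rule gr_cong[OF gr_add[OF gr_cmult[OF gr_S(1)] gr_cmult[OF gr_\<phi>(1)]] \<alpha>_B_\<alpha>_\<beta>])
  \<comment> \<open>The derivative along v is moved inside the normal derivative, where
    \<open>\<alpha>_B_\<alpha>_\<beta>\<close> has only bounded terms; integration along the line
    brings it back.\<close>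
  have g3: "gr 0 (dird v (B \<alpha> \<beta>))" for v
  proof (rule gr_int[OF smd[OF smooth_B]], rule gr_cong)
    show "gr 0 (\<lambda>x. of_real ((3 * \<kappa> - 1) / 2) * dird v (dird \<beta> S) x + (- 1 / 2) * dird v (dird \<beta> \<phi>) x)"
      by (intro gr_add gr_cmult gr_S gr_\<phi>)
    fix x assume x: "x \<in> V"
    have "dird \<alpha> (dird v (B \<alpha> \<beta>)) x = dird v (dird \<alpha> (B \<alpha> \<beta>)) x"
      by (rule dird_commute[OF open_V smooth_B x])
    also have "\<dots> = dird v (\<lambda>x. of_real ((3 * \<kappa> - 1) / 2) * dird \<beta> S x + (- 1 / 2) * dird \<beta> \<phi> x) x"
      by (rule dird_cong[OF open_V x]) (rule \<alpha>_B_\<alpha>_\<beta>)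
    also have "\<dots> = of_real ((3 * \<kappa> - 1) / 2) * dird v (dird \<beta> S) x + (- 1 / 2) * dird v (dird \<beta> \<phi>) x"
      by (rule dird_lincomb[OF dV[OF smd[OF smS] x] dV[OF smd[OF smooth_\<phi>] x]])
    finally show "dird \<alpha> (dird v (B \<alpha> \<beta>)) x =
       of_real ((3 * \<kappa> - 1) / 2) * dird v (dird \<beta> S) x + (- 1 / 2) * dird v (dird \<beta> \<phi>) x" .
  qed
  \<comment> \<open>The same device with \<open>\<alpha>_B_\<alpha>\<close>: after differentiation
    along \<beta> every derivative of R may be replaced by one of S, which removes the pole.\<close>
  have g4: "gr 0 (dird \<beta> (B \<alpha> v))" for v
  proof (rule gr_int[OF smd[OF smooth_B]], rule gr_cong)
    show "gr 0 (\<lambda>x. (1 / 2) * ((3 * (\<Sum>k\<in>UNIV. of_real (\<alpha> $ k * \<alpha> $ k * v $ k) * dird (axis k 1) (dird \<beta> S) x)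
        - dird \<beta> (dird v \<phi>) x) - dird v (dird \<beta> S) x))"
      by (intro gr_cmult gr_diff gr_sum gr_S(2) gr_\<phi>(2))
    fix x assume x: "x \<in> V"
    let ?T = "\<lambda>x. \<Sum>k\<in>UNIV. of_real (\<alpha> $ k * \<alpha> $ k * v $ k) * partial k R x"
    have dpR: "partial k R differentiable (at x)" for k
      by (rule dV[OF smooth_on_partial[OF smooth_R] x])
    have dcR: "(\<lambda>x. of_real (\<alpha> $ k * \<alpha> $ k * v $ k) * partial k R x) differentiable (at x)" for k
      by (intro differentiable_mult differentiable_const dpR)
    have dT: "?T differentiable (at x)"
      by (intro differentiable_sum ballI dcR) simp
    have swap: "dird \<beta> (dird u R) x = dird u (dird \<beta> S) x" for u
      using dird_commute[OF open_V smooth_R x, of \<beta> u] dird_dird_\<beta>_R[OF x, of u] by simp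
    have "dird \<beta> ?T x = (\<Sum>k\<in>UNIV. of_real (\<alpha> $ k * \<alpha> $ k * v $ k) * dird \<beta> (partial k R) x)"
      unfolding dird_sum[OF dcR] dird_cmult[OF dpR] ..
    also have "\<dots> = (\<Sum>k\<in>UNIV. of_real (\<alpha> $ k * \<alpha> $ k * v $ k) * dird (axis k 1) (dird \<beta> S) x)"
      unfolding swap[symmetric] by simp
    finally have T: "dird \<beta> ?T x = (\<Sum>k\<in>UNIV. of_real (\<alpha> $ k * \<alpha> $ k * v $ k) * dird (axis k 1) (dird \<beta> S) x)" .
    have "dird \<alpha> (dird \<beta> (B \<alpha> v)) x = dird \<beta> (dird \<alpha> (B \<alpha> v)) x"
      by (rule dird_commute[OF open_V smooth_B x])
    also have "\<dots> = dird \<beta> (\<lambda>x. (1 / 2) * ((3 * ?T x - dird v \<phi> x) - dird v R x)) x"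
      by (rule dird_cong[OF open_V x]) (rule half[OF \<alpha>_B_\<alpha>])
    also have "\<dots> = (1 / 2) * ((3 * dird \<beta> ?T x - dird \<beta> (dird v \<phi>) x) - dird \<beta> (dird v R) x)"
    proof -
      note d\<phi> = dV[OF smd[OF smooth_\<phi>] x, of v] and dR = dV[OF smd[OF smooth_R] x, of v]
      have d3: "(\<lambda>x. 3 * ?T x) differentiable (at x)"
        by (intro differentiable_mult differentiable_const dT)
      note d4 = differentiable_diff[OF d3 d\<phi>]
      show ?thesis
        unfolding dird_cmult[OF differentiable_diff[OF d4 dR]] dird_diff[OF d4 dR] dird_diff[OF d3 d\<phi>] dird_cmult[OF dT] ..
    qed
    finally show "dird \<alpha> (dird \<beta> (B \<alpha> v)) x = (1 / 2) * ((3 * (\<Sum>k\<in>UNIV. of_real (\<alpha> $ k * \<alpha> $ k * v $ k) * dird (axis k 1) (dird \<beta> S) x)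
        - dird \<beta> (dird v \<phi>) x) - dird v (dird \<beta> S) x)"
      unfolding T swap .
  qed
  \<comment> \<open>\<open>B_identity\<close> for \<alpha>, \<beta>, v is solved for this
    derivative; the two others are bounded by \<open>g4\<close> and \<open>g3\<close>.\<close>
  have g5: "gr 3 (dird \<alpha> (B \<beta> v))" for v
  proof (rule gr_cong)
    show "gr 3 (\<lambda>x. (3 * (\<Sum>k\<in>UNIV. of_real (\<alpha> $ k * \<beta> $ k * v $ k) * partial k R x) - dird \<beta> (B \<alpha> v) x) - dird v (B \<alpha> \<beta>) x)"
      by (intro gr_diff gr_cmult gr_sum gr_pR gr_le[OF g4] gr_le[OF g3])
    fix x assume x: "x \<in> V"
    show "dird \<alpha> (B \<beta> v) x = (3 * (\<Sum>k\<in>UNIV. of_real (\<alpha> $ k * \<beta> $ k * v $ k) * partial k R x) - dird \<beta> (B \<alpha> v) x) - dird v (B \<alpha> \<beta>) x"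
      using B_identity[OF x, of \<alpha> \<beta> v] unfolding B_sym[of v \<alpha>] by (simp add: eq_diff_eq add_ac)
  qed
  have g6: "gr 3 (B \<beta> v)" for v
    by (rule gr_int[OF smooth_B g5])
  have "gr 3 (\<lambda>x. 6 * C * of_real a * \<rho> x ^ 4 * B \<alpha> \<beta> x)"
  proof (rule gr_cong[OF _ curl_equation[folded a_def]])
    show "gr 3 (\<lambda>x. 2 * C * (\<rho> x ^ 3 * dird \<alpha> (B \<alpha> \<beta>) x)
      - (\<Sum>k\<in>UNIV. dird \<alpha> (B \<beta> (axis k 1)) x * partial k S x + B \<beta> (axis k 1) x * dird \<alpha> (partial k S) x)
      - 2 * C * (\<rho> x ^ 3 * (dird \<beta> \<phi> x + dird \<beta> S x))
      + (\<Sum>k\<in>UNIV. dird \<beta> (B \<alpha> (axis k 1)) x * partial k S x + B \<alpha> (axis k 1) x * dird \<beta> (partial k S) x))"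
      by (rule gr_add[OF gr_diff[OF gr_diff[OF gr_cmult[OF gr_mult[OF gr_\<rho> g2]]
              gr_sum[OF gr_add[OF gr_mult[OF g5 gr_pS(1)] gr_mult[OF g6 gr_pS(2)]]]]
            gr_cmult[OF gr_mult[OF gr_\<rho> gr_add[OF gr_\<phi>(1) gr_S(1)]]]]
          gr_sum[OF gr_add[OF gr_le[OF gr_mult[OF g4 gr_pS(1)]] gr_mult[OF g1 gr_pS(2)]]]])
  qed
  then obtain K where K: "\<And>t. 0 < t \<Longrightarrow> t \<le> T \<Longrightarrow>
      norm (6 * C * of_real a * \<rho> (?c t) ^ 4 * B \<alpha> \<beta> (?c t)) * t ^ 3 \<le> K"
    unfolding gr_def by (rule growthE) (rule that)
  define L where "L = K * a ^ 3 / (6 * norm C)"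
  have bound: "norm (B \<alpha> \<beta> (?c t)) \<le> L * t" if "0 < t" "t \<le> T" for t
  proof -
    have "norm (6 * C * of_real a * \<rho> (?c t) ^ 4 * B \<alpha> \<beta> (?c t)) * t ^ 3
        = (6 * norm C) * norm (B \<alpha> \<beta> (?c t)) / (a ^ 3 * t)"
    proof -
      have "6 * c * a * inverse (t * a) ^ 4 * b * t ^ 3 = (6 * c) * b / (a ^ 3 * t)" for c b :: real
        using a \<open>0 < t\<close> by (simp add: field_simps eval_nat_numeral)
      moreover have "norm (complex_of_real a) = a"
        using a by simp
      ultimately show ?thesis
        unfolding norm_mult norm_power norm_\<rho>[OF \<open>0 < t\<close>] by simp
    qed
    then have "(6 * norm C) * norm (B \<alpha> \<beta> (?c t)) / (a ^ 3 * t) \<le> K"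
      using K[OF that] by simp
    then show ?thesis
      using a that C by (simp add: L_def field_simps)
  qed
  show ?thesis
  proof (rule Lim_null_comparison)
    show "\<forall>\<^sub>F t in at_right 0. norm (B \<alpha> \<beta> (?c t)) \<le> L * t"
      using T(1) bound by (auto simp: eventually_at_right_field intro!: exI[of _ T])
    have "((\<lambda>t. L * t) \<longlongrightarrow> L * 0) (at_right 0)"
      by (intro tendsto_intros)
    then show "((\<lambda>t. L * t) \<longlongrightarrow> 0) (at_right 0)" by simp
  qed
qed

text \<open>By \<open>\<beta>_\<beta>_B_\<alpha>_\<beta>\<close> the mixed derivative of S is a
  multiple of the second tangential derivative of \<open>B \<alpha> \<beta>\<close>, a function
  tending to 0 at the wall. Such a limit says nothing about derivatives, so a second difference of
  fixed step h is used: it tends to 0 with t, but would stay above a positive constant if the claim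
  failed.\<close>

lemma mixed_derivative_zero: "dird \<alpha> (dird \<beta> S) p = 0"
proof (rule ccontr)
  let ?F = "dird \<alpha> (dird \<beta> S)"
  define c where "c = complex_of_real (3 * \<kappa> - 1)"
  have c: "c \<noteq> 0"
    using \<kappa> by (simp add: c_def) (metis \<kappa> eq_iff_diff_eq_0 of_real_1 of_real_eq_iff of_real_mult of_real_numeral)
  define w where "w = cnj (c * ?F p)"
  define m where "m = (norm (c * ?F p))\<^sup>2"
  assume "?F p \<noteq> 0"
  then have m: "m > 0" using c by (simp add: m_def)
  have Hp: "Re (w * (c * ?F p)) = m"
    unfolding w_def m_def using arg_cong[OF complex_norm_square[of "c * ?F p"], of Re]
    by (simp only: mult.commute[of "cnj (c * ?F p)"] of_real_power[symmetric] Re_complex_of_real)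
  have "?F differentiable (at p)"
    using smooth_on_differentiable[OF smooth_on_dird[OF open_ball smooth_on_dird[OF open_ball smooth_S]] open_ball] \<delta> by simp
  then have "(?F \<longlongrightarrow> ?F p) (at p)"
    using differentiable_imp_continuous_within continuous_within by blast
  then have "((\<lambda>x. Re (w * (c * ?F x))) \<longlongrightarrow> m) (at p)"
    unfolding Hp[symmetric] by (intro tendsto_intros)
  then have "eventually (\<lambda>x. m / 2 < Re (w * (c * ?F x))) (at p)"
    by (rule order_tendstoD(1)) (use m in simp)
  then obtain d0 where d0: "d0 > 0" "\<And>x. x \<noteq> p \<Longrightarrow> dist x p < d0 \<Longrightarrow> m / 2 < Re (w * (c * ?F x))"
    unfolding eventually_at by auto
  define d where "d = min d0 \<delta>"
  have d: "d > 0" "ball p d \<subseteq> ball p \<delta>"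
    using d0(1) \<delta> by (auto simp: d_def)
  have dF: "m / 2 < Re (w * (c * ?F x))" if "x \<in> ball p d" for x
  proof (cases "x = p")
    case True
    then show ?thesis using m Hp by simp
  next
    case False
    then show ?thesis
      using that by (intro d0(2)) (simp_all add: d_def dist_commute)
  qed
  \<comment> \<open>Both edges are \<beta>. Half of the radius d is kept for the displacement t
    \<alpha>, which is what \<open>e\<close> bounds.\<close>
  obtain h where h: "0 < h" "\<And>s t. 0 \<le> s \<Longrightarrow> s \<le> h \<Longrightarrow> 0 \<le> t \<Longrightarrow> t \<le> h \<Longrightarrow> p + s *\<^sub>R \<beta> + t *\<^sub>R \<beta> \<in> ball p (d / 2)"
    by (rule parallelogram_in_ball[of "d / 2"]) (use d in simp, rule that)
  define g where "g t s = 2 * Re (w * B \<alpha> \<beta> ((p + s *\<^sub>R \<beta>) + t *\<^sub>R \<alpha>))" for t s :: real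
  define e where "e = d / (2 * norm \<alpha>)"
  have e: "e > 0" using d \<alpha> by (simp add: e_def)
  have lower: "g t (h + h) - 2 * g t h + g t 0 \<ge> h\<^sup>2 * (m / 2)" if t: "0 < t" "t < e" for t
  proof -
    let ?z = "\<lambda>s s'. p + t *\<^sub>R \<alpha> + s *\<^sub>R \<beta> + s' *\<^sub>R \<beta>"
    have inball: "?z s s' \<in> ball p d" and inV: "?z s s' \<in> V" if "0 \<le> s" "s \<le> h" "0 \<le> s'" "s' \<le> h" for s s'
    proof -
      have "norm (t *\<^sub>R \<alpha>) < d / 2"
        using t \<alpha> by (simp add: e_def field_simps)
      moreover have "norm (s *\<^sub>R \<beta> + s' *\<^sub>R \<beta>) < d / 2"
        using h(2)[OF that] by (simp only: mem_ball dist_norm norm_minus_commute[of p] add.assoc add_diff_cancel_left')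
      ultimately have "norm (t *\<^sub>R \<alpha> + (s *\<^sub>R \<beta> + s' *\<^sub>R \<beta>)) < d"
        using norm_triangle_ineq[of "t *\<^sub>R \<alpha>" "s *\<^sub>R \<beta> + s' *\<^sub>R \<beta>"] by linarith
      moreover have "dist p (?z s s') = norm (t *\<^sub>R \<alpha> + (s *\<^sub>R \<beta> + s' *\<^sub>R \<beta>))"
        by (simp only: dist_norm norm_minus_commute[of p] add.assoc add_diff_cancel_left')
      ultimately show *: "?z s s' \<in> ball p d" by simp
      have "\<alpha> \<bullet> ?z s s' = t * (\<alpha> \<bullet> \<alpha>)"
        using p orth by (simp add: inner_add_right)
      also have "\<dots> > 0" using t \<alpha> by simp
      finally show "?z s s' \<in> V"
        using * d(2) unfolding V_def by blast
    qed
    \<comment> \<open>A function of the sum alone: its second difference over the square of side h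
      is g(2h) - 2 g(h) + g(0).\<close>
    define \<psi> where "\<psi> s s' = g t (s + s')" for s s'
    have \<psi>: "\<psi> s s' = 2 * Re (w * B \<alpha> \<beta> (?z s s'))" for s s'
    proof -
      have "(p + (s + s') *\<^sub>R \<beta>) + t *\<^sub>R \<alpha> = ?z s s'" by (simp add: algebra_simps)
      then show ?thesis by (simp only: \<psi>_def g_def)
    qed
    have swap: "?z s s' = p + t *\<^sub>R \<alpha> + s' *\<^sub>R \<beta> + s *\<^sub>R \<beta>" for s s'
      by (simp add: algebra_simps)
    have "\<exists>s s'. 0 < s \<and> s < h \<and> 0 < s' \<and> s' < h \<and> \<psi> h h - \<psi> 0 h - \<psi> h 0 + \<psi> 0 0
        = h\<^sup>2 * (2 * Re (w * dird \<beta> (dird \<beta> (B \<alpha> \<beta>)) (?z s s')))"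
    proof (rule second_difference[OF h(1)])
      fix s s' assume st: "0 \<le> s" "s \<le> h" "0 \<le> s'" "s' \<le> h"
      show "((\<lambda>s. \<psi> s s') has_real_derivative 2 * Re (w * dird \<beta> (B \<alpha> \<beta>) (?z s s'))) (at s)"
        unfolding \<psi> swap[of _ s'] using inV[OF st(3,4,1,2)]
        by (intro DERIV_cmult dird_line_Re dV[OF smooth_B])
      show "((\<lambda>s'. 2 * Re (w * dird \<beta> (B \<alpha> \<beta>) (?z s s'))) has_real_derivative
          2 * Re (w * dird \<beta> (dird \<beta> (B \<alpha> \<beta>)) (?z s s'))) (at s')"
        using inV[OF st] by (intro DERIV_cmult dird_line_Re dV[OF smd[OF smooth_B]])
    qed
    then obtain s s' where ss: "0 < s" "s < h" "0 < s'" "s' < h"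
      "\<psi> h h - \<psi> 0 h - \<psi> h 0 + \<psi> 0 0 = h\<^sup>2 * (2 * Re (w * dird \<beta> (dird \<beta> (B \<alpha> \<beta>)) (?z s s')))"
      by blast
    have zV: "?z s s' \<in> V" and zb: "?z s s' \<in> ball p d"
      using inV[of s s'] inball[of s s'] ss by simp_all
    have "2 * Re (w * dird \<beta> (dird \<beta> (B \<alpha> \<beta>)) (?z s s')) = Re (w * (2 * dird \<beta> (dird \<beta> (B \<alpha> \<beta>)) (?z s s')))"
      by (simp add: algebra_simps)
    also have "\<dots> = Re (w * (c * ?F (?z s s')))"
      unfolding \<beta>_\<beta>_B_\<alpha>_\<beta>[OF zV] c_def ..
    also have "\<dots> \<ge> m / 2"
      using dF[OF zb] by simp
    finally have "h\<^sup>2 * (m / 2) \<le> \<psi> h h - \<psi> 0 h - \<psi> h 0 + \<psi> 0 0"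
      unfolding ss(5) by (intro mult_left_mono) auto
    then show ?thesis
      by (simp add: \<psi>_def)
  qed
  have lim: "((\<lambda>t. g t s) \<longlongrightarrow> 0) (at_right 0)" if ab: "0 \<le> a" "a \<le> h" "0 \<le> b" "b \<le> h" "s = a + b" for s a b
  proof -
    have "p + s *\<^sub>R \<beta> = p + a *\<^sub>R \<beta> + b *\<^sub>R \<beta>"
      by (simp only: ab(5) scaleR_add_left add.assoc)
    then have "dist p (p + s *\<^sub>R \<beta>) < d / 2"
      using h(2)[OF ab(1-4)] by (simp only: mem_ball)
    moreover have "d / 2 < \<delta>"
      using d0(1) \<delta> unfolding d_def by linarith
    ultimately have "p + s *\<^sub>R \<beta> \<in> ball p \<delta>"
      unfolding mem_ball by linarith
    moreover have "\<alpha> \<bullet> (p + s *\<^sub>R \<beta>) = 0"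
      using p orth by (simp add: inner_add_right)
    ultimately have "((\<lambda>t. B \<alpha> \<beta> ((p + s *\<^sub>R \<beta>) + t *\<^sub>R \<alpha>)) \<longlongrightarrow> 0) (at_right 0)"
      by (intro form_tendsto_zero)
    then have "((\<lambda>t. 2 * Re (w * B \<alpha> \<beta> ((p + s *\<^sub>R \<beta>) + t *\<^sub>R \<alpha>))) \<longlongrightarrow> 2 * Re (w * 0)) (at_right 0)"
      by (intro tendsto_intros)
    then show ?thesis by (simp add: g_def)
  qed
  have "((\<lambda>t. g t (h + h) - 2 * g t h + g t 0) \<longlongrightarrow> 0 - 2 * 0 + 0) (at_right 0)"
    using h(1) by (intro tendsto_intros lim[of h h] lim[of h 0] lim[of 0 0]) simp_all
  moreover have "eventually (\<lambda>t. h\<^sup>2 * (m / 2) \<le> g t (h + h) - 2 * g t h + g t 0) (at_right 0)"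
    using e lower by (auto simp: eventually_at_right_field intro!: exI[of _ e])
  ultimately have "h\<^sup>2 * (m / 2) \<le> 0 - 2 * 0 + 0"
    by (rule tendsto_lowerbound) simp
  moreover have "h\<^sup>2 * (m / 2) > 0"
    using h(1) m by simp
  ultimately show False by simp
qed

end

section \<open>Root sums\<close>

lemma sum_roots_B:
  fixes F :: "real ^ 'n::{finite,linorder} \<Rightarrow> 'b::comm_monoid_add"
  shows "(\<Sum>\<gamma>\<in>roots_B. F \<gamma>) =
    (\<Sum>i\<in>UNIV. \<Sum>j | i < j. F (axis i 1 + axis j 1) + F (axis i 1 - axis j 1)) + (\<Sum>i\<in>UNIV. F (axis i 1))"
proof -
  let ?I = "Sigma UNIV (\<lambda>i :: 'n. {j. i < j})"
  let ?p = "\<lambda>(i :: 'n, j). axis i 1 + axis j 1 :: real ^ 'n::_"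
  let ?m = "\<lambda>(i :: 'n, j). axis i 1 - axis j 1 :: real ^ 'n::_"
  let ?a = "\<lambda>i :: 'n. axis i 1 :: real ^ 'n::_"
  have eq: "roots_B = (?p ` ?I \<union> ?m ` ?I) \<union> range ?a"
    unfolding roots_B_def roots_D_def by auto
  have dis: "(?p ` ?I \<union> ?m ` ?I) \<inter> range ?a = {}" "?p ` ?I \<inter> ?m ` ?I = {}"
    by (auto simp: vectors_distinct)
  have ip: "inj_on ?p ?I"
    by (rule inj_onI) (auto simp: plus_eq_plus)
  have im: "inj_on ?m ?I"
    by (rule inj_onI) (auto simp: minus_eq_minus)
  have ia: "inj ?a"
    by (rule injI) (simp add: axis_eq_axis)
  have fin: "finite (?p ` ?I)" "finite (?m ` ?I)" "finite (range ?a)"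
    by simp_all
  have "(\<Sum>\<gamma>\<in>roots_B. F \<gamma>) = (sum F (?p ` ?I) + sum F (?m ` ?I)) + sum F (range ?a)"
    unfolding eq sum.union_disjoint[OF finite_UnI[OF fin(1,2)] fin(3) dis(1)] sum.union_disjoint[OF fin(1,2) dis(2)] ..
  also have "sum F (?p ` ?I) + sum F (?m ` ?I) = (\<Sum>(i, j)\<in>?I. F (axis i 1 + axis j 1) + F (axis i 1 - axis j 1))"
    unfolding sum.reindex[OF ip] sum.reindex[OF im] sum.distrib[symmetric]
    by (intro sum.cong refl) auto
  also have "\<dots> = (\<Sum>i\<in>UNIV. \<Sum>j | i < j. F (axis i 1 + axis j 1) + F (axis i 1 - axis j 1))"
    by (rule sum.Sigma[symmetric]) auto
  also have "sum F (range ?a) = (\<Sum>i\<in>UNIV. F (axis i 1))"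
    unfolding sum.reindex[OF ia] o_def ..
  finally show ?thesis .
qed

lemma finite_roots_B: "finite (roots_B :: (real ^ 'n::{finite,linorder}) set)"
proof -
  have "roots_B \<subseteq> (\<lambda>(i, j). axis i 1 + axis j 1 :: real ^ 'n::_) ` UNIV \<union>
      (\<lambda>(i, j). axis i 1 - axis j 1) ` UNIV \<union> range (\<lambda>i. axis i 1)"
    unfolding roots_B_def roots_D_def by force
  then show ?thesis
    by (rule finite_subset) simp
qed

lemma roots_B_cases [consumes 1]:
  assumes "\<gamma> \<in> (roots_B :: (real ^ 'n::{finite,linorder}) set)"
  obtains i j where "i < j" "\<gamma> = axis i 1 + axis j 1" | i j where "i < j" "\<gamma> = axis i 1 - axis j 1"
    | i where "\<gamma> = axis i 1"
  using assms unfolding roots_B_def roots_D_def by auto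

lemma coefficient_outside:
  assumes "\<gamma> \<notin> roots_B"
  shows "coefficient Cp Cm C1 \<gamma> = 0"
proof -
  have "\<gamma> \<noteq> axis i 1 + axis j 1" "\<gamma> \<noteq> axis i 1 - axis j 1" "\<gamma> \<noteq> axis k 1" if "i < j" for i j k
    using assms that unfolding roots_B_def roots_D_def by auto
  moreover have "\<gamma> \<noteq> axis k 1" for k
    using assms unfolding roots_B_def by auto
  ultimately show ?thesis
    unfolding coefficient_def by (auto intro!: sum.neutral)
qed

lemma singular_vectors_alt: "singular_vectors Cp Cm C1 = {\<gamma> \<in> roots_B. coefficient Cp Cm C1 \<gamma> \<noteq> 0}"
  unfolding singular_vectors_def roots_B_def roots_D_def
  by (auto simp: coefficient_plus coefficient_minus coefficient_axis)

text \<open>Coordinate sums of positive roots are 2, 1 or 0, so a root whose negative is also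
  positive has sum 0. It is then a difference of two axis vectors, and its sign is fixed by the
  order of the indices.\<close>

lemma uminus_roots_B:
  assumes "\<gamma> \<in> roots_B"
  shows "- \<gamma> \<notin> roots_B"
proof
  assume neg: "- \<gamma> \<in> roots_B"
  define s where "s \<gamma> = (\<Sum>m\<in>UNIV. \<gamma> $ m)" for \<gamma> :: "real ^ 'a::_"
  have s: "s \<gamma> \<ge> 0 \<and> (s \<gamma> = 0 \<longrightarrow> (\<exists>i j. i < j \<and> \<gamma> = axis i 1 - axis j 1))" if "\<gamma> \<in> roots_B" for \<gamma> :: "real ^ 'a::_"
    using that by (cases rule: roots_B_cases) (auto simp: s_def coordinate_sums[simplified])
  have "s (- \<gamma>) = - s \<gamma>"
    by (simp add: s_def sum_negf)
  then have "s \<gamma> = 0" "s (- \<gamma>) = 0"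
    using s[OF assms] s[OF neg] by auto
  then obtain i j k l where ij: "i < j" "\<gamma> = axis i 1 - axis j 1" and kl: "k < l" "- \<gamma> = axis k 1 - axis l 1"
    using s[OF assms] s[OF neg] by blast
  have "axis j 1 - axis i 1 = (axis k 1 - axis l 1 :: real ^ 'a::_)"
    using ij kl by simp
  then have "(axis j 1 - axis i 1 :: real ^ 'a::_) $ m = (axis k 1 - axis l 1) $ m" for m
    by simp
  from this[of i] this[of j] ij(1) kl(1) show False
    by (auto simp: axis_def split: if_splits)
qed

lemma inner_axis_left: "axis i (1::real) \<bullet> x = x $ i"
  by (simp add: inner_axis')

lemma potential_roots:
  "potential Cp Cm C1 Rt x = (\<Sum>\<gamma>\<in>roots_B. coefficient Cp Cm C1 \<gamma> * inverse (of_real (\<gamma> \<bullet> x)) ^ 2) + Rt x"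
proof -
  have "(\<Sum>i\<in>UNIV. \<Sum>j | i < j. Cp i j / of_real ((x $ i + x $ j)\<^sup>2) + Cm i j / of_real ((x $ i - x $ j)\<^sup>2)) =
     (\<Sum>i\<in>UNIV. \<Sum>j | i < j. coefficient Cp Cm C1 (axis i 1 + axis j 1) * inverse (of_real ((axis i 1 + axis j 1) \<bullet> x)) ^ 2
      + coefficient Cp Cm C1 (axis i 1 - axis j 1) * inverse (of_real ((axis i 1 - axis j 1) \<bullet> x)) ^ 2)"
    by (intro sum.cong refl)
      (simp add: coefficient_plus coefficient_minus inner_add_left inner_diff_left inner_axis_left divide_inverse power_inverse)
  moreover have "(\<Sum>i\<in>UNIV. C1 i / of_real ((x $ i)\<^sup>2)) =
     (\<Sum>i\<in>UNIV. coefficient Cp Cm C1 (axis i 1) * inverse (of_real (axis i 1 \<bullet> x)) ^ 2)"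
    by (intro sum.cong refl) (simp add: coefficient_axis inner_axis_left divide_inverse power_inverse)
  ultimately show ?thesis
    unfolding potential_def sum_roots_B by (simp only:)
qed

text \<open>The coefficient of the root e_i + \<sigma> e_j up to sign, for distinct i and j in
  either order and \<sigma> equal to 1 or -1. Taking minimum and maximum removes case distinctions
  on the order.\<close>

definition pair_coefficient :: "('n \<Rightarrow> 'n \<Rightarrow> complex) \<Rightarrow> ('n \<Rightarrow> 'n \<Rightarrow> complex) \<Rightarrow> 'n::linorder \<Rightarrow> real \<Rightarrow> 'n \<Rightarrow> complex" where
  "pair_coefficient Cp Cm i \<sigma> j = (if \<sigma> = 1 then Cp (min i j) (max i j) else Cm (min i j) (max i j))"

lemma pair_coefficient_sym: "pair_coefficient Cp Cm i \<sigma> j = pair_coefficient Cp Cm j \<sigma> i"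
  by (simp add: pair_coefficient_def min.commute max.commute)

text \<open>The root sum as an explicit linear form in v: for v supported on one or two coordinates
  just the corresponding summands remain.\<close>

lemma roots_sum_coordinates:
  fixes u v x :: "real ^ 'n::{finite,linorder}"
  shows "(\<Sum>\<gamma>\<in>roots_B. coefficient Cp Cm C1 \<gamma> * of_real (\<gamma> \<bullet> u) * of_real (\<gamma> \<bullet> v) * inverse (of_real (\<gamma> \<bullet> x)) ^ 4) =
    (\<Sum>i\<in>UNIV. of_real (v $ i) *
      ((\<Sum>j\<in>UNIV - {i}. \<Sum>\<sigma>\<in>{1, - 1}. pair_coefficient Cp Cm i \<sigma> j * of_real ((u $ i + \<sigma> * u $ j) * inverse (x $ i + \<sigma> * x $ j) ^ 4))
        + C1 i * of_real (u $ i * inverse (x $ i) ^ 4)))"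
proof -
  define a where "a i \<sigma> j = (if i = j then 0 else pair_coefficient Cp Cm i \<sigma> j * of_real ((u $ i + \<sigma> * u $ j) * inverse (x $ i + \<sigma> * x $ j) ^ 4))" for i \<sigma> j
  \<comment> \<open>Each pair root is shared equally between (i, j) and (j, i). Exchanging the
    indices multiplies the root by \<sigma>, which changes both linear factors by that sign and
    leaves the fourth power unchanged.\<close>
  define f where "f i j = (1 / 2) * (\<Sum>\<sigma>\<in>{1, - 1}. a i \<sigma> j * of_real (v $ i + \<sigma> * v $ j))" for i j
  have a_swap: "a i \<sigma> j * of_real \<sigma> = a j \<sigma> i" if "\<sigma> \<in> {1, - 1}" for i j \<sigma>
  proof -
    have "(u $ i + \<sigma> * u $ j) * \<sigma> = u $ j + \<sigma> * u $ i"
      using that by auto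
    moreover have "(x $ i + \<sigma> * x $ j) ^ 4 = (x $ j + \<sigma> * x $ i) ^ 4"
      using that by (auto simp: add.commute power4_eq_xxxx algebra_simps)
    then have "inverse (x $ i + \<sigma> * x $ j) ^ 4 = inverse (x $ j + \<sigma> * x $ i) ^ 4"
      by (simp add: power_inverse)
    ultimately have "((u $ i + \<sigma> * u $ j) * \<sigma>) * inverse (x $ i + \<sigma> * x $ j) ^ 4 = (u $ j + \<sigma> * u $ i) * inverse (x $ j + \<sigma> * x $ i) ^ 4"
      by (simp only:)
    then have "(u $ i + \<sigma> * u $ j) * inverse (x $ i + \<sigma> * x $ j) ^ 4 * \<sigma> = (u $ j + \<sigma> * u $ i) * inverse (x $ j + \<sigma> * x $ i) ^ 4"
      by (simp only: mult_ac)
    then have "complex_of_real ((u $ i + \<sigma> * u $ j) * inverse (x $ i + \<sigma> * x $ j) ^ 4) * of_real \<sigma> = of_real ((u $ j + \<sigma> * u $ i) * inverse (x $ j + \<sigma> * x $ i) ^ 4)"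
      by (simp only: of_real_mult[symmetric])
    then show ?thesis
      unfolding a_def pair_coefficient_sym[of Cp Cm j] by (simp add: mult.assoc)
  qed
  have f_swap: "f j i = f i j" for i j
  proof -
    have "a j \<sigma> i * of_real (v $ j + \<sigma> * v $ i) = a i \<sigma> j * of_real (v $ i + \<sigma> * v $ j)" if "\<sigma> \<in> {1, - 1}" for \<sigma>
    proof -
      have "\<sigma> * (v $ j + \<sigma> * v $ i) = v $ i + \<sigma> * v $ j"
        using that by auto
      then show ?thesis
        unfolding a_swap[OF that, of i j, symmetric] by (metis mult.assoc of_real_mult)
    qed
    then show ?thesis
      unfolding f_def by simp
  qed
  have f_pair: "coefficient Cp Cm C1 (axis i 1 + axis j 1) * of_real ((axis i 1 + axis j 1) \<bullet> u) * of_real ((axis i 1 + axis j 1) \<bullet> v) * inverse (of_real ((axis i 1 + axis j 1) \<bullet> x)) ^ 4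
      + coefficient Cp Cm C1 (axis i 1 - axis j 1) * of_real ((axis i 1 - axis j 1) \<bullet> u) * of_real ((axis i 1 - axis j 1) \<bullet> v) * inverse (of_real ((axis i 1 - axis j 1) \<bullet> x)) ^ 4
      = f i j + f j i" if "i < j" for i j
    using that
    by (simp add: f_swap[of j i]) (simp add: f_def a_def pair_coefficient_def coefficient_plus coefficient_minus
        inner_add_left inner_diff_left inner_axis_left mult_ac)
  have "(\<Sum>\<gamma>\<in>roots_B. coefficient Cp Cm C1 \<gamma> * of_real (\<gamma> \<bullet> u) * of_real (\<gamma> \<bullet> v) * inverse (of_real (\<gamma> \<bullet> x)) ^ 4) =
     (\<Sum>i\<in>UNIV. \<Sum>j | i < j. f i j + f j i) + (\<Sum>i\<in>UNIV. of_real (v $ i) * (C1 i * of_real (u $ i * inverse (x $ i) ^ 4)))"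
    unfolding sum_roots_B
  proof (rule arg_cong2[where f = "(+)"]; intro sum.cong refl)
    fix i j :: 'n assume "j \<in> {j. i < j}"
    then have "i < j" by simp
    then show "coefficient Cp Cm C1 (axis i 1 + axis j 1) * of_real ((axis i 1 + axis j 1) \<bullet> u) * of_real ((axis i 1 + axis j 1) \<bullet> v) * inverse (of_real ((axis i 1 + axis j 1) \<bullet> x)) ^ 4
      + coefficient Cp Cm C1 (axis i 1 - axis j 1) * of_real ((axis i 1 - axis j 1) \<bullet> u) * of_real ((axis i 1 - axis j 1) \<bullet> v) * inverse (of_real ((axis i 1 - axis j 1) \<bullet> x)) ^ 4
      = f i j + f j i"
      by (rule f_pair)
  qed (simp add: coefficient_axis inner_axis_left mult_ac)
  also have "(\<Sum>i\<in>UNIV. \<Sum>j | i < j. f i j + f j i) = (\<Sum>i\<in>UNIV. \<Sum>j\<in>UNIV. f i j)"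
    unfolding sum_less_symmetrize by (simp add: f_def a_def)
  also have "\<dots> = (\<Sum>i\<in>UNIV. \<Sum>j\<in>UNIV. (1 / 2) * (\<Sum>\<sigma>\<in>{1, - 1}. a i \<sigma> j * of_real (v $ i)) + (1 / 2) * (\<Sum>\<sigma>\<in>{1, - 1}. a j \<sigma> i * of_real (v $ j)))"
  proof (intro sum.cong refl)
    fix i j
    have "a i \<sigma> j * of_real (v $ i + \<sigma> * v $ j) = a i \<sigma> j * of_real (v $ i) + a j \<sigma> i * of_real (v $ j)" if "\<sigma> \<in> {1, - 1}" for \<sigma>
      unfolding a_swap[OF that, of i j, symmetric] by (simp add: algebra_simps)
    then have *: "(\<Sum>\<sigma>\<in>{1, - 1}. a i \<sigma> j * of_real (v $ i + \<sigma> * v $ j)) = (\<Sum>\<sigma>\<in>{1, - 1}. a i \<sigma> j * of_real (v $ i) + a j \<sigma> i * of_real (v $ j))"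
      by (intro sum.cong refl)
    show "f i j = (1 / 2) * (\<Sum>\<sigma>\<in>{1, - 1}. a i \<sigma> j * of_real (v $ i)) + (1 / 2) * (\<Sum>\<sigma>\<in>{1, - 1}. a j \<sigma> i * of_real (v $ j))"
      unfolding f_def * sum.distrib distrib_left ..
  qed
  also have "\<dots> = (\<Sum>i\<in>UNIV. \<Sum>j\<in>UNIV. (1 / 2) * (\<Sum>\<sigma>\<in>{1, - 1}. a i \<sigma> j * of_real (v $ i))) + (\<Sum>i\<in>UNIV. \<Sum>j\<in>UNIV. (1 / 2) * (\<Sum>\<sigma>\<in>{1, - 1}. a j \<sigma> i * of_real (v $ j)))"
    by (simp only: sum.distrib)
  also have "(\<Sum>i\<in>UNIV. \<Sum>j\<in>UNIV. (1 / 2) * (\<Sum>\<sigma>\<in>{1, - 1}. a j \<sigma> i * of_real (v $ j))) = (\<Sum>i\<in>UNIV. \<Sum>j\<in>UNIV. (1 / 2) * (\<Sum>\<sigma>\<in>{1, - 1}. a i \<sigma> j * of_real (v $ i)))"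
    by (rule sum.swap)
  also have "(\<Sum>i\<in>UNIV. \<Sum>j\<in>UNIV. (1 / 2) * (\<Sum>\<sigma>\<in>{1, - 1}. a i \<sigma> j * of_real (v $ i))) + (\<Sum>i\<in>UNIV. \<Sum>j\<in>UNIV. (1 / 2) * (\<Sum>\<sigma>\<in>{1, - 1}. a i \<sigma> j * of_real (v $ i)))
     = (\<Sum>i\<in>UNIV. of_real (v $ i) * (\<Sum>j\<in>UNIV. \<Sum>\<sigma>\<in>{1, - 1}. a i \<sigma> j))"
    unfolding sum.distrib[symmetric] sum_distrib_left by (intro sum.cong refl) (simp add: mult_ac)
  also have "\<dots> = (\<Sum>i\<in>UNIV. of_real (v $ i) * (\<Sum>j\<in>UNIV - {i}. \<Sum>\<sigma>\<in>{1, - 1}. pair_coefficient Cp Cm i \<sigma> j * of_real ((u $ i + \<sigma> * u $ j) * inverse (x $ i + \<sigma> * x $ j) ^ 4)))"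
  proof -
    have "(\<Sum>j\<in>UNIV. \<Sum>\<sigma>\<in>{1, - 1}. a i \<sigma> j) = (\<Sum>j\<in>UNIV - {i}. \<Sum>\<sigma>\<in>{1, - 1}. pair_coefficient Cp Cm i \<sigma> j * of_real ((u $ i + \<sigma> * u $ j) * inverse (x $ i + \<sigma> * x $ j) ^ 4))" for i
      by (rule sum.mono_neutral_cong_right) (auto simp: a_def)
    then show ?thesis by simp
  qed
  finally show ?thesis
    by (simp only: distrib_left sum.distrib)
qed

section \<open>Relations between the coupling constants\<close>

lemma zero_notin_roots_B: "0 \<notin> roots_B"
  using uminus_roots_B[of 0] by auto

locale root_setting =
  fixes Cp Cm :: "'n::{finite,linorder} \<Rightarrow> 'n \<Rightarrow> complex"
    and C1 :: "'n \<Rightarrow> complex"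
    and Rt :: "real ^ 'n::_ \<Rightarrow> complex"
    and r :: real
    and a2 a1 :: "'n \<Rightarrow> real ^ 'n::_ \<Rightarrow> complex"
    and a11 :: "'n \<Rightarrow> 'n \<Rightarrow> real ^ 'n::_ \<Rightarrow> complex"
    and a0 :: "real ^ 'n::_ \<Rightarrow> complex"
    and H D :: "(real ^ 'n::_) set"
  assumes H_def: "H = singular_vectors Cp Cm C1"
    and D_def: "D = ball 0 r - (\<Union>\<alpha>\<in>H. {x. \<alpha> \<bullet> x = 0})"
    and r: "r > 0" and analytic_Rt: "real_analytic_on (ball 0 r) Rt"
    and analytic_a2: "\<And>i. real_analytic_on D (a2 i)"
    and analytic_a11: "\<And>i j. i < j \<Longrightarrow> real_analytic_on D (a11 i j)"
    and analytic_a1: "\<And>i. real_analytic_on D (a1 i)"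
    and analytic_a0: "real_analytic_on D a0"
    and commute: "commute_on D (schroedinger_op (potential Cp Cm C1 Rt)) (quartic_op a2 a11 a1 a0)"
begin

abbreviation c :: "real ^ 'n::_ \<Rightarrow> complex" where
  "c \<equiv> coefficient Cp Cm C1"

lemma in_H: "\<gamma> \<in> H \<longleftrightarrow> \<gamma> \<in> roots_B \<and> c \<gamma> \<noteq> 0"
  by (simp add: H_def singular_vectors_alt)

lemma open_D: "open D"
proof -
  have "finite H"
    by (rule finite_subset[OF _ finite_roots_B]) (use in_H in blast)
  then have "closed (\<Union>\<alpha>\<in>H. {x. \<alpha> \<bullet> x = 0})"
    by (intro closed_UN ballI closed_hyperplane)
  then show ?thesis
    unfolding D_def by (intro open_Diff open_ball)
qed

lemma smooth_Rt: "smooth_on (ball 0 r) Rt"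
  by (rule real_analytic_on_smooth_on[OF open_ball analytic_Rt])

lemma smooth_potential: "smooth_on D (potential Cp Cm C1 Rt)"
proof -
  have "smooth_on D (\<lambda>x. c \<gamma> * inverse (of_real (\<gamma> \<bullet> x)) ^ 2)" if \<gamma>: "\<gamma> \<in> roots_B" for \<gamma>
  proof (cases "c \<gamma> = 0")
    case True
    then show ?thesis using smooth_on_const[OF open_D] by simp
  next
    case False
    then have "\<gamma> \<in> H" using \<gamma> in_H by blast
    then have "\<gamma> \<bullet> x \<noteq> 0" if "x \<in> D" for x
      using that by (auto simp: D_def)
    then show ?thesis
      by (intro smooth_on_cmult smooth_on_inverse_power open_D)
  qed
  moreover have "smooth_on D Rt"
    by (rule smooth_on_subset[OF smooth_Rt]) (auto simp: D_def)
  ultimately show ?thesis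
    unfolding potential_roots[abs_def] by (intro smooth_on_add smooth_on_sum open_D)
qed

sublocale commuting_pair a2 a1 a11 a0 "potential Cp Cm C1 Rt" D
  by unfold_locales
    (rule open_D smooth_potential commute real_analytic_on_smooth_on[OF open_D] analytic_a2 analytic_a11 analytic_a1 analytic_a0 | assumption)+

text \<open>Orthogonal roots satisfy this with \<open>\<kappa> = 1\<close> if they have the same support and with
  \<open>\<kappa> = 0\<close> if their supports are disjoint.\<close>

definition wall_pair :: "real ^ 'n::_ \<Rightarrow> real ^ 'n::_ \<Rightarrow> real \<Rightarrow> bool" where
  "wall_pair \<alpha> \<beta> \<kappa> \<longleftrightarrow> \<alpha> \<in> H \<and> \<alpha> \<bullet> \<beta> = 0 \<and> 3 * \<kappa> \<noteq> 1 \<and>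
    (\<forall>k. (\<alpha> $ k) ^ 3 = \<alpha> $ k \<and> (\<beta> $ k) ^ 3 = \<beta> $ k \<and>
      (\<alpha> $ k)\<^sup>2 * \<beta> $ k = \<kappa> * \<beta> $ k \<and> (\<beta> $ k)\<^sup>2 * \<alpha> $ k = \<kappa> * \<alpha> $ k)"

text \<open>The hyperplanes of all type B roots are avoided, including those with coefficient 0, so
  the notion does not depend on the unknown set H.\<close>

definition generic_point :: "real ^ 'n::_ \<Rightarrow> real ^ 'n::_ \<Rightarrow> bool" where
  "generic_point \<alpha> p \<longleftrightarrow> \<alpha> \<bullet> p = 0 \<and> (\<forall>\<gamma>\<in>roots_B - {\<alpha>}. \<gamma> \<bullet> p \<noteq> 0)"

text \<open>Near p all roots other than \<alpha> contribute smooth terms, which go into the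
  remainder S of \<open>wall_model\<close>. The factor 6 comes from differentiating an inverse
  square twice.\<close>

lemma wall_identity:
  assumes wp: "wall_pair \<alpha> \<beta> \<kappa>" and gp: "generic_point \<alpha> p" and p: "p \<in> ball 0 r"
  shows "6 * (\<Sum>\<gamma>\<in>roots_B - {\<alpha>}. c \<gamma> * of_real (\<gamma> \<bullet> \<alpha>) * of_real (\<gamma> \<bullet> \<beta>) * inverse (of_real (\<gamma> \<bullet> p)) ^ 4)
    + dird \<alpha> (dird \<beta> Rt) p = 0"
proof -
  let ?A = "roots_B - {\<alpha>}"
  let ?R = "potential Cp Cm C1 Rt"
  have \<alpha>H: "\<alpha> \<in> roots_B" "c \<alpha> \<noteq> 0"
    using wp in_H unfolding wall_pair_def by blast+
  have finA: "finite ?A"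
    using finite_roots_B by blast
  \<comment> \<open>Finitely many open conditions, so a whole ball around p avoids every root
    hyperplane except that of \<alpha>.\<close>
  define U where "U = ball 0 r \<inter> (\<Inter>\<gamma>\<in>?A. {x. \<gamma> \<bullet> x \<noteq> 0})"
  have "open {x. \<gamma> \<bullet> x \<noteq> 0}" for \<gamma> :: "real ^ 'n::_"
    using closed_hyperplane[of \<gamma> 0] by (simp add: closed_def Compl_eq)
  then have "open U"
    unfolding U_def using finA by (intro open_Int open_INT open_ball) blast+
  moreover have "p \<in> U"
    using gp p unfolding U_def generic_point_def by blast
  ultimately obtain \<delta> where \<delta>: "\<delta> > 0" "ball p \<delta> \<subseteq> U"
    unfolding open_contains_ball by blast
  have nz: "\<gamma> \<bullet> x \<noteq> 0" if "\<gamma> \<in> ?A" "x \<in> ball p \<delta>" for \<gamma> x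
    using \<delta>(2) that unfolding U_def by blast
  define S where "S x = (\<Sum>\<gamma>\<in>?A. c \<gamma> * inverse (of_real (\<gamma> \<bullet> x)) ^ 2) + Rt x" for x
  define V where "V = {x \<in> ball p \<delta>. 0 < \<alpha> \<bullet> x}"
  have ball_r: "ball p \<delta> \<subseteq> ball 0 r"
    using \<delta>(2) unfolding U_def by blast
  have smooth_Rt': "smooth_on (ball p \<delta>) Rt"
    by (rule smooth_on_subset[OF smooth_Rt ball_r])
  have smooth_S: "smooth_on (ball p \<delta>) S"
    unfolding S_def[abs_def]
    by (intro smooth_on_add smooth_on_sum smooth_on_cmult smooth_on_inverse_power open_ball smooth_Rt' nz)
  have VD: "V \<subseteq> D"
  proof
    fix x assume x: "x \<in> V"
    have "\<gamma> \<bullet> x \<noteq> 0" if "\<gamma> \<in> H" for \<gamma>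
    proof (cases "\<gamma> = \<alpha>")
      case True
      then show ?thesis using x by (simp add: V_def)
    next
      case False
      then show ?thesis
        using that in_H x by (intro nz) (auto simp: V_def)
    qed
    then show "x \<in> D"
      using x ball_r unfolding D_def V_def by blast
  qed
  interpret w: wall_model p \<alpha> \<beta> \<delta> \<kappa> "c \<alpha>" ?R S shifted_form V
  proof
    show "0 < \<delta>" "c \<alpha> \<noteq> 0" by fact+
    show "\<alpha> \<noteq> 0" using \<alpha>H(1) zero_notin_roots_B by blast
    show "\<alpha> \<bullet> p = 0" using gp by (simp add: generic_point_def)
    show "\<alpha> \<bullet> \<beta> = 0" "3 * \<kappa> \<noteq> 1" using wp by (simp_all add: wall_pair_def)
    show "(\<alpha> $ k) ^ 3 = \<alpha> $ k" "(\<beta> $ k) ^ 3 = \<beta> $ k"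
      "(\<alpha> $ k)\<^sup>2 * \<beta> $ k = \<kappa> * \<beta> $ k" "(\<beta> $ k)\<^sup>2 * \<alpha> $ k = \<kappa> * \<alpha> $ k" for k
      using wp by (simp_all add: wall_pair_def)
    show "V = {x \<in> ball p \<delta>. 0 < \<alpha> \<bullet> x}" by (rule V_def)
    show "smooth_on (ball p \<delta>) S" by (rule smooth_S)
    show "?R x = c \<alpha> * inverse (of_real (\<alpha> \<bullet> x)) ^ 2 + S x" for x
      unfolding potential_roots S_def sum.remove[OF finite_roots_B \<alpha>H(1)] by (simp only: add.assoc)
    show "smooth_on V ?R" by (rule smooth_on_subset[OF smooth_potential VD])
    show "smooth_on V (shifted_form u v)" for u v
      by (rule smooth_on_subset[OF smooth_shifted_form VD])
    show "shifted_form u v = shifted_form v u" for u v by (rule shifted_form_sym)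
    show "shifted_form u v x = (\<Sum>k\<in>UNIV. of_real (v $ k) * shifted_form u (axis k 1) x)" for u v x
      by (rule shifted_form_axis)
    fix u v w x assume "x \<in> V"
    then have x: "x \<in> D" using VD by blast
    show "dird u (shifted_form v w) x + dird v (shifted_form w u) x + dird w (shifted_form u v) x =
        3 * (\<Sum>k\<in>UNIV. of_real (u $ k * v $ k * w $ k) * partial k ?R x)"
      by (rule shifted_form_identity[OF x])
    show "dird v (\<lambda>x. \<Sum>k\<in>UNIV. shifted_form u (axis k 1) x * partial k ?R x) x =
        dird u (\<lambda>x. \<Sum>k\<in>UNIV. shifted_form v (axis k 1) x * partial k ?R x) x"
      by (rule shifted_form_curl_free[OF x])
  qed
  have diff: "Rt differentiable (at x)" "dird \<beta> Rt differentiable (at x)" if "x \<in> ball p \<delta>" for x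
    by (rule smooth_on_differentiable[OF smooth_Rt' open_ball that]
        smooth_on_differentiable[OF smooth_on_dird[OF open_ball smooth_Rt'] open_ball that])+
  have ds: "dird u (\<lambda>x. (\<Sum>\<gamma>\<in>?A. b \<gamma> * inverse (of_real (\<gamma> \<bullet> x)) ^ n) + f x) x
      = (\<Sum>\<gamma>\<in>?A. b \<gamma> * (- of_nat n * of_real (\<gamma> \<bullet> u) * inverse (of_real (\<gamma> \<bullet> x)) ^ Suc n)) + dird u f x"
    if x: "x \<in> ball p \<delta>" and f: "f differentiable (at x)" for x u b n and f :: "real ^ 'n::_ \<Rightarrow> complex"
  proof -
    have d: "(\<lambda>x. b \<gamma> * inverse (complex_of_real (\<gamma> \<bullet> x)) ^ n) differentiable (at x)" if "\<gamma> \<in> ?A" for \<gamma>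
      by (intro differentiable_mult differentiable_const dird_inverse_power(1) nz[OF that x])
    have "dird u (\<lambda>x. (\<Sum>\<gamma>\<in>?A. b \<gamma> * inverse (of_real (\<gamma> \<bullet> x)) ^ n) + f x) x
        = dird u (\<lambda>x. \<Sum>\<gamma>\<in>?A. b \<gamma> * inverse (of_real (\<gamma> \<bullet> x)) ^ n) x + dird u f x"
      by (rule dird_add[OF _ f]) (intro differentiable_sum finA ballI d)
    also have "dird u (\<lambda>x. \<Sum>\<gamma>\<in>?A. b \<gamma> * inverse (of_real (\<gamma> \<bullet> x)) ^ n) x
        = (\<Sum>\<gamma>\<in>?A. dird u (\<lambda>x. b \<gamma> * inverse (of_real (\<gamma> \<bullet> x)) ^ n) x)"
      by (rule dird_sum) (rule d)
    also have "\<dots> = (\<Sum>\<gamma>\<in>?A. b \<gamma> * (- of_nat n * of_real (\<gamma> \<bullet> u) * inverse (of_real (\<gamma> \<bullet> x)) ^ Suc n))"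
    proof (rule sum.cong[OF refl])
      fix \<gamma> assume "\<gamma> \<in> ?A"
      note e = dird_inverse_power[OF nz[OF this x]]
      show "dird u (\<lambda>x. b \<gamma> * inverse (of_real (\<gamma> \<bullet> x)) ^ n) x
          = b \<gamma> * (- of_nat n * of_real (\<gamma> \<bullet> u) * inverse (of_real (\<gamma> \<bullet> x)) ^ Suc n)"
        unfolding dird_cmult[OF e(1)] e(2) ..
    qed
    finally show ?thesis .
  qed
  have pb: "p \<in> ball p \<delta>" using \<delta>(1) by simp
  have 1: "dird \<beta> S x = (\<Sum>\<gamma>\<in>?A. (c \<gamma> * (- 2 * of_real (\<gamma> \<bullet> \<beta>))) * inverse (of_real (\<gamma> \<bullet> x)) ^ 3) + dird \<beta> Rt x"
    if "x \<in> ball p \<delta>" for x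
    unfolding S_def[abs_def] ds[OF that diff(1)[OF that]] by (simp add: eval_nat_numeral mult.assoc)
  have "dird \<alpha> (dird \<beta> S) p = dird \<alpha> (\<lambda>x. (\<Sum>\<gamma>\<in>?A. (c \<gamma> * (- 2 * of_real (\<gamma> \<bullet> \<beta>))) * inverse (of_real (\<gamma> \<bullet> x)) ^ 3) + dird \<beta> Rt x) p"
    by (rule dird_cong[OF open_ball pb]) (rule 1)
  also have "\<dots> = (\<Sum>\<gamma>\<in>?A. (c \<gamma> * (- 2 * of_real (\<gamma> \<bullet> \<beta>))) * (- of_nat 3 * of_real (\<gamma> \<bullet> \<alpha>) * inverse (of_real (\<gamma> \<bullet> p)) ^ Suc 3)) + dird \<alpha> (dird \<beta> Rt) p"
    by (rule ds[OF pb diff(2)[OF pb]])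
  also have "(\<Sum>\<gamma>\<in>?A. (c \<gamma> * (- 2 * of_real (\<gamma> \<bullet> \<beta>))) * (- of_nat 3 * of_real (\<gamma> \<bullet> \<alpha>) * inverse (of_real (\<gamma> \<bullet> p)) ^ Suc 3))
      = 6 * (\<Sum>\<gamma>\<in>?A. c \<gamma> * of_real (\<gamma> \<bullet> \<alpha>) * of_real (\<gamma> \<bullet> \<beta>) * inverse (of_real (\<gamma> \<bullet> p)) ^ 4)"
    unfolding sum_distrib_left by (intro sum.cong refl) (simp add: eval_nat_numeral)
  finally show ?thesis
    using w.mixed_derivative_zero by simp
qed

text \<open>Generic points are stable under positive scaling and Q is homogeneous of degree -4.
  Multiplying \<open>wall_identity\<close> at s p by s^4 keeps the term 6 Q(p), while the
  contribution of \<open>Rt\<close>, smooth at the origin, tends to 0 with s.\<close>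

lemma wall_relation:
  assumes wp: "wall_pair \<alpha> \<beta> \<kappa>" and gp: "generic_point \<alpha> p"
  shows "(\<Sum>\<gamma>\<in>roots_B. c \<gamma> * of_real (\<gamma> \<bullet> \<alpha>) * of_real (\<gamma> \<bullet> \<beta>) * inverse (of_real (\<gamma> \<bullet> p)) ^ 4) = 0"
proof -
  define Q where "Q p = (\<Sum>\<gamma>\<in>roots_B - {\<alpha>}. c \<gamma> * of_real (\<gamma> \<bullet> \<alpha>) * of_real (\<gamma> \<bullet> \<beta>) * inverse (of_real (\<gamma> \<bullet> p)) ^ 4)" for p
  define h where "h = dird \<alpha> (dird \<beta> Rt)"
  define e where "e = r / (norm p + 1)"
  have np: "norm p + 1 > 0" using norm_ge_zero[of p] by linarith
  have e: "e > 0" using r np by (simp add: e_def)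
  have Qs: "of_real s ^ 4 * Q (s *\<^sub>R p) = Q p" if "s > 0" for s
    unfolding Q_def sum_distrib_left
  proof (intro sum.cong refl)
    fix \<gamma> :: "real ^ 'n::_"
    have "complex_of_real s ^ 4 * inverse (of_real (\<gamma> \<bullet> s *\<^sub>R p)) ^ 4 = inverse (of_real (\<gamma> \<bullet> p)) ^ 4"
      using that by (simp add: power_inverse power_mult_distrib)
    then show "complex_of_real s ^ 4 * (c \<gamma> * of_real (\<gamma> \<bullet> \<alpha>) * of_real (\<gamma> \<bullet> \<beta>) * inverse (of_real (\<gamma> \<bullet> s *\<^sub>R p)) ^ 4)
        = c \<gamma> * of_real (\<gamma> \<bullet> \<alpha>) * of_real (\<gamma> \<bullet> \<beta>) * inverse (of_real (\<gamma> \<bullet> p)) ^ 4"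
      by (metis mult.left_commute)
  qed
  have main: "- (of_real s ^ 4 * h (s *\<^sub>R p)) = 6 * Q p" if "0 < s" "s < e" for s
  proof -
    have "generic_point \<alpha> (s *\<^sub>R p)"
      using gp that by (auto simp: generic_point_def)
    moreover have "s * norm p < r"
    proof -
      have "s * norm p \<le> s * (norm p + 1)"
        using that by (intro mult_left_mono) auto
      also have "\<dots> < r"
        using that np by (simp add: e_def field_simps)
      finally show ?thesis .
    qed
    then have "s *\<^sub>R p \<in> ball 0 r"
      using that by simp
    ultimately have "6 * Q (s *\<^sub>R p) + h (s *\<^sub>R p) = 0"
      unfolding Q_def h_def by (rule wall_identity[OF wp])
    then have "h (s *\<^sub>R p) = - (6 * Q (s *\<^sub>R p))"
      by (simp add: eq_neg_iff_add_eq_0 add.commute)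
    then show ?thesis
      using Qs[OF that(1)] by simp
  qed
  have "h differentiable (at 0)"
    unfolding h_def using r
    by (intro smooth_on_differentiable[OF smooth_on_dird[OF open_ball smooth_on_dird[OF open_ball smooth_Rt]] open_ball]) simp
  then have "isCont h 0"
    using differentiable_imp_continuous_within by blast
  moreover have "((\<lambda>s. s *\<^sub>R p) \<longlongrightarrow> 0 *\<^sub>R p) (at_right (0::real))"
    by (intro tendsto_intros)
  ultimately have "((\<lambda>s. h (s *\<^sub>R p)) \<longlongrightarrow> h 0) (at_right (0::real))"
    using isCont_tendsto_compose[of 0 h] by simp
  then have lim: "((\<lambda>s. - (of_real s ^ 4 * h (s *\<^sub>R p))) \<longlongrightarrow> - (of_real 0 ^ 4 * h 0)) (at_right (0::real))"
    by (intro tendsto_intros)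
  have "eventually (\<lambda>s. - (of_real s ^ 4 * h (s *\<^sub>R p)) = 6 * Q p) (at_right (0::real))"
    using e main by (auto simp: eventually_at_right_field intro!: exI[of _ e])
  then have "((\<lambda>s. - (of_real s ^ 4 * h (s *\<^sub>R p))) \<longlongrightarrow> 6 * Q p) (at_right (0::real))"
    by (rule tendsto_eventually)
  from tendsto_unique[OF trivial_limit_at_right_real this lim]
  have "6 * Q p = - (of_real 0 ^ 4 * h 0)" .
  then have "Q p = 0" by simp
  \<comment> \<open>The root \<alpha> may be put back into the sum, since its term contains the
    factor \<alpha> \<bullet> \<beta>.\<close>
  moreover have "\<alpha> \<in> roots_B" "\<alpha> \<bullet> \<beta> = 0"
    using wp in_H by (auto simp: wall_pair_def)
  ultimately show ?thesis
    unfolding sum.remove[OF finite_roots_B \<open>\<alpha> \<in> roots_B\<close>] by (simp add: Q_def)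
qed

end

lemma sum_eq_single:
  assumes "finite A" "i \<in> A" "\<And>j. j \<in> A \<Longrightarrow> j \<noteq> i \<Longrightarrow> F j = 0"
  shows "sum F A = F i"
proof -
  have "sum F A = F i + sum F (A - {i})"
    by (rule sum.remove[OF assms(1,2)])
  also have "sum F (A - {i}) = 0"
    by (rule sum.neutral) (use assms(3) in blast)
  finally show ?thesis by simp
qed

text \<open>Supplies pairwise distinct coordinates for points on a wall.\<close>

lemma exists_injective_index: "\<exists>f :: 'n::finite \<Rightarrow> nat. inj f"
  using finite_imp_inj_to_nat_seg[of "UNIV :: 'n set"] by auto

text \<open>The bases are s + 1 and s - 1 for s = 2 and s = 3. The ratios 81 and 16 of their fourth
  powers differ, so the two equations are independent.\<close>

lemma two_point_elimination:
  fixes X Y :: complex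
  assumes "X * of_real (inverse 3 ^ 4) - Y * of_real (inverse 1 ^ 4) = 0"
    and "X * of_real (inverse 4 ^ 4) - Y * of_real (inverse 2 ^ 4) = 0"
  shows "X = 0" "Y = 0"
proof -
  have 1: "X = 81 * Y"
    using assms(1) by (simp add: field_simps)
  have 2: "X = 16 * Y"
    using assms(2) by (simp add: field_simps)
  have "65 * Y = 81 * Y - 16 * Y" by simp
  also have "\<dots> = 0" using 1 2 by (metis diff_self)
  finally show "Y = 0" by simp
  then show "X = 0" using 1 by simp
qed

section \<open>Evaluation at test points\<close>

context root_setting
begin

abbreviation q :: "'n \<Rightarrow> real \<Rightarrow> 'n \<Rightarrow> complex" where
  "q \<equiv> pair_coefficient Cp Cm"

abbreviation pair_root :: "'n \<Rightarrow> real \<Rightarrow> 'n \<Rightarrow> real ^ 'n::_" where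
  "pair_root i \<tau> j \<equiv> axis i 1 + \<tau> *\<^sub>R axis j 1"

lemma pair_root_nth: "i \<noteq> j \<Longrightarrow> pair_root i \<tau> j $ k = (if k = i then 1 else if k = j then \<tau> else 0)"
  by (simp add: axis_def)

lemma axis_nth: "axis i 1 $ k = (if k = i then 1 else (0 :: real))"
  by (simp add: axis_def)

lemma pair_root_in_roots:
  assumes "i < j" "\<tau> \<in> {1, - 1}"
  shows "pair_root i \<tau> j \<in> roots_B"
  using assms unfolding roots_B_def roots_D_def by auto

lemma coefficient_pair_root:
  assumes "i < j" "\<tau> \<in> {1, - 1}"
  shows "c (pair_root i \<tau> j) = q i \<tau> j"
  using assms by (auto simp: coefficient_plus coefficient_minus pair_coefficient_def)

lemma coordinate_relation:
  assumes "wall_pair \<alpha> \<beta> \<kappa>" "generic_point \<alpha> p"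
  shows "(\<Sum>i\<in>UNIV. of_real (\<beta> $ i) *
      ((\<Sum>j\<in>UNIV - {i}. \<Sum>\<sigma>\<in>{1, - 1}. q i \<sigma> j * of_real ((\<alpha> $ i + \<sigma> * \<alpha> $ j) * inverse (p $ i + \<sigma> * p $ j) ^ 4))
        + C1 i * of_real (\<alpha> $ i * inverse (p $ i) ^ 4))) = 0"
  using wall_relation[OF assms] unfolding roots_sum_coordinates .

text \<open>The wall of e_i with \<beta> = e_m: among the roots, e_m + e_i and e_m - e_i up to sign
  are the ones not orthogonal to either vector. Their terms have opposite signs and, as p vanishes
  at i, equal denominators.\<close>

lemma axis_relation:
  assumes i: "C1 i \<noteq> 0" and m: "m \<noteq> i"
  shows "q m 1 i = q m (- 1) i"
proof -
  obtain f :: "'n \<Rightarrow> nat" where f: "inj f"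
    using exists_injective_index by blast
  \<comment> \<open>Apart from the zero at i the coordinates are positive and pairwise distinct,
    which keeps p off every other root hyperplane.\<close>
  define p :: "real ^ 'n::_" where "p = (\<chi> k. if k = i then 0 else 1 + real (f k))"
  have pn: "p $ k = (if k = i then 0 else 1 + real (f k))" for k
    by (simp add: p_def)
  have wp: "wall_pair (axis i 1) (axis m 1) 0"
    using i m unfolding wall_pair_def in_H roots_B_def
    by (auto simp: coefficient_axis inner_axis_left axis_nth)
  have "generic_point (axis i 1) p"
    unfolding generic_point_def
  proof (intro conjI ballI)
    show "axis i 1 \<bullet> p = 0" by (simp add: inner_axis_left pn)
    fix \<gamma> :: "real ^ 'n::_" assume "\<gamma> \<in> roots_B - {axis i 1}"
    then have \<gamma>: "\<gamma> \<in> roots_B" "\<gamma> \<noteq> axis i 1" by auto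
    from \<gamma>(1) show "\<gamma> \<bullet> p \<noteq> 0"
    proof (cases rule: roots_B_cases)
      case (1 k l)
      then have "p $ k + p $ l > 0" by (auto simp: pn)
      then show ?thesis using 1 by (simp add: inner_add_left inner_axis_left)
    next
      case (2 k l)
      then have "p $ k \<noteq> p $ l" using injD[OF f, of k l] by (auto simp: pn)
      then show ?thesis using 2 by (simp add: inner_diff_left inner_axis_left)
    next
      case (3 k)
      then show ?thesis using \<gamma>(2) by (auto simp: inner_axis_left pn)
    qed
  qed
  from coordinate_relation[OF wp this]
  have "(\<Sum>j\<in>UNIV - {m}. \<Sum>\<sigma>\<in>{1, - 1}. q m \<sigma> j * of_real ((axis i 1 $ m + \<sigma> * axis i 1 $ j) * inverse (p $ m + \<sigma> * p $ j) ^ 4))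
        + C1 m * of_real (axis i 1 $ m * inverse (p $ m) ^ 4) = 0"
    unfolding axis_sum .
  moreover have "(\<Sum>j\<in>UNIV - {m}. \<Sum>\<sigma>\<in>{1, - 1}. q m \<sigma> j * of_real ((axis i 1 $ m + \<sigma> * axis i 1 $ j) * inverse (p $ m + \<sigma> * p $ j) ^ 4))
      = (\<Sum>\<sigma>\<in>{1, - 1}. q m \<sigma> i * of_real ((axis i 1 $ m + \<sigma> * axis i 1 $ i) * inverse (p $ m + \<sigma> * p $ i) ^ 4))"
    by (rule sum_eq_single) (use m in \<open>auto simp: axis_nth\<close>)
  moreover have "axis i 1 $ m = (0 :: real)" "axis i 1 $ i = (1 :: real)" "p $ i = 0"
    using m by (simp_all add: axis_nth pn)
  ultimately have "(\<Sum>\<sigma>\<in>{1, - 1}. q m \<sigma> i * of_real ((0 + \<sigma> * 1) * inverse (p $ m + \<sigma> * 0) ^ 4)) + C1 m * of_real (0 * inverse (p $ m) ^ 4) = 0"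
    by (simp only:)
  then have "(q m 1 i - q m (- 1) i) * of_real (inverse (p $ m) ^ 4) = 0"
    by (simp add: left_diff_distrib)
  moreover have "p $ m \<noteq> 0" using m by (simp add: pn)
  ultimately show ?thesis by simp
qed

text \<open>A point on the wall of the root with entries \<open>1\<close> at \<open>i\<close> and \<open>\<tau>\<close> at \<open>j\<close>.  Its only free coordinate
  is the one at \<open>m\<close>; the offset \<open>10\<close> keeps the other coordinates away from those in use.\<close>

definition test_point :: "('n \<Rightarrow> nat) \<Rightarrow> 'n \<Rightarrow> 'n \<Rightarrow> real \<Rightarrow> 'n \<Rightarrow> real \<Rightarrow> real ^ 'n::_" where
  "test_point f i j \<tau> m s = (\<chi> k. if k = i then 1 else if k = j then - \<tau> else if k = m then s else 10 + real (f k))"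

lemma test_point_nth:
  "test_point f i j \<tau> m s $ k = (if k = i then 1 else if k = j then - \<tau> else if k = m then s else 10 + real (f k))"
  by (simp add: test_point_def)

text \<open>Only the coordinates at i and j share an absolute value, and the other root supported on
  them takes the value 2. The bounds on s separate a free coordinate at m from 1 and from the
  entries that are at least 10.\<close>

lemma generic_test_point:
  assumes f: "inj f" and ij: "i < j" and \<tau>: "\<tau> \<in> {1, - 1}" and s: "1 < s" "s < 10"
  shows "generic_point (pair_root i \<tau> j) (test_point f i j \<tau> m s)"
  unfolding generic_point_def
proof (intro conjI ballI)
  let ?p = "test_point f i j \<tau> m s"
  have \<tau>2: "\<tau> * \<tau> = 1" using \<tau> by auto
  show "pair_root i \<tau> j \<bullet> ?p = 0"
    using ij \<tau>2 by (simp add: inner_add_left inner_axis_left test_point_nth)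
  have ne: "\<bar>?p $ k\<bar> \<noteq> \<bar>?p $ l\<bar>" if "k < l" "(k, l) \<noteq> (i, j)" for k l
  proof -
    have "k \<noteq> l" "\<not> (k = j \<and> l = i)" using that ij by auto
    moreover have "f k \<noteq> f l" using \<open>k \<noteq> l\<close> f by (simp add: inj_eq)
    ultimately show ?thesis
      using that(2) s \<tau> by (auto simp: test_point_nth)
  qed
  fix \<gamma> :: "real ^ 'n::_" assume "\<gamma> \<in> roots_B - {pair_root i \<tau> j}"
  then have \<gamma>: "\<gamma> \<in> roots_B" "\<gamma> \<noteq> pair_root i \<tau> j" by auto
  from \<gamma>(1) show "\<gamma> \<bullet> ?p \<noteq> 0"
  proof (cases rule: roots_B_cases)
    case (1 k l)
    show ?thesis
    proof (cases "(k, l) = (i, j)")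
      case True
      then have "\<tau> = - 1" using \<tau> \<gamma>(2) 1 by auto
      then show ?thesis
        using True 1 by (simp add: inner_add_left inner_axis_left test_point_nth)
    next
      case False
      then show ?thesis
        using ne[OF 1(1) False] 1 by (auto simp: inner_add_left inner_axis_left)
    qed
  next
    case (2 k l)
    show ?thesis
    proof (cases "(k, l) = (i, j)")
      case True
      then have "\<tau> = 1" using \<tau> \<gamma>(2) 2 by auto
      then show ?thesis
        using True 2 by (simp add: inner_diff_left inner_axis_left test_point_nth)
    next
      case False
      then show ?thesis
        using ne[OF 2(1) False] 2 by (auto simp: inner_diff_left inner_axis_left)
    qed
  next
    case (3 k)
    then show ?thesis
      using s \<tau> by (auto simp: inner_axis_left test_point_nth)
  qed
qed

text \<open>With \<beta> = e_m only the roots joining m to i or j contribute. Since the point has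
  entries 1 and - \<tau> there, their denominators are (s + 1)^4 and (s - 1)^4, and two values of s
  separate the coefficients. The equality relates e_m + \<sigma> e_i to its image e_m - \<sigma>
  \<tau> e_j under the reflection.\<close>

lemma pair_relation_ordered:
  assumes ij: "i < j" and \<tau>: "\<tau> \<in> {1, - 1}" and nz: "q i \<tau> j \<noteq> 0" and m: "m \<noteq> i" "m \<noteq> j"
    and \<sigma>: "\<sigma> \<in> {1, - 1}"
  shows "q m \<sigma> i = q m (- \<sigma> * \<tau>) j"
proof -
  obtain f :: "'n \<Rightarrow> nat" where f: "inj f"
    using exists_injective_index by blast
  let ?\<alpha> = "pair_root i \<tau> j"
  have ne: "i \<noteq> j" using ij by simp
  note an = pair_root_nth[OF ne]
  have wp: "wall_pair ?\<alpha> (axis m 1) 0"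
    unfolding wall_pair_def in_H coefficient_pair_root[OF ij \<tau>] an
    using nz m \<tau> pair_root_in_roots[OF ij \<tau>] by (auto simp: axis_nth inner_axis an)
  have eq: "(q m 1 i - q m (- \<tau>) j) * of_real (inverse (s + 1) ^ 4) - (q m (- 1) i - q m \<tau> j) * of_real (inverse (s - 1) ^ 4) = 0"
    if s: "1 < s" "s < 10" for s
  proof -
    let ?p = "test_point f i j \<tau> m s"
    have pm: "?p $ m = s" "?p $ i = 1" "?p $ j = - \<tau>"
      using m ne by (simp_all add: test_point_nth)
    define F where "F l = (\<Sum>\<sigma>\<in>{1, - 1}. q m \<sigma> l * of_real ((?\<alpha> $ m + \<sigma> * ?\<alpha> $ l) * inverse (?p $ m + \<sigma> * ?p $ l) ^ 4))" for l
    from coordinate_relation[OF wp generic_test_point[OF f ij \<tau> s, of m]]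
    have F0: "(\<Sum>l\<in>UNIV - {m}. F l) + C1 m * of_real (?\<alpha> $ m * inverse (?p $ m) ^ 4) = 0"
      unfolding axis_sum F_def .
    have "?\<alpha> $ m = 0" using m by (simp only: an if_False)
    with F0 have "(\<Sum>l\<in>UNIV - {m}. F l) + C1 m * of_real (0 * inverse (?p $ m) ^ 4) = 0"
      by (simp only:)
    moreover have "(\<Sum>l\<in>UNIV - {m}. F l) = F i + (\<Sum>l\<in>UNIV - {m} - {i}. F l)"
      by (rule sum.remove) (use m in auto)
    moreover have "(\<Sum>l\<in>UNIV - {m} - {i}. F l) = F j"
    proof (rule sum_eq_single)
      fix l assume "l \<in> UNIV - {m} - {i}" "l \<noteq> j"
      then have "?\<alpha> $ l = 0" by (simp only: an) simp
      then show "F l = 0" unfolding F_def \<open>?\<alpha> $ m = 0\<close> by simp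
    qed (use m ne in auto)
    ultimately have "F i + F j = 0" by simp
    moreover have "F i = q m 1 i * of_real (inverse (s + 1) ^ 4) - q m (- 1) i * of_real (inverse (s - 1) ^ 4)"
      unfolding F_def \<open>?\<alpha> $ m = 0\<close> pm an using ne m by simp
    moreover have "F j = q m \<tau> j * of_real (inverse (s - 1) ^ 4) - q m (- \<tau>) j * of_real (inverse (s + 1) ^ 4)"
      unfolding F_def \<open>?\<alpha> $ m = 0\<close> pm an using ne m \<tau> by auto
    ultimately show ?thesis by (simp add: algebra_simps)
  qed
  have "q m 1 i - q m (- \<tau>) j = 0" "q m (- 1) i - q m \<tau> j = 0"
    by (rule two_point_elimination; use eq[of 2] eq[of 3] in simp)+
  then show ?thesis using \<sigma> by auto
qed

text \<open>Here \<beta> is the orthogonal root of the same support, so \<kappa> = 1. Roots joining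
  i or j to a third index cancel by \<open>pair_relation_ordered\<close>; as the entries of the
  point at i and j have absolute value 1, the axis terms leave \<open>C1 i - C1 j\<close>.\<close>

lemma axis_pair_relation_ordered:
  assumes ij: "i < j" and \<tau>: "\<tau> \<in> {1, - 1}" and nz: "q i \<tau> j \<noteq> 0"
  shows "C1 i = C1 j"
proof -
  obtain f :: "'n \<Rightarrow> nat" where f: "inj f"
    using exists_injective_index by blast
  let ?\<alpha> = "pair_root i \<tau> j" and ?\<beta> = "pair_root i (- \<tau>) j"
  have ne: "i \<noteq> j" using ij by simp
  note an = pair_root_nth[OF ne]
  have \<tau>2: "\<tau> * \<tau> = 1" using \<tau> by auto
  have wp: "wall_pair ?\<alpha> ?\<beta> 1"
    unfolding wall_pair_def in_H coefficient_pair_root[OF ij \<tau>] an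
    using nz \<tau> ne pair_root_in_roots[OF ij \<tau>]
    by (auto simp: inner_add_left inner_add_right inner_axis_left axis_nth)
  \<comment> \<open>With m = i the free coordinate is overridden by the entry 1, so any admissible
    value would do in place of 2.\<close>
  let ?p = "test_point f i j \<tau> i 2"
  have pn: "?p $ i = 1" "?p $ j = - \<tau>"
    using ne by (simp_all add: test_point_nth)
  define F where "F k l = (\<Sum>\<sigma>\<in>{1, - 1}. q k \<sigma> l * of_real ((?\<alpha> $ k + \<sigma> * ?\<alpha> $ l) * inverse (?p $ k + \<sigma> * ?p $ l) ^ 4))" for k l
  define G where "G k = (\<Sum>l\<in>UNIV - {k}. F k l) + C1 k * of_real (?\<alpha> $ k * inverse (?p $ k) ^ 4)" for k
  have "(\<Sum>k\<in>UNIV. of_real (?\<beta> $ k) * G k) = 0"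
    unfolding G_def F_def
    by (rule coordinate_relation[OF wp generic_test_point[OF f ij \<tau>]]) simp_all
  moreover have "(\<Sum>k\<in>UNIV. of_real (?\<beta> $ k) * G k) = of_real (?\<beta> $ i) * G i + (\<Sum>k\<in>UNIV - {i}. of_real (?\<beta> $ k) * G k)"
    by (rule sum.remove) auto
  moreover have "(\<Sum>k\<in>UNIV - {i}. of_real (?\<beta> $ k) * G k) = of_real (?\<beta> $ j) * G j"
    by (rule sum_eq_single) (use ne in \<open>auto simp: axis_nth\<close>)
  ultimately have "of_real (?\<beta> $ i) * G i + of_real (?\<beta> $ j) * G j = 0"
    by (simp only:)
  moreover have "?\<beta> $ i = 1" "?\<beta> $ j = - \<tau>"
    using ne by (simp_all add: axis_nth)
  ultimately have "of_real 1 * G i + of_real (- \<tau>) * G j = 0"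
    by (simp only:)
  then have 0: "G i - of_real \<tau> * G j = 0"
    by simp
  \<comment> \<open>For \<sigma> = \<tau> the denominator is 0 and its inverse is 0 by convention;
    for \<sigma> = - \<tau> the factor coming from \<alpha> is 0.\<close>
  have Fij: "F i j = 0" "F j i = 0"
    unfolding F_def pn an using ne \<tau> by auto
  have Gi: "G i = (\<Sum>l\<in>UNIV - {i} - {j}. F i l) + C1 i"
  proof -
    have "(\<Sum>l\<in>UNIV - {i}. F i l) = F i j + (\<Sum>l\<in>UNIV - {i} - {j}. F i l)"
      by (rule sum.remove) (use ne in auto)
    then show ?thesis unfolding G_def Fij pn an by simp
  qed
  have Gj: "of_real \<tau> * G j = (\<Sum>l\<in>UNIV - {i} - {j}. of_real \<tau> * F j l) + C1 j"
  proof -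
    have "(\<Sum>l\<in>UNIV - {j}. F j l) = F j i + (\<Sum>l\<in>UNIV - {j} - {i}. F j l)"
      by (rule sum.remove) (use ne in auto)
    moreover have "UNIV - {j} - {i} = UNIV - {i} - {j}" by blast
    moreover have "of_real \<tau> * (C1 j * of_real (?\<alpha> $ j * inverse (?p $ j) ^ 4)) = C1 j"
      unfolding pn an using ne \<tau> by auto
    ultimately show ?thesis
      unfolding G_def Fij distrib_left by (simp add: sum_distrib_left)
  qed
  have "F i l = of_real \<tau> * F j l" if "l \<in> UNIV - {i} - {j}" for l
  proof -
    have l: "l \<noteq> i" "l \<noteq> j" using that by auto
    have qs: "q i \<sigma> l = q j (- \<sigma> * \<tau>) l" if "\<sigma> \<in> {1, - 1}" for \<sigma>
      using pair_relation_ordered[OF ij \<tau> nz l that] by (simp only: pair_coefficient_sym[of Cp Cm _ _ l])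
    have al: "?\<alpha> $ l = 0" "?\<alpha> $ i = 1" "?\<alpha> $ j = \<tau>" using l ne by (simp_all add: axis_nth)
    have sq: "inverse (- 1 - x) ^ 4 = inverse (1 + x) ^ 4" "inverse (- 1 + x) ^ 4 = inverse (1 - x) ^ 4"
      "inverse (x - 1) ^ 4 = inverse (1 - x) ^ 4" for x :: real
    proof -
      have "(- 1 - x) ^ 4 = (1 + x) ^ 4" "(- 1 + x) ^ 4 = (1 - x) ^ 4" "(x - 1) ^ 4 = (1 - x) ^ 4"
        by (simp_all add: power4_eq_xxxx algebra_simps)
      then show "inverse (- 1 - x) ^ 4 = inverse (1 + x) ^ 4" "inverse (- 1 + x) ^ 4 = inverse (1 - x) ^ 4"
        "inverse (x - 1) ^ 4 = inverse (1 - x) ^ 4"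
        by (simp_all only: power_inverse)
    qed
    define x where "x = ?p $ l"
    have Fi: "F i l = q j (- \<tau>) l * of_real (inverse (1 + x) ^ 4) + q j \<tau> l * of_real (inverse (1 - x) ^ 4)"
      unfolding F_def al pn x_def[symmetric] using qs[of 1] qs[of "- 1"] by simp
    have Fj: "F j l = q j 1 l * of_real (\<tau> * inverse (- \<tau> + x) ^ 4) + q j (- 1) l * of_real (\<tau> * inverse (- \<tau> - x) ^ 4)"
      unfolding F_def al pn x_def[symmetric] by (simp add: minus_diff_commute)
    from \<tau> consider "\<tau> = 1" | "\<tau> = - 1" by blast
    then show ?thesis
    proof cases
      case 1
      show ?thesis unfolding Fi Fj 1 sq by (simp add: sq)
    next
      case 2
      show ?thesis unfolding Fi Fj 2 by (simp add: algebra_simps)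
    qed
  qed
  then have "(\<Sum>l\<in>UNIV - {i} - {j}. F i l) = (\<Sum>l\<in>UNIV - {i} - {j}. of_real \<tau> * F j l)"
    by (rule sum.cong[OF refl])
  then show ?thesis
    using 0 unfolding Gi Gj by simp
qed

end

section \<open>Invariance under the reflection group\<close>

lemma reflection_involution: "reflection \<alpha> (reflection \<alpha> x) = x"
  by (cases "\<alpha> = 0") (auto simp: reflection_def inner_diff_right)

lemma reflection_add: "reflection \<alpha> (x + y) = reflection \<alpha> x + reflection \<alpha> y"
  by (simp add: reflection_def inner_add_right algebra_simps add_divide_distrib)

lemma reflection_scaleR: "reflection \<alpha> (s *\<^sub>R x) = s *\<^sub>R reflection \<alpha> x"
  by (simp add: reflection_def algebra_simps)

lemma reflection_axis:
  "reflection (axis i 1) (axis a 1) = (if a = i then - axis i 1 else axis a (1::real))"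
  by (auto simp: reflection_def inner_axis_axis vec_eq_iff)

lemma reflection_pair:
  assumes "i \<noteq> j" "\<tau> \<in> {1, - 1}"
  shows "reflection (axis i 1 + \<tau> *\<^sub>R axis j 1) (axis a 1) =
    (if a = i then (- \<tau>) *\<^sub>R axis j 1 else if a = j then (- \<tau>) *\<^sub>R axis i 1 else axis a (1::real))"
proof -
  have "(axis i 1 + \<tau> *\<^sub>R axis j 1) \<bullet> (axis i 1 + \<tau> *\<^sub>R axis j (1::real)) = 2"
    using assms by (auto simp: inner_add_left inner_add_right inner_axis_axis)
  moreover have "(axis i 1 + \<tau> *\<^sub>R axis j 1) \<bullet> axis a (1::real) = (if a = i then 1 else if a = j then \<tau> else 0)"
    using assms(1) by (simp add: inner_add_left inner_axis_axis)
  ultimately show ?thesis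
    using assms by (auto simp: reflection_def algebra_simps)
qed

lemma reflection_in_group: "\<delta> \<in> A \<Longrightarrow> reflection \<delta> \<in> reflection_group A"
  unfolding reflection_group_def by (rule generate.incl) simp

text \<open>Induction over \<open>generate\<close>. Membership in \<open>Bij UNIV\<close> is carried
  along because the group product is composition only on the carrier.\<close>

lemma reflection_group_invariant:
  fixes A :: "'a::real_inner set"
  assumes "\<And>\<alpha> x. \<alpha> \<in> A \<Longrightarrow> k (reflection \<alpha> x) = k x" and "w \<in> reflection_group A"
  shows "k (w x) = k x"
proof -
  have "w \<in> Bij UNIV \<and> (\<forall>x. k (w x) = k x)"
    using assms(2) unfolding reflection_group_def
  proof (induction rule: generate.induct)
    case one
    have "(\<lambda>a. a) \<in> Bij (UNIV :: 'a set)"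
      by (auto simp: Bij_def extensional_def bij_betw_def)
    then show ?case
      by (simp add: BijGroup_def)
  next
    case (incl h)
    then show ?case
      using assms(1) reflection_in_BijGroup by (auto simp: BijGroup_def)
  next
    case (inv h)
    then obtain \<alpha> where \<alpha>: "\<alpha> \<in> A" "h = reflection \<alpha>" by blast
    have h: "h \<in> Bij UNIV"
      using reflection_in_BijGroup[of \<alpha>] \<alpha> by (simp add: BijGroup_def)
    have surj: "surj h"
      unfolding surj_def
    proof
      show "\<exists>y. x = h y" for x
        by (rule exI[of _ "h x"]) (simp add: \<alpha>(2) reflection_involution)
    qed
    have "k (inv_into UNIV h x) = k x" for x
      using assms(1)[OF \<alpha>(1), of "inv_into UNIV h x"] surj_f_inv_f[OF surj, of x] by (simp add: \<alpha>(2))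
    moreover have "inv\<^bsub>BijGroup UNIV\<^esub> h = inv_into UNIV h"
      using inv_BijGroup[OF h] by (simp add: restrict_def)
    moreover have "inv_into UNIV h \<in> Bij UNIV"
      using restrict_inv_into_Bij[OF h] by (simp add: restrict_def)
    ultimately show ?case by simp
  next
    case (eng h1 h2)
    have h: "h1 \<in> Bij UNIV" "h2 \<in> Bij UNIV" "\<And>x. k (h1 x) = k x" "\<And>x. k (h2 x) = k x"
      using eng.IH by blast+
    have "h1 \<otimes>\<^bsub>BijGroup UNIV\<^esub> h2 = compose UNIV h1 h2"
      using h(1,2) by (simp add: BijGroup_def)
    moreover have "compose UNIV h1 h2 \<in> Bij UNIV"
      by (rule compose_Bij[OF h(1,2)])
    moreover have "k (compose UNIV h1 h2 x) = k x" for x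
      using h(3,4) by (simp add: compose_def)
    ultimately show ?case by simp
  qed
  then show ?thesis by blast
qed

context root_setting
begin

text \<open>Only one of \<open>\<gamma>\<close> and \<open>- \<gamma>\<close> is a positive root and \<open>c\<close> vanishes elsewhere, so this is the
  coefficient of a root irrespective of its sign.\<close>

definition k :: "real ^ 'n::_ \<Rightarrow> complex" where
  "k \<gamma> = c \<gamma> + c (- \<gamma>)"

lemma k_minus: "k (- \<gamma>) = k \<gamma>"
  by (simp add: k_def)

lemma k_root:
  assumes "\<gamma> \<in> roots_B"
  shows "k \<gamma> = c \<gamma>"
  by (simp add: k_def coefficient_outside[OF uminus_roots_B[OF assms]])

lemma k_axis:
  assumes "s \<in> {1, - 1}"
  shows "k (s *\<^sub>R axis a 1) = C1 a"
proof -
  have "k (axis a 1) = C1 a"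
    by (subst k_root) (auto simp: roots_B_def coefficient_axis)
  then show ?thesis
    using assms k_minus[of "axis a 1"] by auto
qed

text \<open>Pulling out the sign s leaves a \<open>pair_root\<close> with sign s t, and k is even;
  for b < a the two summands change roles.\<close>

lemma k_pair:
  assumes "a \<noteq> b" "s \<in> {1, - 1}" "t \<in> {1, - 1}"
  shows "k (s *\<^sub>R axis a 1 + t *\<^sub>R axis b 1) = q a (s * t) b"
proof -
  have *: "k (s *\<^sub>R axis a 1 + t *\<^sub>R axis b 1) = q a (s * t) b"
    if "a < b" "s \<in> {1, - 1}" "t \<in> {1, - 1}" for a b s t
  proof -
    have 1: "k (pair_root a (s * t) b) = q a (s * t) b"
      using that by (subst k_root[OF pair_root_in_roots]) (auto intro: coefficient_pair_root[simplified])
    have "s *\<^sub>R axis a 1 + t *\<^sub>R axis b 1 = s *\<^sub>R pair_root a (s * t) b"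
      using that by auto
    moreover have "k (s *\<^sub>R \<gamma>) = k \<gamma>" for \<gamma>
      using that(2) k_minus[of \<gamma>] by auto
    ultimately show ?thesis
      using 1 by simp
  qed
  show ?thesis
  proof (cases "a < b")
    case True
    then show ?thesis by (rule *[OF _ assms(2,3)])
  next
    case False
    then have "b < a" using assms(1) by simp
    from *[OF this assms(3,2)] show ?thesis
      by (simp add: add.commute mult.commute pair_coefficient_sym[of Cp Cm a])
  qed
qed

lemma k_nonzero_cases:
  assumes "k \<gamma> \<noteq> 0"
  obtains (single) a s where "s \<in> {1, - 1 :: real}" "\<gamma> = s *\<^sub>R axis a 1"
    | (pair) a b s t where "a \<noteq> b" "s \<in> {1, - 1 :: real}" "t \<in> {1, - 1 :: real}" "\<gamma> = s *\<^sub>R axis a 1 + t *\<^sub>R axis b 1"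
proof -
  have "\<exists>s \<delta>. s \<in> {1, - 1 :: real} \<and> \<delta> \<in> roots_B \<and> \<gamma> = s *\<^sub>R \<delta>"
  proof (cases "\<gamma> \<in> roots_B")
    case True
    then show ?thesis by (intro exI[of _ 1] exI[of _ \<gamma>]) simp
  next
    case False
    then have "- \<gamma> \<in> roots_B"
      using assms coefficient_outside[of \<gamma> Cp Cm C1] coefficient_outside[of "- \<gamma>" Cp Cm C1] by (auto simp: k_def)
    then show ?thesis by (intro exI[of _ "- 1"] exI[of _ "- \<gamma>"]) simp
  qed
  then obtain s \<delta> where s: "s \<in> {1, - 1 :: real}" "\<delta> \<in> roots_B" "\<gamma> = s *\<^sub>R \<delta>" by blast
  from s(2) show thesis
  proof (cases rule: roots_B_cases)
    case (1 i j)
    show thesis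
      by (rule pair[of i j s s]) (use 1 s in \<open>auto simp: scaleR_add_right\<close>)
  next
    case (2 i j)
    show thesis
      by (rule pair[of i j s "- s"]) (use 2 s in \<open>auto simp: scaleR_diff_right\<close>)
  next
    case (3 i)
    show thesis
      by (rule single[of s i]) (use 3 s in auto)
  qed
qed

text \<open>For j < i the ordered relation is read backwards: the map from \<sigma> to - \<sigma>
  \<tau> is an involution, as \<tau>^2 = 1, so the same equality results.\<close>

lemma pair_relation:
  assumes ij: "i \<noteq> j" and \<tau>: "\<tau> \<in> {1, - 1}" and nz: "q i \<tau> j \<noteq> 0" and m: "m \<noteq> i" "m \<noteq> j"
    and \<sigma>: "\<sigma> \<in> {1, - 1}"
  shows "q m \<sigma> i = q m (- \<sigma> * \<tau>) j"
proof (cases "i < j")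
  case True
  then show ?thesis by (rule pair_relation_ordered[OF _ \<tau> nz m \<sigma>])
next
  case False
  then have "j < i" using ij by simp
  moreover have "q j \<tau> i \<noteq> 0" using nz by (simp add: pair_coefficient_sym[of Cp Cm j])
  moreover have "- \<sigma> * \<tau> \<in> {1, - 1}" using \<sigma> \<tau> by auto
  ultimately have "q m (- \<sigma> * \<tau>) j = q m (- (- \<sigma> * \<tau>) * \<tau>) i"
    by (intro pair_relation_ordered \<tau> m)
  moreover have "- (- \<sigma> * \<tau>) * \<tau> = \<sigma>" using \<tau> by auto
  ultimately show ?thesis by (simp only:)
qed

lemma axis_pair_relation:
  assumes ij: "i \<noteq> j" and \<tau>: "\<tau> \<in> {1, - 1}" and nz: "q i \<tau> j \<noteq> 0"
  shows "C1 i = C1 j"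
proof (cases "i < j")
  case True
  then show ?thesis by (rule axis_pair_relation_ordered[OF _ \<tau> nz])
next
  case False
  then have "j < i" using ij by simp
  then show ?thesis
    using axis_pair_relation_ordered[OF _ \<tau>, of j i] nz by (simp add: pair_coefficient_sym[of Cp Cm j])
qed

lemma H_cases:
  assumes "\<alpha> \<in> H"
  obtains (single) i where "\<alpha> = axis i 1" "C1 i \<noteq> 0"
    | (pair) i j \<tau> where "i < j" "\<tau> \<in> {1, - 1}" "\<alpha> = pair_root i \<tau> j" "q i \<tau> j \<noteq> 0"
proof -
  have \<alpha>: "\<alpha> \<in> roots_B" "c \<alpha> \<noteq> 0" using assms in_H by blast+
  from \<alpha>(1) show thesis
  proof (cases rule: roots_B_cases)
    case (1 i j)
    show thesis
      by (rule pair[of i j 1]) (use 1 \<alpha>(2) coefficient_pair_root[of i j 1] in auto)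
  next
    case (2 i j)
    show thesis
      by (rule pair[of i j "- 1"]) (use 2 \<alpha>(2) coefficient_pair_root[of i j "- 1"] in auto)
  next
    case (3 i)
    show thesis
      by (rule single[of i]) (use 3 \<alpha>(2) in \<open>auto simp: coefficient_axis\<close>)
  qed
qed

text \<open>A vector with non-zero k is a type B root up to sign, and each reflection permutes the
  axis vectors up to sign. What has to be checked is then one of \<open>axis_relation\<close>,
  \<open>pair_relation\<close> and \<open>axis_pair_relation\<close>, or the symmetry of
  \<open>pair_coefficient\<close>.\<close>

lemma k_reflection_nonzero:
  assumes "\<alpha> \<in> H" "k \<gamma> \<noteq> 0"
  shows "k (reflection \<alpha> \<gamma>) = k \<gamma>"
  using assms(1)
proof (cases rule: H_cases)
  case (single i)
  have flip: "q a (- \<sigma>) i = q a \<sigma> i" if "a \<noteq> i" "\<sigma> \<in> {1, - 1}" for a \<sigma>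
    using axis_relation[OF single(2) that(1)] that(2) by auto
  from assms(2) show ?thesis
  proof (cases rule: k_nonzero_cases)
    case (single a s)
    have "reflection \<alpha> \<gamma> = (if a = i then - s else s) *\<^sub>R axis a 1"
      unfolding \<open>\<alpha> = _\<close> single reflection_scaleR reflection_axis by simp
    then show ?thesis
      using single k_axis[of s a] k_axis[of "- s" a] by auto
  next
    case (pair a b s t)
    have r: "reflection \<alpha> \<gamma> = (if a = i then - s else s) *\<^sub>R axis a 1 + (if b = i then - t else t) *\<^sub>R axis b 1"
      unfolding \<open>\<alpha> = _\<close> pair reflection_add reflection_scaleR reflection_axis by simp
    have "k (reflection \<alpha> \<gamma>) = q a ((if a = i then - s else s) * (if b = i then - t else t)) b"
      unfolding r using pair by (intro k_pair) auto
    moreover have "k \<gamma> = q a (s * t) b"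
      unfolding pair by (rule k_pair[OF pair(1-3)])
    moreover have "s * t \<in> {1, - 1}" using pair by auto
    ultimately show ?thesis
      using flip[of a "s * t"] flip[of b "s * t"] pair(1) pair_coefficient_sym[of Cp Cm a _ b] by auto
  qed
next
  case (pair i j \<tau>)
  have ij: "i \<noteq> j" using pair(1) by simp
  note \<tau> = pair(2)
  have rel: "q m \<sigma> i = q m (- \<sigma> * \<tau>) j" "q m \<sigma> j = q m (- \<sigma> * \<tau>) i" if "m \<noteq> i" "m \<noteq> j" "\<sigma> \<in> {1, - 1}" for m \<sigma>
  proof -
    show "q m \<sigma> i = q m (- \<sigma> * \<tau>) j"
      by (rule pair_relation[OF ij \<tau> pair(4) that])
    have "q j \<tau> i \<noteq> 0" using pair(4) by (simp add: pair_coefficient_sym[of Cp Cm j])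
    then show "q m \<sigma> j = q m (- \<sigma> * \<tau>) i"
      by (rule pair_relation[OF ij[symmetric] \<tau> _ that(2,1,3)])
  qed
  \<comment> \<open>The signed permutation of the axes induced by the reflection, separated into the
    transposition g and the signs e.\<close>
  define g where "g a = (if a = i then j else if a = j then i else a)" for a
  define e where "e a = (if a = i \<or> a = j then - \<tau> else 1)" for a
  have e: "e a \<in> {1, - 1}" for a using \<tau> by (auto simp: e_def)
  have refl: "reflection \<alpha> (axis a 1) = e a *\<^sub>R axis (g a) 1" for a
    unfolding pair(3) reflection_pair[OF ij \<tau>] by (simp add: e_def g_def)
  from assms(2) show ?thesis
  proof (cases rule: k_nonzero_cases)
    case (single a s)
    have "s * e a \<in> {1, - 1}" using single(1) e[of a] by auto
    then have "k (reflection \<alpha> \<gamma>) = C1 (g a)"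
      unfolding single reflection_scaleR refl scaleR_scaleR by (rule k_axis)
    moreover have "C1 (g a) = C1 a"
      using axis_pair_relation[OF ij \<tau> pair(4)] by (simp add: g_def)
    ultimately show ?thesis
      unfolding single k_axis[OF single(1)] by simp
  next
    case (pair a b s t)
    have st: "s * t \<in> {1, - 1}" using pair by auto
    have "s * e a \<in> {1, - 1}" "t * e b \<in> {1, - 1}" "g a \<noteq> g b"
      using pair e[of a] e[of b] by (auto simp: g_def split: if_splits)
    then have "k (reflection \<alpha> \<gamma>) = q (g a) ((s * e a) * (t * e b)) (g b)"
      unfolding pair reflection_add reflection_scaleR refl scaleR_scaleR by (intro k_pair)
    also have "(s * e a) * (t * e b) = (s * t) * (e a * e b)" by simp
    also have "q (g a) ((s * t) * (e a * e b)) (g b) = q a (s * t) b"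
    proof (cases "a \<in> {i, j}")
      case a: True
      show ?thesis
      proof (cases "b \<in> {i, j}")
        case True
        then have "e a * e b = 1" using a \<tau> by (auto simp: e_def)
        moreover have "(g a = a \<and> g b = b) \<or> (g a = b \<and> g b = a)"
          using a True pair(1) by (auto simp: g_def)
        ultimately show ?thesis
          using pair_coefficient_sym[of Cp Cm a _ b] by auto
      next
        case False
        then have b: "b \<noteq> i" "b \<noteq> j" by auto
        have "q b ((s * t) * - \<tau>) (g a) = q b (s * t) a"
          using a rel[OF b st] by (auto simp: g_def)
        then show ?thesis
          using a b by (auto simp: e_def g_def pair_coefficient_sym[of Cp Cm b])
      qed
    next
      case False
      then have a: "a \<noteq> i" "a \<noteq> j" by auto
      show ?thesis
      proof (cases "b \<in> {i, j}")
        case True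
        have "q a ((s * t) * - \<tau>) (g b) = q a (s * t) b"
          using True rel[OF a st] by (auto simp: g_def)
        then show ?thesis
          using a True by (auto simp: e_def g_def)
      next
        case False
        then show ?thesis using a by (auto simp: e_def g_def)
      qed
    qed
    also have "\<dots> = k \<gamma>"
      unfolding pair by (rule k_pair[OF pair(1-3), symmetric])
    finally show ?thesis .
  qed
qed

text \<open>If k vanished at \<gamma> but not at its image, the non-zero case at the image would
  contradict this, since reflecting twice gives \<gamma> back.\<close>

lemma k_reflection:
  assumes "\<alpha> \<in> H"
  shows "k (reflection \<alpha> \<gamma>) = k \<gamma>"
proof (cases "k \<gamma> = 0")
  case False
  then show ?thesis by (rule k_reflection_nonzero[OF assms])
next
  case True
  then show ?thesis
    using k_reflection_nonzero[OF assms, of "reflection \<alpha> \<gamma>"] unfolding reflection_involution by metis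
qed

lemma k_group: "w \<in> reflection_group H \<Longrightarrow> k (w \<gamma>) = k \<gamma>"
  by (rule reflection_group_invariant[of H k]) (rule k_reflection)

lemma coefficient_group_invariant:
  assumes "\<alpha> \<in> H" "\<beta> \<in> H" "w \<in> reflection_group H" "\<beta> = w \<alpha> \<or> \<beta> = - w \<alpha>"
  shows "c \<alpha> = c \<beta>"
proof -
  have "k \<beta> = k (w \<alpha>)" using assms(4) k_minus by auto
  also have "\<dots> = k \<alpha>" by (rule k_group[OF assms(3)])
  finally show ?thesis
    using k_root assms(1,2) in_H by metis
qed

section \<open>Classification of the singular set\<close>

text \<open>The reflection in e_j + \<tau> e_l fixes e_i and sends e_j to - \<tau> e_l.\<close>

lemma pair_coefficient_permute:
  assumes K: "\<And>\<delta> \<gamma>. \<delta> \<in> roots_D \<Longrightarrow> k (reflection \<delta> \<gamma>) = k \<gamma>"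
    and "j \<noteq> l" "i \<noteq> j" "i \<noteq> l" "\<tau> \<in> {1, - 1}" "\<sigma> \<in> {1, - 1}"
  shows "q i \<sigma> j = q i (- \<tau> * \<sigma>) l"
proof -
  have *: "k (reflection (pair_root j \<tau> l) \<gamma>) = k \<gamma>" if "j < l" for j l \<gamma>
    by (rule K) (use assms(5) that in \<open>auto simp: roots_D_def\<close>)
  have "k (reflection (pair_root j \<tau> l) \<gamma>) = k \<gamma>" for \<gamma>
  proof (cases "j < l")
    case False
    then have "l < j" using assms(2) by simp
    \<comment> \<open>The positive root has the smaller index in front; a factor \<tau> does not
      change the reflection.\<close>
    have "pair_root j \<tau> l = \<tau> *\<^sub>R pair_root l \<tau> j"
      using assms(5) by auto
    then have "reflection (pair_root j \<tau> l) \<gamma> = reflection (pair_root l \<tau> j) \<gamma>"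
      using assms(5) by (auto simp: reflection_def)
    then show ?thesis using *[OF \<open>l < j\<close>] by simp
  qed (rule *)
  from this[of "1 *\<^sub>R axis i 1 + \<sigma> *\<^sub>R axis j 1"]
  have "k (1 *\<^sub>R axis i 1 + (\<sigma> * - \<tau>) *\<^sub>R axis l 1) = k (1 *\<^sub>R axis i 1 + \<sigma> *\<^sub>R axis j 1)"
    unfolding reflection_add reflection_scaleR reflection_pair[OF assms(2,5)] using assms(2-4) by simp
  moreover have "k (1 *\<^sub>R axis i 1 + (\<sigma> * - \<tau>) *\<^sub>R axis l 1) = q i (1 * (\<sigma> * - \<tau>)) l"
    by (rule k_pair) (use assms in auto)
  moreover have "k (1 *\<^sub>R axis i 1 + \<sigma> *\<^sub>R axis j 1) = q i (1 * \<sigma>) j"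
    by (rule k_pair) (use assms in auto)
  ultimately show ?thesis by (simp add: mult.commute)
qed

text \<open>Signs are normalised to 1 by \<open>sign\<close>. Two pairs of indices are then linked
  by exchanging one index at a time, through {a, b'} unless b' = a.\<close>

lemma pair_coefficient_constant:
  assumes K: "\<And>\<delta> \<gamma>. \<delta> \<in> roots_D \<Longrightarrow> k (reflection \<delta> \<gamma>) = k \<gamma>"
    and sign: "\<And>i j. i \<noteq> j \<Longrightarrow> q i 1 j = q i (- 1) j"
    and "a \<noteq> b" "a' \<noteq> b'" "\<sigma> \<in> {1, - 1}" "\<sigma>' \<in> {1, - 1}"
  shows "q a \<sigma> b = q a' \<sigma>' b'"
proof -
  have s: "q i \<sigma> j = q i 1 j" if "i \<noteq> j" "\<sigma> \<in> {1, - 1}" for i j \<sigma>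
    using sign[OF that(1)] that(2) by auto
  have m: "q i 1 j = q i 1 l" if "i \<noteq> j" "i \<noteq> l" for i j l
    using pair_coefficient_permute[OF K, of j l i "- 1" 1] that by (cases "j = l") auto
  have "q a 1 b = q a' 1 b'"
  proof (cases "b' = a")
    case True
    then show ?thesis
      using m[of a b a'] assms(3,4) pair_coefficient_sym[of Cp Cm a] by auto
  next
    case False
    then have "q a 1 b = q b' 1 a"
      using m[of a b b'] assms(3) pair_coefficient_sym[of Cp Cm a] by auto
    also have "\<dots> = q b' 1 a'"
      using False assms(4) by (intro m) auto
    finally show ?thesis
      using pair_coefficient_sym[of Cp Cm b'] by auto
  qed
  then show ?thesis
    using s assms(3-6) by metis
qed

end

context root_setting
begin

lemma roots_D_subset: "roots_D \<subseteq> roots_B"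
  by (auto simp: roots_B_def)

lemma long_roots_in_H:
  assumes "\<And>i j \<sigma>. i < j \<Longrightarrow> \<sigma> \<in> {1, - 1} \<Longrightarrow> q i \<sigma> j \<noteq> 0"
  shows "roots_D \<subseteq> H"
proof
  fix \<delta> :: "real ^ 'n::_" assume "\<delta> \<in> roots_D"
  then obtain i j \<sigma> where "i < j" "\<sigma> \<in> {1, - 1 :: real}" "\<delta> = pair_root i \<sigma> j"
    unfolding roots_D_def by force
  then show "\<delta> \<in> H"
    using assms[of i j \<sigma>] pair_root_in_roots coefficient_pair_root in_H by metis
qed

text \<open>W contains the reflections of type D, so the coefficients of all e_i + e_j and e_i - e_j
  coincide; in type B so do those of all e_i. Hence H consists of complete length classes. It is
  non-empty because it spans, and it cannot be the set of axes because those split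
  orthogonally.\<close>

lemma classification:
  assumes irr: "irreducible_vectors H"
    and W: "(CARD('n) \<ge> 2 \<and> reflection_group H = reflection_group roots_B) \<or>
         (CARD('n) \<ge> 4 \<and> reflection_group H = reflection_group roots_D \<and> (\<forall>i. C1 i = 0))"
  shows "H = roots_B \<or> H = roots_D"
proof -
  have HB: "H \<subseteq> roots_B" using in_H by blast
  have "H \<noteq> {}"
  proof
    assume "H = {}"
    then have "(UNIV :: (real ^ 'n::_) set) = {0}"
      using irr by (simp add: irreducible_vectors_def)
    then have "axis undefined 1 = (0 :: real ^ 'n::_)" by blast
    then show False by (simp add: axis_eq_0_iff)
  qed
  have K: "k (reflection \<delta> \<gamma>) = k \<gamma>" if "\<delta> \<in> roots_D" for \<delta> \<gamma>
  proof (rule k_group)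
    show "reflection \<delta> \<in> reflection_group H"
      using W that roots_D_subset reflection_in_group by (metis subsetD)
  qed
  \<comment> \<open>In type B the reflection in e_j changes the sign. In type D that reflection is
    missing, but with a third index l two different reflections carry both roots to e_i - e_l up to
    sign.\<close>
  have sign: "q i 1 j = q i (- 1) j" if ij: "i \<noteq> j" for i j
    using W
  proof
    assume "CARD('n) \<ge> 2 \<and> reflection_group H = reflection_group roots_B"
    then have "reflection (axis j 1) \<in> reflection_group H"
      using reflection_in_group[of "axis j 1" roots_B] by (auto simp: roots_B_def)
    then have "k (reflection (axis j 1) (1 *\<^sub>R axis i 1 + 1 *\<^sub>R axis j 1)) = k (1 *\<^sub>R axis i 1 + 1 *\<^sub>R axis j 1)"
      by (rule k_group)
    then have "k (1 *\<^sub>R axis i 1 + (- 1) *\<^sub>R axis j 1) = k (1 *\<^sub>R axis i 1 + 1 *\<^sub>R axis j 1)"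
      unfolding reflection_add reflection_scaleR reflection_axis using ij by simp
    then show ?thesis
      using k_pair[OF ij, of 1 1] k_pair[OF ij, of 1 "- 1"] by simp
  next
    assume "CARD('n) \<ge> 4 \<and> reflection_group H = reflection_group roots_D \<and> (\<forall>i. C1 i = 0)"
    then have "card {i, j} \<noteq> CARD('n)"
      using ij by simp
    then have "{i, j} \<noteq> UNIV" by auto
    then obtain l where l: "l \<noteq> i" "l \<noteq> j"
      by blast
    have "q i 1 j = q i (- 1 * 1) l"
      by (rule pair_coefficient_permute[OF K]) (use l ij in auto)
    moreover have "q i (- 1) j = q i (- (- 1) * - 1) l"
      by (rule pair_coefficient_permute[OF K]) (use l ij in auto)
    ultimately show ?thesis by simp
  qed
  have const: "q a \<sigma> b = q a' \<sigma>' b'" if "a \<noteq> b" "a' \<noteq> b'" "\<sigma> \<in> {1, - 1}" "\<sigma>' \<in> {1, - 1}" for a b a' b' \<sigma> \<sigma>'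
    by (rule pair_coefficient_constant[OF K sign that])
  have long: "roots_D \<subseteq> H" if "i < j" "\<tau> \<in> {1, - 1}" "q i \<tau> j \<noteq> 0" for i j \<tau>
  proof (rule long_roots_in_H)
    fix a b \<sigma> assume "a < (b :: 'n)" "\<sigma> \<in> {1, - 1 :: real}"
    then have "q a \<sigma> b = q i \<tau> j"
      using that by (intro const) auto
    then show "q a \<sigma> b \<noteq> 0" using that(3) by simp
  qed
  from W show ?thesis
  proof
    assume B: "CARD('n) \<ge> 2 \<and> reflection_group H = reflection_group roots_B"
    have C1_less: "C1 i = C1 j" if "i < j" for i j
    proof -
      have "pair_root i (- 1) j \<in> roots_D"
        using that by (auto simp: roots_D_def)
      from K[OF this, of "1 *\<^sub>R axis i 1"] have "k (1 *\<^sub>R axis j 1) = k (1 *\<^sub>R axis i 1)"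
        using that unfolding reflection_scaleR by (subst (asm) reflection_pair) auto
      then show ?thesis
        using k_axis[of 1] by simp
    qed
    have C1_const: "C1 i = C1 j" for i j
    proof (cases i j rule: linorder_cases)
      case less
      then show ?thesis by (rule C1_less)
    next
      case greater
      then show ?thesis by (rule C1_less[symmetric])
    qed simp
    have short: "range (\<lambda>i. axis i 1) \<subseteq> H" if "C1 i \<noteq> 0" for i
    proof
      fix \<delta> :: "real ^ 'n::_" assume "\<delta> \<in> range (\<lambda>i. axis i 1)"
      then obtain j where "\<delta> = axis j 1" by blast
      then show "\<delta> \<in> H"
        using C1_const[of i j] that by (auto simp: in_H roots_B_def coefficient_axis)
    qed
    show ?thesis
    proof (cases "\<exists>i. C1 i \<noteq> 0")
      case True
      then have sub: "range (\<lambda>i. axis i 1) \<subseteq> H" using short by blast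
      show ?thesis
      proof (cases "\<exists>i j \<tau>. i < j \<and> \<tau> \<in> {1, - 1} \<and> q i \<tau> j \<noteq> 0")
        case True
        then have "roots_D \<subseteq> H" using long by blast
        then have "roots_B \<subseteq> H" using sub by (auto simp: roots_B_def)
        then show ?thesis using HB by blast
      next
        case False
        have Hr: "H = range (\<lambda>i. axis i 1)"
        proof
          show "H \<subseteq> range (\<lambda>i. axis i 1)"
          proof
            fix \<alpha> assume "\<alpha> \<in> H"
            then show "\<alpha> \<in> range (\<lambda>i. axis i 1)"
              by (cases rule: H_cases) (use False in blast)+
          qed
        qed (rule sub)
        \<comment> \<open>As n is at least 2 there are two distinct axes, and a single axis split
          off from the others contradicts irreducibility.\<close>
        have "(UNIV :: 'n set) \<noteq> {undefined}"
        proof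
          assume "(UNIV :: 'n set) = {undefined}"
          then have "CARD('n) = card {undefined :: 'n}" by (rule arg_cong)
          then show False using B by simp
        qed
        then obtain i j :: 'n where ij: "i \<noteq> j" by blast
        let ?A = "{axis i 1 :: real ^ 'n::_}"
        have ei: "axis i 1 \<in> H" and ej: "axis j 1 \<in> H" and eij: "axis j 1 \<notin> ?A"
          using ij by (auto simp: Hr axis_eq_axis)
        have "?A \<subset> H" using ei ej eij by (metis empty_subsetI insert_subset psubsetI)
        moreover have "H - ?A \<subset> H" using ei by blast
        moreover have "?A \<union> (H - ?A) = H" using ei by blast
        moreover have "?A \<inter> (H - ?A) = {}" by blast
        moreover have "\<forall>a\<in>?A. \<forall>b\<in>H - ?A. orthogonal a b"
          unfolding Hr by (auto simp: orthogonal_def inner_axis_axis split: if_splits)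
        ultimately have "\<exists>A B. A \<subset> H \<and> B \<subset> H \<and> A \<union> B = H \<and> A \<inter> B = {} \<and> (\<forall>a\<in>A. \<forall>b\<in>B. orthogonal a b)"
          by (intro exI[of _ ?A] exI[of _ "H - ?A"] conjI)
        then have False
          using irr by (simp add: irreducible_vectors_def)
        then show ?thesis ..
      qed
    next
      case False
      obtain \<alpha> where "\<alpha> \<in> H" using \<open>H \<noteq> {}\<close> by blast
      then have "roots_D \<subseteq> H"
        by (cases rule: H_cases) (use False long in blast)+
      moreover have "H \<subseteq> roots_D"
      proof
        fix \<alpha> assume "\<alpha> \<in> H"
        then have "\<alpha> \<in> roots_B" "c \<alpha> \<noteq> 0" by (simp_all add: in_H)
        then show "\<alpha> \<in> roots_D" using False by (auto simp: roots_B_def coefficient_axis)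
      qed
      ultimately show ?thesis by blast
    qed
  next
    assume "CARD('n) \<ge> 4 \<and> reflection_group H = reflection_group roots_D \<and> (\<forall>i. C1 i = 0)"
    then have C1_zero: "C1 i = 0" for i by blast
    obtain \<alpha> where "\<alpha> \<in> H" using \<open>H \<noteq> {}\<close> by blast
    then have "roots_D \<subseteq> H"
      by (cases rule: H_cases) (use C1_zero long in blast)+
    moreover have "H \<subseteq> roots_D"
    proof
      fix \<alpha> assume "\<alpha> \<in> H"
      then have "\<alpha> \<in> roots_B" "c \<alpha> \<noteq> 0" by (simp_all add: in_H)
      then show "\<alpha> \<in> roots_D" using C1_zero by (auto simp: roots_B_def coefficient_axis)
    qed
    ultimately show ?thesis by blast
  qed
qed

end

theorem proposition7p4:
  fixes Cp Cm :: "'n::{finite,linorder} \<Rightarrow> 'n \<Rightarrow> complex"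
    and C1 :: "'n \<Rightarrow> complex"
    and Rt :: "real ^ 'n::_ \<Rightarrow> complex"
    and r :: real
    and a2 a1 :: "'n \<Rightarrow> real ^ 'n::_ \<Rightarrow> complex"
    and a11 :: "'n \<Rightarrow> 'n \<Rightarrow> real ^ 'n::_ \<Rightarrow> complex"
    and a0 :: "real ^ 'n::_ \<Rightarrow> complex"
    and H D :: "(real ^ 'n::_) set"
    and W :: "(real ^ 'n::_ \<Rightarrow> real ^ 'n::_) set"
  defines "H \<equiv> singular_vectors Cp Cm C1"
    and "W \<equiv> reflection_group H"
    and "D \<equiv> ball 0 r - (\<Union>\<alpha>\<in>H. {x. \<alpha> \<bullet> x = 0})"
  assumes "r > 0" and "real_analytic_on (ball 0 r) Rt"
    and "irreducible_vectors H"
    and "generic Cp Cm C1"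
    and "(CARD('n) \<ge> 2 \<and> W = reflection_group roots_B) \<or>
         (CARD('n) \<ge> 4 \<and> W = reflection_group roots_D \<and> (\<forall>i. C1 i = 0))"
    and "\<And>i. real_analytic_on D (a2 i)"
    and "\<And>i j. i < j \<Longrightarrow> real_analytic_on D (a11 i j)"
    and "\<And>i. real_analytic_on D (a1 i)"
    and "real_analytic_on D a0"
    and "commute_on D (schroedinger_op (potential Cp Cm C1 Rt)) (quartic_op a2 a11 a1 a0)"
  shows "(H = roots_B \<or> H = roots_D) \<and>
    (\<forall>\<alpha>\<in>H. \<forall>\<beta>\<in>H. (\<exists>w\<in>W. \<beta> = w \<alpha> \<or> \<beta> = - w \<alpha>) \<longrightarrow>
       coefficient Cp Cm C1 \<alpha> = coefficient Cp Cm C1 \<beta>)"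
proof -
  note H_eq = H_def and W_eq = W_def and D_eq = D_def
  have setting: "root_setting Cp Cm C1 Rt r a2 a1 a11 a0 H D"
    by (rule root_setting.intro) (fact H_eq[THEN meta_eq_to_obj_eq] D_eq[THEN meta_eq_to_obj_eq] assms)+
  have "H = roots_B \<or> H = roots_D"
    by (rule root_setting.classification[OF setting]) (fact | use assms in \<open>simp only: W_eq\<close>)+
  moreover have "coefficient Cp Cm C1 \<alpha> = coefficient Cp Cm C1 \<beta>"
    if "\<alpha> \<in> H" "\<beta> \<in> H" "\<exists>w\<in>W. \<beta> = w \<alpha> \<or> \<beta> = - w \<alpha>" for \<alpha> \<beta>
    using root_setting.coefficient_group_invariant[OF setting that(1,2)] that(3)
    unfolding W_eq by blast
  ultimately show ?thesis
    by blast
qed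

end
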